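(* Let $d\in\mathbb{N}$, $-2<s<d$, $m\ge1$, and let $(x_n)_{n\in\mathbb{N}}$ be a greedy sequence of points on $\mathbb{S}^d$ with respect to $K_s$ with fixed arbitrary initial points $x_1,\dots,x_m\in\mathbb{S}^d$. Let $\omega_{N,d}$ denote the set of the first $N$ points of this sequence. Then there exists a positive constant $C'_{s,d}$ such that for all $N>m$ the following hold. (1) For $0\le s<d$, $$E_{K_s}(\omega_{N,d})\le\mathcal{I}_{s,d}(N^2-m^2)-C'_{s,d}\big(N^{1+\frac sd}-m^{1+\frac sd}\big)-\mathcal{I}_{s,d}(N-m)+E_{K_s}(\omega_{m,d})+\mathcal{O}(N^{\frac sd}).$$ (2) For $-2<s\le0$ if $d\ge2$, and for $-1<s\le0$ if $d=1$, $$E_{K_s}(\omega_{N,d})\le\mathcal{I}_{s,d}(N^2-m^2)-\mathcal{I}_{s,d}(N-m)-C'_{s,d}\big(N^{1+\frac sd}-m^{1+\frac sd}\big)+E_{K_s}(\omega_{m,d})+\mathcal{O}(1).$$ (3) For $d=1$ and $s=-1$, $$E_{K_{-1}}(\omega_{N,1})\le\mathcal{I}_{-1,1}(N^2-m^2)-\mathcal{I}_{-1,1}(N-m)-C'_{-1,1}(\log(N)-\log(m))+E_{K_{-1}}(\omega_{m,1})+\mathcal{O}(1).$$ (4) For $d=1$ and $-2<s<-1$, $$E_{K_s}(\omega_{N,1})\le\mathcal{I}_{s,1}(N^2-m^2)-\mathcal{I}_{s,1}(N-m)+E_{K_s}(\omega_{m,1})+\mathcal{O}(N^{1+s})+\m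athcal{O}(m^{1+s}).$$
   Context: $\mathbb{S}^d\subset\mathbb{R}^{d+1}$ is the unit sphere with Euclidean norm $\|\cdot\|$, and $\sigma_d$ is the surface measure normalized by $\sigma_d(\mathbb{S}^d)=1$. The Riesz $s$-kernel is $K_s(x,y)=\operatorname{sgn}(s)\|x-y\|^{-s}$ for $s\ne0$ and $K_0(x,y)=-\log\|x-y\|$ (with value $+\infty$ at $x=y$ when $s\ge0$). The discrete energy of $\omega_{N,d}=\{x_1,\dots,x_N\}$ is $E_{K}(\omega_{N,d})=2\sum_{1\le i<j\le N}K(x_i,x_j)$. For $s<d$, $\mathcal{I}_{s,d}=\int_{\mathbb{S}^d}\int_{\mathbb{S}^d}K_s(x,y)\,d\sigma_d(x)\,d\sigma_d(y)$. A greedy sequence for $K_s$ with initial points $x_1,\dots,x_m$ is a sequence such that for every $N\ge m$, $x_{N+1}$ is a minimizer (any one, if not unique) over $x\in\mathbb{S}^d$ of $\sum_{i=1}^{N}K_s(x,x_i)$. The constant $C'_{s,d}$ and all constants implied by $\mathcal{O}(\cdot)$ depend only on $s$ and $d$. *)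

theory Defs
  imports "HOL-Probability.Probability"
begin

text \<open>
  Values are extended reals because the kernel is infinite on the diagonal for \<open>s \<ge> 0\<close>.
  For \<open>s < 0\<close> the last branch also covers \<open>x = y\<close>, where it gives 0.
\<close>

definition riesz_kernel :: "real \<Rightarrow> 'a::metric_space \<Rightarrow> 'a \<Rightarrow> ereal" where
  "riesz_kernel s x y =
     (if x = y \<and> s \<ge> 0 then \<infinity>
      else if s = 0 then ereal (- ln (dist x y))
      else ereal (sgn s * dist x y powr (- s)))"

text \<open>
  A configuration is the family of the first \<open>N\<close> terms \<open>x 1, \<dots>, x N\<close> of a sequence
  (the value \<open>x 0\<close> is never used), so that repeated points count with multiplicity.
\<close>

definition discrete_energy :: "('a \<Rightarrow> 'a \<Rightarrow> ereal) \<Rightarrow> (nat \<Rightarrow> 'a) \<Rightarrow> nat \<Rightarrow> ereal" where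
  "discrete_energy K x N = 2 * (\<Sum>i\<in>{1..N}. \<Sum>j\<in>{i<..N}. K (x i) (x j))"

text \<open>
  Normalized surface measure on the unit sphere, defined by polar coordinates as the cone
  measure: a Borel set \<open>A\<close> gets the proportion of the volume of the unit ball that lies over
  \<open>A\<close> under radial projection. It lives on the Borel sets of the ambient space and is
  concentrated on \<open>sphere 0 1\<close>; the centre of the ball is a null set.
\<close>

definition sphere_measure :: "'a::euclidean_space measure" where
  "sphere_measure = distr (uniform_measure lborel (ball 0 1)) borel (\<lambda>x. x /\<^sub>R norm x)"

text \<open>
  \<open>real_of_ereal\<close> sends \<open>\<infinity>\<close> to 0. For Riesz kernels this changes the integrand only on the
  diagonal, whose sections are null sets for the sphere measure in ambient dimension
  at least 2.
\<close>

definition continuous_energy :: "('a \<Rightarrow> 'a \<Rightarrow> ereal) \<Rightarrow> 'a measure \<Rightarrow> real" where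
  "continuous_energy K \<mu> = (\<integral>x. (\<integral>y. real_of_ereal (K x y) \<partial>\<mu>) \<partial>\<mu>)"

definition greedy_sequence ::
    "('a::real_normed_vector \<Rightarrow> 'a \<Rightarrow> ereal) \<Rightarrow> nat \<Rightarrow> (nat \<Rightarrow> 'a) \<Rightarrow> bool" where
  "greedy_sequence K m x \<longleftrightarrow>
     (\<forall>i\<in>{1..m}. x i \<in> sphere 0 1) \<and>
     (\<forall>N\<ge>m. is_arg_min (\<lambda>y. \<Sum>i=1..N. K y (x i)) (\<lambda>y. y \<in> sphere 0 1) (x (N + 1)))"

lemma prob_space_sphere_measure: "prob_space (sphere_measure :: 'a::euclidean_space measure)"
proof -
  have "emeasure lborel (ball (0::'a) 1) \<noteq> 0"
    using open_not_negligible[of "ball (0::'a) 1"]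
    by (auto simp: negligible_iff_emeasure0)
  moreover have "emeasure lborel (ball (0::'a) 1) \<noteq> \<infinity>"
    using emeasure_lborel_ball_finite[of "0::'a" 1] by simp
  ultimately have "prob_space (uniform_measure lborel (ball (0::'a) 1))"
    by (rule prob_space_uniform_measure)
  then show ?thesis
    unfolding sphere_measure_def by (rule prob_space.prob_space_distr) simp
qed

lemma AE_sphere_measure: "AE x in (sphere_measure :: 'a::euclidean_space measure). x \<in> sphere 0 1"
proof -
  have "AE x in lborel. x \<noteq> (0::'a)"
    by (rule AE_lborel_singleton)
  then have "AE x in lborel. x \<in> ball 0 1 \<longrightarrow> x /\<^sub>R norm x \<in> sphere (0::'a) 1"
    by eventually_elim simp
  then have "AE x in uniform_measure lborel (ball (0::'a) 1). x /\<^sub>R norm x \<in> sphere (0::'a) 1"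
    by (intro AE_uniform_measureI) auto
  then show ?thesis
    unfolding sphere_measure_def by (subst AE_distr_iff) auto
qed

end

theory Submission
  imports Defs
begin

text \<open>
  Adding a point to a greedy sequence adds twice the minimum of the current potential, so everything
  follows from a polarization bound: for some \<open>c > 0\<close> and arbitrary points \<open>x 1, \<dots>, x N\<close> of the sphere,
  the minimum of \<open>\<Sum>i. K y (x i)\<close> over \<open>y\<close> is at most \<open>N I - c N powr (s / d)\<close>.

  The function \<open>f y = (\<Sum>i. K y (x i) - I)\<close> has mean zero, so its minimum is bounded above by
  testing \<open>f\<close> against a function \<open>\<rho>\<close> that is bounded by a constant: it suffices that
  \<open>\<integral> f \<rho> \<le> - c N powr (s / d)\<close>. Inversions preserving the sphere
  are conformal, and transporting the constant potential of the surface measure by them gives explicit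
  functions, concentrated near \<open>z\<close> at scale \<open>sqrt \<theta>\<close>, whose potential at \<open>x\<close> is a multiple
  of \<open>(\<theta> + |x - z|\<^sup>2) powr (- s / 2)\<close>. Taking a finite difference of order \<open>d + 1\<close> in \<open>\<theta>\<close> turns the
  potential into a positive bump with integrable tails. Now let \<open>\<rho>\<close> be the superposition
  over all centres \<open>z\<close> at distance at least of order \<open>N powr (- 1 / d)\<close> from every \<open>x i\<close>: since these
  centres fill half of the sphere but the \<open>x i\<close> only see the tails of the bumps, the potential
  of \<open>\<rho>\<close> at every \<open>x i\<close> lies below its mean by a constant times \<open>N powr (s / d - 1)\<close>.
\<close>

subsection \<open>Change of variables on the sphere\<close>

text \<open>Averaging the potential over the sphere yields only the linear term \<open>N I\<close>;
  the gain needs a weight whose size does not grow with \<open>N\<close>. Individual bubbles become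
  unbounded as \<theta> tends to 0, but their integrals do not. The densities built from them are
  symmetric in centre and argument, so a bound on their integral in the argument is at the same time
  a pointwise bound on every superposition over centres, whatever set of centres is chosen. This
  leaves complete freedom to avoid the given points. The exponent is a matter of scaling: with
  \<theta> of order \<open>N powr (- 2 / d)\<close> a bump has mean of order
  \<open>\<theta> powr ((d - s) / 2)\<close>, that is \<open>N powr (s / d - 1)\<close>, and there
  are \<open>N\<close> points. The condition \<open>s > - 2\<close> enters through the derivatives
  of the kernel as a function of the squared distance: exactly then their signs alternate from the
  first one on, for kernels of either sign. The bound for one greedy step has no error term, and
  summation over the steps creates none, so the remainders in the theorem are obtained with constant
  0.\<close>

lemma det_scaled_off_axis:
  fixes e :: "real^'n" and J :: real
  assumes e: "norm e = 1"
  shows "det (matrix (\<lambda>v. J *\<^sub>R v + ((1 - J) * (e \<bullet> v)) *\<^sub>R e)) = J ^ (CARD('n) - 1)"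
proof -
  fix k :: 'n
  \<comment> \<open>\<open>M\<close> fixes \<open>e\<close> and scales its orthogonal complement by
    \<open>J\<close>. \<open>D\<close> does the same with a coordinate axis in place of
    \<open>e\<close>, where the matrix is diagonal; an orthogonal map conjugates one into the
    other.\<close>
  define M where "M = (\<lambda>v. J *\<^sub>R v + ((1 - J) * (e \<bullet> v)) *\<^sub>R e)"
  define D where "D = (\<lambda>v::real^'n. J *\<^sub>R v + ((1 - J) * (v $ k)) *\<^sub>R axis k 1)"
  have "norm (axis k 1 :: real^'n) = 1" by simp
  from orthogonal_transformation_exists_1[OF this e]
  obtain f :: "real^'n \<Rightarrow> real^'n" where f: "orthogonal_transformation f" "f (axis k 1) = e"
    by blast
  have lf: "linear f" using f(1) orthogonal_transformation_linear by blast
  have lM: "linear M" unfolding M_def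
    by (auto intro!: linearI simp: algebra_simps inner_add_right)
  have lD: "linear D" unfolding D_def
    by (auto intro!: linearI simp: algebra_simps)
  have "M (f v) = f (D v)" for v
  proof -
    have "e \<bullet> f v = v $ k"
      using f by (metis orthogonal_transformation_def cart_eq_inner_axis inner_commute)
    then show ?thesis
      by (simp add: M_def D_def linear_add[OF lf] linear_cmul[OF lf] f(2))
  qed
  then have "M \<circ> f = f \<circ> D" by auto
  then have "matrix M ** matrix f = matrix f ** matrix D"
    by (metis lD lM lf matrix_compose)
  then have eq: "det (matrix M) * det (matrix f) = det (matrix f) * det (matrix D)"
    by (metis det_mul)
  have "\<bar>det (matrix f)\<bar> = 1" using f(1) by simp
  with eq have "det (matrix M) = det (matrix D)" by (auto simp: mult.commute)
  also have "det (matrix D) = (\<Prod>i\<in>UNIV. if i = k then 1 else J)"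
    by (subst det_diagonal)
      (auto simp: matrix_def D_def axis_def intro!: prod.cong)
  also have "\<dots> = J ^ (CARD('n) - 1)"
    by (simp add: prod.If_cases card_Diff_subset Compl_eq_Diff_UNIV)
  finally show ?thesis by (simp add: M_def)
qed

text \<open>The centre is a null set. Without it the preimage is a genuine cone, on which polar
  decomposition is injective.\<close>

lemma emeasure_sphere_measure:
  assumes "A \<in> sets borel"
  shows "emeasure (sphere_measure :: 'a::euclidean_space measure) A =
    emeasure lborel {x \<in> ball 0 1 - {0}. x /\<^sub>R norm x \<in> A} / emeasure lborel (ball (0::'a) 1)"
proof -
  have [measurable]: "A \<in> sets borel" by fact
  have pre: "(\<lambda>x::'a. x /\<^sub>R norm x) -` A \<in> sets borel"
    using measurable_sets[OF _ \<open>A \<in> sets borel\<close>, of "\<lambda>x::'a. x /\<^sub>R norm x" borel] by simp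
  have "emeasure (sphere_measure :: 'a measure) A =
      emeasure lborel (ball 0 1 \<inter> (\<lambda>x. x /\<^sub>R norm x) -` A) / emeasure lborel (ball (0::'a) 1)"
    unfolding sphere_measure_def
    using pre by (subst emeasure_distr) (auto simp: emeasure_uniform_measure)
  also have "emeasure lborel (ball 0 1 \<inter> (\<lambda>x. x /\<^sub>R norm x) -` A) =
      emeasure lborel {x \<in> ball 0 1 - {0::'a}. x /\<^sub>R norm x \<in> A}"
  proof (rule emeasure_eq_AE)
    have "AE x in lborel. x \<noteq> (0::'a)" by (rule AE_lborel_singleton)
    then show "AE x in lborel. (x \<in> ball 0 1 \<inter> (\<lambda>x. x /\<^sub>R norm x) -` A) =
        (x \<in> {x \<in> ball 0 1 - {0::'a}. x /\<^sub>R norm x \<in> A})"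
      by eventually_elim auto
    show "ball 0 1 \<inter> (\<lambda>x::'a. x /\<^sub>R norm x) -` A \<in> sets lborel" using pre by simp
    have "{x \<in> ball 0 1 - {0::'a}. x /\<^sub>R norm x \<in> A} = (ball 0 1 - {0}) \<inter> (\<lambda>x::'a. x /\<^sub>R norm x) -` A"
      by auto
    then show "{x \<in> ball 0 1 - {0::'a}. x /\<^sub>R norm x \<in> A} \<in> sets lborel"
      using pre by simp
  qed
  finally show ?thesis .
qed

text \<open>
  The change of variables is carried out in the ball, for the extension of \<open>\<phi>\<close> that is
  homogeneous of degree 1: it preserves the norm, hence is compatible with the cone measure.
\<close>

lemma sphere_measure_change_of_variables:
  fixes \<phi> :: "real^'n::{finite,wellorder} \<Rightarrow> real^'n::_"
  assumes meas [measurable]: "\<phi> \<in> borel_measurable borel" "w \<in> borel_measurable borel"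
    and bij: "bij_betw \<phi> (sphere 0 1) (sphere 0 1)"
    and der: "\<And>x. x \<noteq> 0 \<Longrightarrow> ((\<lambda>x. norm x *\<^sub>R \<phi> (x /\<^sub>R norm x)) has_derivative \<Phi>' x) (at x)"
    and det: "\<And>x. x \<noteq> 0 \<Longrightarrow> \<bar>det (matrix (\<Phi>' x))\<bar> = w (x /\<^sub>R norm x)"
  shows "distr (density sphere_measure (\<lambda>x. ennreal (w x))) borel \<phi> = sphere_measure"
proof (rule measure_eqI)
  let ?N = "\<lambda>x::real^'n::_. x /\<^sub>R norm x"
  let ?F = "\<lambda>x::real^'n::_. norm x *\<^sub>R \<phi> (?N x)"
  let ?V = "emeasure lborel (ball (0::real^'n::_) 1)"
  have [measurable_cong]: "sets (sphere_measure :: (real^'n::_) measure) = sets borel"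
    by (simp add: sphere_measure_def)
  show "sets (distr (density sphere_measure (\<lambda>x. ennreal (w x))) borel \<phi>) = sets sphere_measure"
    by (simp add: sphere_measure_def)
  fix A assume "A \<in> sets (distr (density sphere_measure (\<lambda>x. ennreal (w x))) borel \<phi>)"
  then have A [measurable]: "A \<in> sets borel" by simp
  \<comment> \<open>\<open>S\<close> is the cone over the preimage of \<open>A\<close>,
    \<open>T\<close> the cone over \<open>A\<close>. The homogeneous extension \<open>?F\<close>
    maps the first bijectively onto the second.\<close>
  define S where "S = {x \<in> ball 0 1 - {0}. \<phi> (?N x) \<in> A}"
  define T where "T = {x \<in> ball 0 1 - {0}. ?N x \<in> A}"
  have pre: "f -` A \<in> sets borel" if "f \<in> borel_measurable borel" for f :: "real^'n::_ \<Rightarrow> real^'n::_"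
    using measurable_sets[OF that A] by simp
  have S_meas [measurable]: "S \<in> sets borel"
  proof -
    have "(\<lambda>x. \<phi> (?N x)) -` A \<in> sets borel" by (intro pre) measurable
    moreover have "S = (ball 0 1 - {0}) \<inter> (\<lambda>x. \<phi> (?N x)) -` A" by (auto simp: S_def)
    ultimately show ?thesis by simp
  qed
  have T_meas [measurable]: "T \<in> sets borel"
  proof -
    have "?N -` A \<in> sets borel" by (intro pre) measurable
    moreover have "T = (ball 0 1 - {0}) \<inter> ?N -` A" by (auto simp: T_def)
    ultimately show ?thesis by simp
  qed
  have N_sphere: "?N x \<in> sphere 0 1" if "x \<noteq> 0" for x using that by simp
  have phi_norm: "norm (\<phi> (?N x)) = 1" if "x \<noteq> 0" for x
    using bij_betwE[OF bij] N_sphere[OF that] by auto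
  have F_norm: "norm (?F x) = norm x" if "x \<noteq> 0" for x
    using phi_norm[OF that] by simp
  have F_N: "?N (?F x) = \<phi> (?N x)" if "x \<noteq> 0" for x
    using that F_norm[OF that] by simp
  have inj: "inj_on ?F S"
  proof (rule inj_onI)
    fix x y assume "x \<in> S" "y \<in> S" and eq: "?F x = ?F y"
    then have nz: "x \<noteq> 0" "y \<noteq> 0" by (auto simp: S_def)
    have "norm x = norm y" using F_norm nz eq by metis
    moreover have "\<phi> (?N x) = \<phi> (?N y)" using F_N nz eq by metis
    then have "?N x = ?N y"
      using bij N_sphere nz by (meson bij_betw_imp_inj_on inj_onD)
    ultimately show "x = y" using nz by simp
  qed
  have img: "?F ` S = T"
  proof (intro equalityI subsetI)
    fix y assume "y \<in> ?F ` S"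
    then obtain x where x: "x \<in> S" "y = ?F x" by blast
    then have nz: "x \<noteq> 0" by (auto simp: S_def)
    have "norm y = norm x" using F_norm[OF nz] x by simp
    moreover have "?N y = \<phi> (?N x)" using F_N[OF nz] x by simp
    ultimately show "y \<in> T" using x(1) nz by (auto simp: S_def T_def)
  next
    fix y assume y: "y \<in> T"
    then have nz: "y \<noteq> 0" by (auto simp: T_def)
    obtain p where p: "p \<in> sphere 0 1" "\<phi> p = ?N y"
      using bij N_sphere[OF nz] by (metis bij_betw_imp_surj_on imageE)
    have x: "?N (norm y *\<^sub>R p) = p" "norm (norm y *\<^sub>R p) = norm y" "norm y *\<^sub>R p \<noteq> 0"
      using p(1) nz by auto
    have "norm y *\<^sub>R p \<in> S" using y p x by (auto simp: S_def T_def)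
    moreover have "?F (norm y *\<^sub>R p) = norm y *\<^sub>R \<phi> p" using p(1) nz by simp
    then have "?F (norm y *\<^sub>R p) = y" unfolding p(2) using nz by simp
    ultimately show "y \<in> ?F ` S" by (intro image_eqI[where x = "norm y *\<^sub>R p"]) (rule sym)
  qed
  have T_fin: "T \<in> lmeasurable"
  proof (rule bounded_set_imp_lmeasurable)
    show "bounded T" unfolding T_def by (rule bounded_subset[OF bounded_ball[of 0 1]]) auto
  qed simp
  have "((\<lambda>x. \<bar>det (matrix (\<Phi>' x))\<bar>) has_integral measure lebesgue T) S"
  proof (rule iffD1[OF has_measure_differentiable_image[of S ?F \<Phi>' "measure lebesgue T"]])
    show "S \<in> sets lebesgue" by simp
    show "(?F has_derivative \<Phi>' x) (at x within S)" if "x \<in> S" for x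
      using der that by (auto simp: S_def intro: has_derivative_at_withinI)
    show "?F ` S \<in> lmeasurable \<and> measure lebesgue (?F ` S) = measure lebesgue T"
      using img T_fin by simp
  qed (rule inj)
  then have hi: "((\<lambda>x. \<bar>w (?N x)\<bar>) has_integral measure lebesgue T) S"
    by (rule has_integral_eq[rotated]) (use det in \<open>auto simp: S_def simp flip: det\<close>)
  have "(\<integral>\<^sup>+ x. indicator S x * ennreal \<bar>w (?N x)\<bar> \<partial>lborel) =
      (\<integral>\<^sup>+ x. ennreal (if x \<in> S then \<bar>w (?N x)\<bar> else 0) \<partial>lborel)"
    by (intro nn_integral_cong) (simp add: indicator_def)
  also have "\<dots> = measure lebesgue T"
    by (rule nn_integral_has_integral_lborel)
      (use hi in \<open>simp_all add: has_integral_restrict_UNIV\<close>)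
  also have "\<dots> = emeasure lborel T"
    using emeasure_eq_ennreal_measure[OF fmeasurableD2[OF T_fin]] by simp
  finally have key: "(\<integral>\<^sup>+ x. indicator S x * ennreal \<bar>w (?N x)\<bar> \<partial>lborel) = emeasure lborel T" .
  have "emeasure (distr (density sphere_measure (\<lambda>x. ennreal (w x))) borel \<phi>) A =
      (\<integral>\<^sup>+ x. ennreal (w x) * indicator (\<phi> -` A) x \<partial>sphere_measure)"
    by (subst emeasure_distr; simp add: space_density; subst emeasure_density)
      (auto simp: sphere_measure_def intro: pre)
  also have "\<dots> = (\<integral>\<^sup>+ x. ennreal (w (?N x)) * indicator (\<phi> -` A) (?N x)
      \<partial>uniform_measure lborel (ball 0 1))"
    unfolding sphere_measure_def using pre[of \<phi>]
    by (subst nn_integral_distr) auto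
  also have "\<dots> = (\<integral>\<^sup>+ x. ennreal (w (?N x)) * indicator (\<phi> -` A) (?N x) * indicator (ball 0 1) x \<partial>lborel) / ?V"
    using pre[of \<phi>] by (subst nn_integral_uniform_measure) auto
  also have "(\<integral>\<^sup>+ x. ennreal (w (?N x)) * indicator (\<phi> -` A) (?N x) * indicator (ball 0 1) x \<partial>lborel) =
     (\<integral>\<^sup>+ x. indicator S x * ennreal \<bar>w (?N x)\<bar> \<partial>lborel)"
  proof (rule nn_integral_cong_AE)
    have "AE x in lborel. x \<noteq> (0::real^'n::_)" by (rule AE_lborel_singleton)
    then show "AE x in lborel. ennreal (w (?N x)) * indicator (\<phi> -` A) (?N x) * indicator (ball 0 1) x =
        indicator S x * ennreal \<bar>w (?N x)\<bar>"
    proof eventually_elim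
      fix x :: "real^'n::_" assume "x \<noteq> 0"
      then have "w (?N x) \<ge> 0" using det by (metis abs_ge_zero)
      with \<open>x \<noteq> 0\<close> show "ennreal (w (?N x)) * indicator (\<phi> -` A) (?N x) * indicator (ball 0 1) x =
        indicator S x * ennreal \<bar>w (?N x)\<bar>"
        by (auto simp: S_def indicator_def)
    qed
  qed
  also note key
  also have "emeasure lborel T / ?V = emeasure sphere_measure A"
    unfolding T_def by (rule emeasure_sphere_measure[symmetric]) simp
  finally show "emeasure (distr (density sphere_measure (\<lambda>x. ennreal (w x))) borel \<phi>) A =
    emeasure sphere_measure A" .
qed


section \<open>Inversions that preserve the unit sphere\<close>

definition inversion :: "real^'n \<Rightarrow> real \<Rightarrow> real^'n \<Rightarrow> real^'n" where
  "inversion c r y = c + (r / ((y - c) \<bullet> (y - c))) *\<^sub>R (y - c)"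

text \<open>The parameter \<open>r\<close> is the square of the radius. What matters is that the
  factor splits into a part depending on \<open>x\<close> and the same part depending on
  \<open>y\<close>: this is conformality in terms of chords.\<close>

lemma dist_inversion:
  assumes "x \<noteq> c" "y \<noteq> c"
  shows "(dist (inversion c r x) (inversion c r y))\<^sup>2 =
    r\<^sup>2 / ((dist x c)\<^sup>2 * (dist y c)\<^sup>2) * (dist x y)\<^sup>2"
proof -
  define a b where "a = x - c" and "b = y - c"
  have nz: "a \<bullet> a \<noteq> 0" "b \<bullet> b \<noteq> 0" using assms by (auto simp: a_def b_def)
  have "(dist (inversion c r x) (inversion c r y))\<^sup>2 =
      (r / (a \<bullet> a))\<^sup>2 * (a \<bullet> a) + (r / (b \<bullet> b))\<^sup>2 * (b \<bullet> b) - 2 * (r / (a \<bullet> a)) * (r / (b \<bullet> b)) * (a \<bullet> b)"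
    unfolding inversion_def a_def[symmetric] b_def[symmetric] dist_norm power2_norm_eq_inner
    by (simp add: inner_diff_left inner_diff_right inner_commute[of b a] power2_eq_square algebra_simps
        del: norm_eq_zero flip: dot_square_norm)
  also have "\<dots> = r\<^sup>2 / ((a \<bullet> a) * (b \<bullet> b)) * (a \<bullet> a + b \<bullet> b - 2 * (a \<bullet> b))"
    using nz by (simp add: field_simps power2_eq_square)
  also have "a \<bullet> a + b \<bullet> b - 2 * (a \<bullet> b) = (dist x y)\<^sup>2"
  proof -
    have "x - y = a - b" by (simp add: a_def b_def)
    then show ?thesis
      by (simp add: dist_norm power2_norm_eq_inner inner_diff_left inner_diff_right inner_commute[of b a])
  qed
  finally show ?thesis by (simp add: a_def b_def dist_norm power2_norm_eq_inner)
qed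

lemma inversion_involutive:
  assumes "y \<noteq> c" "r > 0"
  shows "inversion c r (inversion c r y) = y"
proof -
  define a where "a = y - c"
  have nz: "a \<bullet> a \<noteq> 0" using assms by (simp add: a_def)
  have "inversion c r y - c = (r / (a \<bullet> a)) *\<^sub>R a" by (simp add: inversion_def a_def)
  then have "inversion c r (inversion c r y) =
      c + (r / ((r / (a \<bullet> a))\<^sup>2 * (a \<bullet> a)) * (r / (a \<bullet> a))) *\<^sub>R a"
    unfolding inversion_def[of c r "inversion c r y"] by (simp add: power2_eq_square)
  also have "r / ((r / (a \<bullet> a))\<^sup>2 * (a \<bullet> a)) * (r / (a \<bullet> a)) = 1"
    using nz assms by (simp add: field_simps power2_eq_square)
  finally show ?thesis by (simp add: a_def)
qed

text \<open>
  The squared radius \<open>c \<bullet> c - 1\<close> makes the sphere of inversion orthogonal to the unit sphere.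
\<close>

lemma inversion_eq_reflection:
  assumes "norm y = 1" "y \<noteq> c"
  shows "inversion c (c \<bullet> c - 1) y = y - (2 * ((y - c) \<bullet> y) / ((y - c) \<bullet> (y - c))) *\<^sub>R (y - c)"
proof -
  define D where "D = (y - c) \<bullet> (y - c)"
  have D: "D \<noteq> 0" using assms by (simp add: D_def)
  have yy: "y \<bullet> y = 1" using assms by (simp add: norm_eq_1)
  have e: "(c \<bullet> c - 1) / D = 1 - 2 * ((y - c) \<bullet> y) / D"
    using D by (simp add: field_simps)
      (simp add: D_def inner_diff_left inner_diff_right inner_commute[of y c] yy algebra_simps)
  show ?thesis
    unfolding inversion_def D_def[symmetric] e by (simp add: algebra_simps)
qed

text \<open>The derivative is a scalar times the reflection in the hyperplane orthogonal to
  \<open>e - c\<close>. By \<open>inversion_eq_reflection\<close> the same reflection also produces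
  the image of \<open>e\<close> itself, which makes the determinant of the homogeneous extension
  computable.\<close>

lemma has_derivative_inversion:
  assumes "e \<noteq> c"
  shows "(inversion c r has_derivative
    (\<lambda>t. (r / ((e - c) \<bullet> (e - c))) *\<^sub>R
      (t - (2 * ((e - c) \<bullet> t) / ((e - c) \<bullet> (e - c))) *\<^sub>R (e - c)))) (at e)"
proof -
  have nz: "(e - c) \<bullet> (e - c) \<noteq> 0" using assms by simp
  show ?thesis
    unfolding inversion_def[abs_def]
    by (rule has_derivative_eq_rhs, (rule derivative_intros nz)+)
      (use nz in \<open>simp add: fun_eq_iff inner_commute field_simps scaleR_diff_right\<close>)
qed

lemma has_derivative_normalize:
  fixes x :: "'a::real_inner"
  assumes "x \<noteq> 0"
  defines "e \<equiv> x /\<^sub>R norm x"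
  shows "((\<lambda>x. x /\<^sub>R norm x) has_derivative (\<lambda>v. (v - (e \<bullet> v) *\<^sub>R e) /\<^sub>R norm x)) (at x)"
proof -
  have nz: "norm x \<noteq> 0" using assms by simp
  have [derivative_intros]: "(norm has_derivative (\<lambda>v. e \<bullet> v)) (at x)"
    using has_derivative_norm[OF assms(1)] by (simp add: e_def sgn_div_norm inner_commute)
  show ?thesis
    by (rule has_derivative_eq_rhs, (rule derivative_intros nz)+)
      (use nz in \<open>simp add: fun_eq_iff e_def field_simps scaleR_diff_right\<close>)
qed

text \<open>A radial increment moves along \<open>f e\<close>, a tangential one is mapped by
  \<open>f'\<close>. The factor \<open>1 / norm x\<close> from normalizing cancels against
  \<open>norm x\<close>, so the derivative is constant along rays.\<close>

lemma has_derivative_homogeneous_extension: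
  fixes x :: "'a::real_inner" and f :: "'a \<Rightarrow> 'a"
  assumes "x \<noteq> 0"
  defines "e \<equiv> x /\<^sub>R norm x"
  assumes "(f has_derivative f') (at e)"
  shows "((\<lambda>x. norm x *\<^sub>R f (x /\<^sub>R norm x)) has_derivative
    (\<lambda>v. (e \<bullet> v) *\<^sub>R f e + f' (v - (e \<bullet> v) *\<^sub>R e))) (at x)"
proof -
  have nz: "norm x \<noteq> 0" using assms by simp
  have lin: "linear f'" using assms(3) has_derivative_linear by blast
  have [derivative_intros]: "(norm has_derivative (\<lambda>v. e \<bullet> v)) (at x)"
    using has_derivative_norm[OF assms(1)] by (simp add: e_def sgn_div_norm inner_commute)
  have [derivative_intros]: "((\<lambda>x. f (x /\<^sub>R norm x)) has_derivative
      (\<lambda>v. f' ((v - (e \<bullet> v) *\<^sub>R e) /\<^sub>R norm x))) (at x)"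
    using has_derivative_compose[OF has_derivative_normalize[OF assms(1)], of f f']
      assms(3) by (simp add: e_def)
  show ?thesis
    by (rule has_derivative_eq_rhs, (rule derivative_intros)+)
      (use nz in \<open>simp add: fun_eq_iff linear_cmul[OF lin] flip: e_def\<close>)
qed

text \<open>The derivative factors as \<open>R \<circ> M\<close>: \<open>M\<close> scales the
  tangent space at \<open>e\<close> by \<open>J\<close> and fixes \<open>e\<close>, and one and the
  same reflection \<open>R\<close> then acts on the tangential and on the radial direction. Only
  \<open>M\<close> contributes to the absolute determinant.\<close>

lemma det_derivative_inversion_extension:
  fixes c x :: "real^'n"
  assumes x: "x \<noteq> 0" and c: "norm c > 1"
  defines "e \<equiv> x /\<^sub>R norm x"
  obtains \<Phi>' where
    "((\<lambda>x. norm x *\<^sub>R inversion c (c \<bullet> c - 1) (x /\<^sub>R norm x)) has_derivative \<Phi>') (at x)"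
    "\<bar>det (matrix \<Phi>')\<bar> = ((c \<bullet> c - 1) / (dist e c)\<^sup>2) ^ (CARD('n) - 1)"
proof -
  have e: "norm e = 1" using x by (simp add: e_def)
  have ec: "e \<noteq> c" using e c by auto
  define D where "D = (e - c) \<bullet> (e - c)"
  define J where "J = (c \<bullet> c - 1) / D"
  define R where "R = (\<lambda>t. t - (2 * ((e - c) \<bullet> t) / D) *\<^sub>R (e - c))"
  define M where "M = (\<lambda>v. J *\<^sub>R v + ((1 - J) * (e \<bullet> v)) *\<^sub>R e)"
  have D: "D \<noteq> 0" using ec by (simp add: D_def)
  have cc: "c \<bullet> c > 1"
    using c by (metis norm_gt_square one_power2 zero_le_one less_le_trans not_less power2_norm_eq_inner)
  have J0: "J \<ge> 0" using cc by (auto simp: J_def D_def)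
  define q where "q = e - c"
  have lR: "linear R" unfolding R_def q_def[symmetric]
    by (auto intro!: linearI simp: algebra_simps inner_add_right add_divide_distrib)
  have lM: "linear M" unfolding M_def
    by (auto intro!: linearI simp: algebra_simps inner_add_right)
  have Re: "inversion c (c \<bullet> c - 1) e = R e"
    using inversion_eq_reflection[OF e ec] by (simp add: R_def D_def)
  have inv: "(inversion c (c \<bullet> c - 1) has_derivative (\<lambda>t. J *\<^sub>R R t)) (at e)"
    using has_derivative_inversion[OF ec, of "c \<bullet> c - 1"] by (simp only: J_def R_def D_def)
  have "((\<lambda>x. norm x *\<^sub>R inversion c (c \<bullet> c - 1) (x /\<^sub>R norm x)) has_derivative
      (\<lambda>v. (e \<bullet> v) *\<^sub>R R e + J *\<^sub>R R (v - (e \<bullet> v) *\<^sub>R e))) (at x)"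
    using has_derivative_homogeneous_extension[OF x, folded e_def, OF inv] by (simp only: Re)
  also have "(\<lambda>v. (e \<bullet> v) *\<^sub>R R e + J *\<^sub>R R (v - (e \<bullet> v) *\<^sub>R e)) = R \<circ> M"
    by (simp add: fun_eq_iff M_def linear_add[OF lR] linear_diff[OF lR] linear_cmul[OF lR] algebra_simps)
  finally have der: "((\<lambda>x. norm x *\<^sub>R inversion c (c \<bullet> c - 1) (x /\<^sub>R norm x)) has_derivative R \<circ> M) (at x)" .
  have "R v \<bullet> R w = v \<bullet> w" for v w
  proof -
    define p where "p u = 2 * (q \<bullet> u) / D" for u
    have p: "p u * D = 2 * (q \<bullet> u)" for u using D by (simp add: p_def)
    have R: "R u = u - p u *\<^sub>R q" for u by (simp add: R_def p_def q_def)
    have "R v \<bullet> R w = v \<bullet> w - p w * (q \<bullet> v) - p v * (q \<bullet> w) + p v * (p w * D)"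
      unfolding R inner_diff_left inner_diff_right inner_scaleR_left inner_scaleR_right
      by (simp add: D_def q_def[symmetric] inner_commute[of v q] right_diff_distrib)
    also have "\<dots> = v \<bullet> w - p w * (p v * D) / 2 - p v * (q \<bullet> w) + p v * (p w * D)"
      by (simp add: p)
    also have "\<dots> = v \<bullet> w - p v * (q \<bullet> w) + p v * (p w * D) / 2" by (simp add: mult_ac)
    also have "\<dots> = v \<bullet> w" by (simp add: p)
    finally show ?thesis .
  qed
  then have "orthogonal_transformation R" using lR by (simp add: orthogonal_transformation_def)
  then have "\<bar>det (matrix (R \<circ> M))\<bar> = \<bar>det (matrix M)\<bar>"
    by (simp add: matrix_compose[OF lM lR] det_mul abs_mult)
  also have "\<dots> = J ^ (CARD('n) - 1)"
    using det_scaled_off_axis[OF e, of J] J0 by (simp add: M_def)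
  also have "J = (c \<bullet> c - 1) / (dist e c)\<^sup>2"
    by (simp add: J_def D_def dist_norm power2_norm_eq_inner)
  finally show thesis by (rule that[OF der])
qed


text \<open>The map is an inversion whose centre lies outside the ball on the ray through
  \<open>z\<close>. Being an involution, it has reciprocal conformal factors at \<open>x\<close> and
  at its image.\<close>

lemma sphere_moebius:
  fixes z :: "real^'n::{finite,wellorder}"
  assumes z: "z \<in> sphere 0 1" and \<theta>: "\<theta> > 0"
  defines "J \<equiv> \<lambda>y::real^'n::_. sqrt (\<theta> * (\<theta> + 4)) / (\<theta> + (dist y z)\<^sup>2)"
  shows "\<exists>\<phi> \<in> borel_measurable borel.
    (\<forall>x\<in>sphere 0 1. \<phi> x \<in> sphere 0 1 \<and> J (\<phi> x) * J x = 1) \<and>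
    (\<forall>x\<in>sphere 0 1. \<forall>y\<in>sphere 0 1. (dist (\<phi> x) (\<phi> y))\<^sup>2 = J x * J y * (dist x y)\<^sup>2) \<and>
    distr (density sphere_measure (\<lambda>y. ennreal (J y ^ (CARD('n) - 1)))) borel \<phi> = sphere_measure"
proof -
  define w where "w = sqrt (\<theta> * (\<theta> + 4))"
  \<comment> \<open>The root above 1 of \<open>k + 1 / k = \<theta> + 2\<close>; then
    \<open>k - 1 / k = w\<close>. With the centre \<open>k *\<^sub>R z\<close> the squared distance
    to the centre is \<open>k\<close> times \<theta> + |x - z|^2 on the sphere, and the squared
    radius is \<open>k * w\<close>.\<close>
  define k where "k = (\<theta> + 2 + w) / 2"
  define c where "c = k *\<^sub>R z"
  define r where "r = c \<bullet> c - 1"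
  define \<phi> where "\<phi> = inversion c r"
  have w2: "w\<^sup>2 = \<theta> * (\<theta> + 4)" and w: "w > 0" using \<theta> by (simp_all add: w_def)
  have k: "k > 1" using w \<theta> by (simp add: k_def)
  have zz: "z \<bullet> z = 1" using z by (simp add: norm_eq_1)
  have kk: "k\<^sup>2 + 1 = k * (\<theta> + 2)" using w2 by (simp add: k_def power2_eq_square algebra_simps)
  have kw: "k\<^sup>2 - 1 = k * w" using w2 by (simp add: k_def power2_eq_square algebra_simps)
  have r: "r = k * w" using kw by (simp add: r_def c_def zz power2_eq_square)
  have r0: "r > 0" using r k w by simp
  have nc: "norm c > 1" using k z by (simp add: c_def)
  have nec: "x \<noteq> c" if "x \<in> sphere 0 1" for x using nc that by auto
  have dc: "(dist x c)\<^sup>2 = k * (\<theta> + (dist x z)\<^sup>2)" if "x \<in> sphere 0 1" for x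
  proof -
    have xx: "x \<bullet> x = 1" using that by (simp add: norm_eq_1)
    have dxc: "(dist x c)\<^sup>2 = 1 + k\<^sup>2 - 2 * k * (x \<bullet> z)"
      unfolding dist_norm power2_norm_eq_inner c_def inner_diff_left inner_diff_right
        inner_scaleR_left inner_scaleR_right xx zz inner_commute[of z x]
      by (simp add: power2_eq_square right_diff_distrib)
    have dxz: "(dist x z)\<^sup>2 = 2 - 2 * (x \<bullet> z)"
      unfolding dist_norm power2_norm_eq_inner inner_diff_left inner_diff_right xx zz
        inner_commute[of z x] by simp
    have "k * (\<theta> + (2 - 2 * (x \<bullet> z))) = k * (\<theta> + 2) - 2 * k * (x \<bullet> z)"
      by (simp add: distrib_left right_diff_distrib)
    then show ?thesis unfolding dxc dxz kk[symmetric] by linarith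
  qed
  have J: "J x = r / (dist x c)\<^sup>2" if "x \<in> sphere 0 1" for x
    using dc[OF that] r k by (simp add: J_def w_def[symmetric])
  have refl: "\<phi> x \<in> sphere 0 1" if x: "x \<in> sphere 0 1" for x
  proof -
    define q where "q = x - c"
    have q: "q \<bullet> q \<noteq> 0" using nec[OF x] by (simp add: q_def)
    have "\<phi> x = x - (2 * (q \<bullet> x) / (q \<bullet> q)) *\<^sub>R q"
      using inversion_eq_reflection[of x c] x nec[OF x] by (simp add: \<phi>_def r_def q_def)
    then have "\<phi> x \<bullet> \<phi> x = x \<bullet> x - 4 * (q \<bullet> x)\<^sup>2 / (q \<bullet> q) + (2 * (q \<bullet> x) / (q \<bullet> q))\<^sup>2 * (q \<bullet> q)"
      by (simp add: inner_diff_left inner_diff_right inner_commute[of x q] power2_eq_square)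
    also have "\<dots> = x \<bullet> x" using q by (simp add: field_simps power2_eq_square)
    finally show ?thesis using x by (simp add: norm_eq_1)
  qed
  have invol: "\<phi> (\<phi> x) = x" if "x \<in> sphere 0 1" for x
    using inversion_involutive[OF nec[OF that] r0] by (simp add: \<phi>_def)
  have bij: "bij_betw \<phi> (sphere 0 1) (sphere 0 1)"
    by (rule bij_betw_byWitness[where f' = \<phi>]) (use refl invol in auto)
  have conf: "(dist (\<phi> x) (\<phi> y))\<^sup>2 = J x * J y * (dist x y)\<^sup>2"
    if "x \<in> sphere 0 1" "y \<in> sphere 0 1" for x y
    using dist_inversion[OF nec[OF that(1)] nec[OF that(2)], of r] J[OF that(1)] J[OF that(2)]
    by (simp add: \<phi>_def power2_eq_square)
  have JJ: "J (\<phi> x) * J x = 1" if x: "x \<in> sphere 0 1" for x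
  proof -
    define q where "q = x - c"
    have q: "q \<bullet> q \<noteq> 0" using nec[OF x] by (simp add: q_def)
    have "\<phi> x - c = (r / (q \<bullet> q)) *\<^sub>R q" by (simp add: \<phi>_def inversion_def q_def)
    then have "(dist (\<phi> x) c)\<^sup>2 = (r / (q \<bullet> q))\<^sup>2 * (q \<bullet> q)"
      by (simp only: dist_norm power2_norm_eq_inner) (simp add: power2_eq_square)
    moreover have "(dist x c)\<^sup>2 = q \<bullet> q" by (simp add: dist_norm power2_norm_eq_inner q_def)
    ultimately have "J (\<phi> x) = r / ((r / (q \<bullet> q))\<^sup>2 * (q \<bullet> q))" "J x = r / (q \<bullet> q)"
      using J[OF x] J[OF refl[OF x]] by simp_all
    then show ?thesis using q r0 by (simp add: power2_eq_square)
  qed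
  have meas [measurable]: "\<phi> \<in> borel_measurable borel"
    unfolding \<phi>_def inversion_def[abs_def] by measurable
  define P where "P x F \<longleftrightarrow> ((\<lambda>x. norm x *\<^sub>R \<phi> (x /\<^sub>R norm x)) has_derivative F) (at x) \<and>
    \<bar>det (matrix F)\<bar> = (r / (dist (x /\<^sub>R norm x) c)\<^sup>2) ^ (CARD('n) - 1)" for x F
  have "\<exists>F. P x F" if nz: "x \<noteq> 0" for x
  proof -
    obtain F where
      "((\<lambda>x. norm x *\<^sub>R inversion c (c \<bullet> c - 1) (x /\<^sub>R norm x)) has_derivative F) (at x)"
      "\<bar>det (matrix F)\<bar> = ((c \<bullet> c - 1) / (dist (x /\<^sub>R norm x) c)\<^sup>2) ^ (CARD('n) - 1)"
      by (rule det_derivative_inversion_extension[OF nz nc])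
    then show ?thesis unfolding P_def \<phi>_def r_def by blast
  qed
  then obtain \<Phi>' where \<Phi>': "\<And>x. x \<noteq> 0 \<Longrightarrow> P x (\<Phi>' x)"
    by metis
  have "distr (density sphere_measure (\<lambda>y. ennreal (J y ^ (CARD('n) - 1)))) borel \<phi> = sphere_measure"
  proof (rule sphere_measure_change_of_variables[where w = "\<lambda>y. J y ^ (CARD('n) - 1)" and \<Phi>' = \<Phi>'])
    show "\<phi> \<in> borel_measurable borel" by (rule meas)
    show "(\<lambda>y. J y ^ (CARD('n) - 1)) \<in> borel_measurable borel"
      unfolding J_def by measurable
    show "bij_betw \<phi> (sphere 0 1) (sphere 0 1)" by (rule bij)
    show "((\<lambda>x. norm x *\<^sub>R \<phi> (x /\<^sub>R norm x)) has_derivative \<Phi>' x) (at x)" if "x \<noteq> 0" for x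
      using \<Phi>'[OF that] by (simp add: P_def)
    show "\<bar>det (matrix (\<Phi>' x))\<bar> = J (x /\<^sub>R norm x) ^ (CARD('n) - 1)" if "x \<noteq> 0" for x
    proof -
      have "x /\<^sub>R norm x \<in> sphere 0 1" using that by simp
      then show ?thesis using \<Phi>'[OF that] by (simp only: P_def J)
    qed
  qed
  then show ?thesis
    by (intro bexI[OF _ meas] conjI ballI refl JJ conf)
qed

text \<open>An orthogonal map is its own homogeneous extension, so the change of variables applies
  with weight 1.\<close>

lemma sphere_rotation:
  fixes x y :: "real^'n::{finite,wellorder}"
  assumes "x \<in> sphere 0 1" "y \<in> sphere 0 1"
  shows "\<exists>f \<in> borel_measurable borel. f x = y \<and> (\<forall>u v. dist (f u) (f v) = dist u v) \<and>
    distr sphere_measure borel f = sphere_measure"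
proof -
  obtain f where f: "orthogonal_transformation f" "f x = y"
    using orthogonal_transformation_exists_1[of x y] assms by auto
  have lin: "linear f" using f orthogonal_transformation_linear by blast
  have [measurable]: "f \<in> borel_measurable borel"
    by (intro borel_measurable_continuous_onI linear_continuous_on linear_conv_bounded_linear[THEN iffD1] lin)
  have nrm: "norm (f u) = norm u" for u using f orthogonal_transformation_norm by blast
  have "distr (density sphere_measure (\<lambda>x. ennreal 1)) borel f = sphere_measure"
  proof (rule sphere_measure_change_of_variables[where w = "\<lambda>x. 1" and \<Phi>' = "\<lambda>x. f"])
    have "bij f" using f(1) orthogonal_transformation_bij by blast
    then have "inj f" "surj f" by (auto simp: bij_def)
    show "bij_betw f (sphere 0 1) (sphere 0 1)"
      unfolding bij_betw_def
    proof (intro conjI equalityI subsetI)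
      show "inj_on f (sphere 0 1)" using \<open>inj f\<close> by (rule inj_on_subset) simp
      fix v assume "v \<in> sphere (0::real^'n::_) 1"
      moreover obtain u where "v = f u" using \<open>surj f\<close> by blast
      ultimately show "v \<in> f ` sphere 0 1" using nrm by simp
    qed (use nrm in auto)
    show "((\<lambda>x. norm x *\<^sub>R f (x /\<^sub>R norm x)) has_derivative f) (at x)" if "x \<noteq> 0" for x
    proof -
      have "norm x *\<^sub>R f (x /\<^sub>R norm x) = f x" for x
        by (cases "x = 0") (simp_all add: linear_cmul[OF lin] linear_0[OF lin])
      then show ?thesis
        using lin by (simp add: linear_imp_has_derivative)
    qed
  qed (use f in auto)
  moreover have "density sphere_measure (\<lambda>x. ennreal 1) = (sphere_measure :: (real^'n::_) measure)"
    by (simp add: density_1)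
  moreover have "dist (f u) (f v) = dist u v" for u v
    using nrm[of "u - v"] by (simp add: dist_norm linear_diff[OF lin])
  ultimately show ?thesis using f by (intro bexI[of _ f]) auto
qed

subsection \<open>Finite differences of the Riesz profile\<close>

lemma sum_alternating_choose_Suc:
  fixes f :: "nat \<Rightarrow> 'a::comm_ring_1"
  shows "(\<Sum>k\<le>Suc n. (-1) ^ k * of_nat (Suc n choose k) * f k) =
    (\<Sum>k\<le>n. (-1) ^ k * of_nat (n choose k) * (f k - f (Suc k)))"
proof -
  have "(\<Sum>k\<le>n. (-1) ^ k * of_nat (n choose k) * f k) =
      (\<Sum>k\<le>Suc n. (-1) ^ k * of_nat (n choose k) * f k)" by (simp add: binomial_eq_0)
  also have "\<dots> = f 0 - (\<Sum>k\<le>n. (-1) ^ k * of_nat (n choose Suc k) * f (Suc k))"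
    by (subst sum.atMost_Suc_shift) (simp add: sum_negf)
  finally have "(\<Sum>k\<le>n. (-1) ^ k * of_nat (n choose k) * (f k - f (Suc k))) =
      f 0 - (\<Sum>k\<le>n. (-1) ^ k * of_nat (n choose Suc k) * f (Suc k))
      - (\<Sum>k\<le>n. (-1) ^ k * of_nat (n choose k) * f (Suc k))"
    by (simp add: right_diff_distrib sum_subtractf)
  also have "\<dots> = f 0 - (\<Sum>k\<le>n. (-1) ^ k * of_nat (Suc n choose Suc k) * f (Suc k))"
    by (simp add: sum.distrib algebra_simps)
  also have "\<dots> = (\<Sum>k\<le>Suc n. (-1) ^ k * of_nat (Suc n choose k) * f k)"
    by (subst sum.atMost_Suc_shift) (simp add: sum_negf)
  finally show ?thesis by simp
qed

text \<open>\<open>F k\<close> stands for the k-th derivative of \<open>F 0\<close> with sign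
  \<open>(-1) ^ k\<close>, which cancels the signs of the difference. The hypothesis passes to
  \<open>F k v - F k (v + h)\<close>, so an induction over arbitrary \<open>F\<close> costs one
  application of the mean value theorem per order.\<close>

lemma finite_difference_mean_value:
  fixes F :: "nat \<Rightarrow> real \<Rightarrow> real"
  assumes "\<And>k v. v > 0 \<Longrightarrow> (F k has_real_derivative - F (Suc k) v) (at v)"
    and "h > 0" and "a > 0"
  shows "\<exists>\<xi>\<in>{a..a + real n * h}.
    (\<Sum>k\<le>n. (-1) ^ k * real (n choose k) * F 0 (a + real k * h)) = h ^ n * F n \<xi>"
  using assms(1)
proof (induction n arbitrary: F)
  case 0
  then show ?case by simp
next
  case (Suc n)
  define G where "G k v = F k v - F k (v + h)" for k v
  have "(G k has_real_derivative - G (Suc k) v) (at v)" if "v > 0" for k v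
  proof -
    have "((\<lambda>v. F k (v + h)) has_real_derivative - F (Suc k) (v + h)) (at v)"
      using Suc.prems[of "v + h" k] that assms(2) by (simp add: DERIV_shift)
    from DERIV_diff[OF Suc.prems[OF that, of k] this] show ?thesis
      by (simp add: G_def[abs_def])
  qed
  from Suc.IH[of G, OF this] obtain \<xi> where \<xi>: "\<xi> \<in> {a..a + real n * h}"
    "(\<Sum>k\<le>n. (-1) ^ k * real (n choose k) * G 0 (a + real k * h)) = h ^ n * G n \<xi>" by blast
  have pos: "\<xi> > 0" using \<xi>(1) assms(3) by simp
  obtain \<zeta> where \<zeta>: "\<xi> < \<zeta>" "\<zeta> < \<xi> + h" "F n (\<xi> + h) - F n \<xi> = (\<xi> + h - \<xi>) * - F (Suc n) \<zeta>"
    using MVT2[of \<xi> "\<xi> + h" "F n" "\<lambda>v. - F (Suc n) v"] Suc.prems pos assms(2) by force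
  have "(\<Sum>k\<le>Suc n. (-1) ^ k * real (Suc n choose k) * F 0 (a + real k * h)) =
      (\<Sum>k\<le>n. (-1) ^ k * real (n choose k) * G 0 (a + real k * h))"
    by (subst sum_alternating_choose_Suc) (simp add: G_def algebra_simps)
  also have "\<dots> = h ^ n * G n \<xi>" by (rule \<xi>(2))
  also have "G n \<xi> = h * F (Suc n) \<zeta>"
    using \<zeta>(3) by (simp add: G_def)
  also have "h ^ n * (h * F (Suc n) \<zeta>) = h ^ Suc n * F (Suc n) \<zeta>" by simp
  finally show ?case
    using \<zeta>(1,2) \<xi>(1) by (intro bexI[of _ \<zeta>]) (auto simp: algebra_simps)
qed

text \<open>The kernel as a function of the squared distance.\<close>

definition riesz_profile :: "real \<Rightarrow> real \<Rightarrow> real" where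
  "riesz_profile s v = (if s = 0 then - ln v / 2 else sgn s * v powr (- s / 2))"

text \<open>Completely monotone derivatives make the \<open>K\<close>-th differences positive for every \<open>s > -2\<close>.\<close>

lemma riesz_profile_difference_bounds:
  assumes s: "s > -2" and K: "K \<ge> 1"
  shows "\<exists>c>0. \<exists>C>0. \<forall>\<theta>>0. \<forall>v\<ge>0.
    c * (\<theta> ^ K * (\<theta> + v) powr (- (s / 2 + K)))
      \<le> (\<Sum>k\<le>K. (-1) ^ k * real (K choose k) * riesz_profile s (real (Suc k) * \<theta> + v)) \<and>
    (\<Sum>k\<le>K. (-1) ^ k * real (K choose k) * riesz_profile s (real (Suc k) * \<theta> + v))
      \<le> C * (\<theta> ^ K * (\<theta> + v) powr (- (s / 2 + K)))"
proof -
  define b where "b = (if s = 0 then 1 / 2 else \<bar>s\<bar> / 2)"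
  \<comment> \<open>The coefficients of the derivatives with alternating sign. The product starts at
    \<open>j = 1\<close>, where \<open>s / 2 + j\<close> is already positive; the factor
    \<open>s / 2\<close>, which may be negative or zero, is combined with \<open>sgn s\<close> into
    the positive \<open>b\<close>.\<close>
  define c where "c k = b * (\<Prod>j\<in>{1..<k}. s / 2 + real j)" for k :: nat
  define F where "F k v = (if k = 0 then riesz_profile s v else c k * v powr (- (s / 2 + real k)))" for k v
  have b: "b > 0" by (simp add: b_def)
  have c: "c k > 0" for k unfolding c_def using s b by (intro mult_pos_pos prod_pos) auto
  have der: "(F k has_real_derivative - F (Suc k) v) (at v)" if v: "v > 0" for k v
  proof (cases "k = 0")
    case True
    have "(riesz_profile s has_real_derivative - (b * v powr (- (s / 2 + 1)))) (at v)"
    proof (cases "s = 0")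
      case True
      then show ?thesis unfolding riesz_profile_def[abs_def] b_def using v
        by (auto intro!: derivative_eq_intros simp: powr_minus field_simps)
    next
      case False
      then show ?thesis unfolding riesz_profile_def[abs_def] b_def using v
        by (auto intro!: derivative_eq_intros simp: sgn_if diff_divide_distrib)
    qed
    with True show ?thesis by (simp add: F_def[abs_def] c_def)
  next
    case False
    then have "c (Suc k) = c k * (s / 2 + real k)"
      by (simp add: c_def prod.atLeastLessThan_Suc)
    moreover have "((\<lambda>v. c k * v powr (- (s / 2 + real k))) has_real_derivative
        - (c k * (s / 2 + real k) * v powr (- (s / 2 + real (Suc k))))) (at v)"
    proof -
      have e: "- (s / 2 + real k) - 1 = - (s / 2 + real (Suc k))" by simp
      have "x * (- y * z) = - (x * y * z)" for x y z :: real by simp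
      then show ?thesis
        by (rule DERIV_cong[OF DERIV_cmult[OF
          has_real_derivative_powr[OF v, of "- (s / 2 + real k)", unfolded e]]])
    qed
    ultimately show ?thesis using False by (simp add: F_def[abs_def])
  qed
  define q where "q = s / 2 + real K"
  have q: "q > 0" using s K by (simp add: q_def)
  show ?thesis
  proof (intro exI conjI allI impI)
    show "c K * real (Suc K) powr (- q) > 0" using c by simp
    show "c K > 0" by (rule c)
    fix \<theta> v :: real assume \<theta>: "\<theta> > 0" and v: "v \<ge> 0"
    let ?B = "\<Sum>k\<le>K. (-1) ^ k * real (K choose k) * riesz_profile s (real (Suc k) * \<theta> + v)"
    have "\<exists>\<xi>\<in>{\<theta> + v..\<theta> + v + real K * \<theta>}.
      (\<Sum>k\<le>K. (-1) ^ k * real (K choose k) * F 0 (\<theta> + v + real k * \<theta>)) = \<theta> ^ K * F K \<xi>"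
      by (rule finite_difference_mean_value) (use der \<theta> v in auto)
    then obtain \<xi> where \<xi>: "\<theta> + v \<le> \<xi>" "\<xi> \<le> \<theta> + v + real K * \<theta>" "?B = \<theta> ^ K * (c K * \<xi> powr (- q))"
      using K by (auto simp: F_def q_def algebra_simps)
    \<comment> \<open>The intermediate point lies between \<theta> + v and \<open>K + 1\<close>
      times this value, so its powers are comparable with those of \<theta> + v uniformly in
      \<theta> and \<open>v\<close>.\<close>
    have "\<xi> \<le> real (Suc K) * (\<theta> + v)" using \<xi>(2) v by (simp add: algebra_simps) (smt (verit) mult_nonneg_nonneg of_nat_0_le_iff)
    then have "(real (Suc K) * (\<theta> + v)) powr (- q) \<le> \<xi> powr (- q)"
      using \<xi>(1) \<theta> v q by (intro powr_mono2') auto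
    then have "c K * \<theta> ^ K * (real (Suc K) * (\<theta> + v)) powr (- q) \<le> c K * \<theta> ^ K * \<xi> powr (- q)"
      using c[of K] \<theta> by (intro mult_left_mono) auto
    then show "c K * real (Suc K) powr (- q) * (\<theta> ^ K * (\<theta> + v) powr (- (s / 2 + real K))) \<le> ?B"
      unfolding \<xi>(3) using \<theta> v by (simp add: q_def powr_mult mult_ac)
    have "\<xi> powr (- q) \<le> (\<theta> + v) powr (- q)"
      using \<xi>(1) \<theta> v q by (intro powr_mono2') auto
    then have "c K * \<theta> ^ K * \<xi> powr (- q) \<le> c K * \<theta> ^ K * (\<theta> + v) powr (- q)"
      using c[of K] \<theta> by (intro mult_left_mono) auto
    then show "?B \<le> c K * (\<theta> ^ K * (\<theta> + v) powr (- (s / 2 + real K)))"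
      unfolding \<xi>(3) by (simp add: q_def mult_ac)
  qed
qed


subsection \<open>Conformal invariance of the surface measure\<close>

text \<open>The conformal factor of the map in \<open>sphere_moebius\<close>; for small \<theta> it
  is about 2 / sqrt \<theta> at \<open>z\<close>.\<close>

definition moebius_factor :: "real \<Rightarrow> 'a::metric_space \<Rightarrow> 'a \<Rightarrow> real" where
  "moebius_factor \<theta> z y = sqrt (\<theta> * (\<theta> + 4)) / (\<theta> + (dist y z)\<^sup>2)"

lemma moebius_factor_pos: "\<theta> > 0 \<Longrightarrow> moebius_factor \<theta> z y > 0"
  by (simp add: moebius_factor_def add_pos_nonneg)

lemma borel_measurable_moebius_factor [measurable]:
  fixes z :: "'a::{metric_space,second_countable_topology}"
  shows "moebius_factor \<theta> z \<in> borel_measurable borel"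
  unfolding moebius_factor_def[abs_def] by measurable

lemma moebius_factor_powr:
  assumes "\<theta> > 0"
  shows "moebius_factor \<theta> z y powr a =
    (\<theta> * (\<theta> + 4)) powr (a / 2) * (\<theta> + (dist y z)\<^sup>2) powr (- a)"
proof -
  have "\<theta> + (dist y z)\<^sup>2 > 0" using assms by (simp add: add_pos_nonneg)
  then show ?thesis using assms
    by (simp add: moebius_factor_def powr_divide powr_minus powr_half_sqrt[symmetric] powr_powr field_simps)
qed

lemma bounds_on_sphere:
  fixes y z :: "'a::real_normed_vector"
  assumes "y \<in> sphere 0 1" "z \<in> sphere 0 1"
  shows "dist y z \<le> 2" "(dist y z)\<^sup>2 \<le> 4"
proof -
  show "dist y z \<le> 2" using assms dist_triangle2[of y z 0] by simp
  then have "(dist y z)\<^sup>2 \<le> 2\<^sup>2" by (rule power_mono) simp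
  then show "(dist y z)\<^sup>2 \<le> 4" by simp
qed

text \<open>One of the end points dominates, according to the sign of \<open>p\<close>; adding both
  values avoids the distinction in later bounds.\<close>

lemma powr_between:
  fixes a b t p :: real
  assumes "0 < a" "a \<le> t" "t \<le> b"
  shows "t powr p \<le> a powr p + b powr p"
proof (cases "p \<ge> 0")
  case True
  then have "t powr p \<le> b powr p" using assms by (intro powr_mono2) auto
  then show ?thesis by (simp add: add_increasing)
next
  case False
  then have "t powr p \<le> a powr p" using assms by (intro powr_mono2') auto
  then show ?thesis by (simp add: add_increasing2)
qed

text \<open>The potential theory below uses the surface measure only through its conformal and
  rotational invariance. The number \<open>d\<close> enters as the exponent of the Jacobian.\<close>

locale moebius_sphere = prob_space \<sigma>
  for \<sigma> :: "'a::euclidean_space measure" +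
  fixes d :: nat
  assumes dim: "d \<ge> 1"
    and sets_sigma [measurable_cong, simp]: "sets \<sigma> = sets borel"
    and AE_sphere: "AE x in \<sigma>. x \<in> sphere 0 1"
    and moebius: "z \<in> sphere 0 1 \<Longrightarrow> \<theta> > 0 \<Longrightarrow> \<exists>\<phi> \<in> borel_measurable borel.
      (\<forall>x\<in>sphere 0 1. \<phi> x \<in> sphere 0 1 \<and> moebius_factor \<theta> z (\<phi> x) * moebius_factor \<theta> z x = 1) \<and>
      (\<forall>x\<in>sphere 0 1. \<forall>y\<in>sphere 0 1. (dist (\<phi> x) (\<phi> y))\<^sup>2 =
        moebius_factor \<theta> z x * moebius_factor \<theta> z y * (dist x y)\<^sup>2) \<and>
      distr (density \<sigma> (\<lambda>y. ennreal (moebius_factor \<theta> z y ^ d))) borel \<phi> = \<sigma>"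
    and rotation: "x \<in> sphere 0 1 \<Longrightarrow> y \<in> sphere 0 1 \<Longrightarrow> \<exists>f \<in> borel_measurable borel.
      f x = y \<and> (\<forall>u v. dist (f u) (f v) = dist u v) \<and> distr \<sigma> borel f = \<sigma>"
begin

lemma space_sigma [simp]: "space \<sigma> = UNIV"
  using sets_eq_imp_space_eq[OF sets_sigma] by simp

lemma integrable_AE_bounded:
  fixes f :: "'a \<Rightarrow> real"
  assumes "f \<in> borel_measurable borel" "\<And>y. y \<in> sphere 0 1 \<Longrightarrow> \<bar>f y\<bar> \<le> B"
  shows "integrable \<sigma> f"
proof (rule integrable_const_bound[where B = B])
  show "AE x in \<sigma>. norm (f x) \<le> B" using AE_sphere by eventually_elim (use assms(2) in simp)
qed (use assms(1) in measurable)

lemma integral_cong_sphere: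
  fixes f g :: "'a \<Rightarrow> real"
  assumes [measurable]: "f \<in> borel_measurable borel" "g \<in> borel_measurable borel"
    and "\<And>y. y \<in> sphere 0 1 \<Longrightarrow> f y = g y"
  shows "integral\<^sup>L \<sigma> f = integral\<^sup>L \<sigma> g"
  by (rule integral_cong_AE) (use AE_sphere assms(3) in \<open>auto elim: eventually_mono\<close>)

lemma moebius_integral:
  assumes "z \<in> sphere 0 1" "\<theta> > 0"
  obtains \<phi> where "\<phi> \<in> borel_measurable borel"
    "\<And>x. x \<in> sphere 0 1 \<Longrightarrow> \<phi> x \<in> sphere 0 1"
    "\<And>x. x \<in> sphere 0 1 \<Longrightarrow> moebius_factor \<theta> z (\<phi> x) = inverse (moebius_factor \<theta> z x)"
    "\<And>x y. x \<in> sphere 0 1 \<Longrightarrow> y \<in> sphere 0 1 \<Longrightarrow>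
      dist (\<phi> x) (\<phi> y) = sqrt (moebius_factor \<theta> z x * moebius_factor \<theta> z y) * dist x y"
    "\<And>F :: 'a \<Rightarrow> real. F \<in> borel_measurable borel \<Longrightarrow> integrable \<sigma> F \<Longrightarrow>
      integrable \<sigma> (\<lambda>y. moebius_factor \<theta> z y ^ d * F (\<phi> y))"
    "\<And>F :: 'a \<Rightarrow> real. F \<in> borel_measurable borel \<Longrightarrow>
      (\<integral>y. moebius_factor \<theta> z y ^ d * F (\<phi> y) \<partial>\<sigma>) = (\<integral>y. F y \<partial>\<sigma>)"
proof -
  let ?J = "moebius_factor \<theta> z"
  from moebius[OF assms] obtain \<phi> where meas [measurable]: "\<phi> \<in> borel_measurable borel"
    and S: "\<And>x. x \<in> sphere 0 1 \<Longrightarrow> \<phi> x \<in> sphere 0 1"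
    and inv: "\<And>x. x \<in> sphere 0 1 \<Longrightarrow> ?J (\<phi> x) * ?J x = 1"
    and conf: "\<And>x y. x \<in> sphere 0 1 \<Longrightarrow> y \<in> sphere 0 1 \<Longrightarrow>
      (dist (\<phi> x) (\<phi> y))\<^sup>2 = ?J x * ?J y * (dist x y)\<^sup>2"
    and img: "distr (density \<sigma> (\<lambda>y. ennreal (?J y ^ d))) borel \<phi> = \<sigma>" by blast
  have J0: "?J y \<ge> 0" for y using moebius_factor_pos[OF assms(2)] by (rule less_imp_le)
  show thesis
  proof (rule that[OF meas S])
    show "?J (\<phi> x) = inverse (?J x)" if "x \<in> sphere 0 1" for x
      using inv[OF that] by (rule inverse_unique[symmetric, OF trans[OF mult.commute]])
    show "dist (\<phi> x) (\<phi> y) = sqrt (?J x * ?J y) * dist x y"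
      if "x \<in> sphere 0 1" "y \<in> sphere 0 1" for x y
      by (rule power2_eq_imp_eq) (use conf[OF that] J0 in \<open>simp_all add: power_mult_distrib\<close>)
    fix F :: "'a \<Rightarrow> real" assume F [measurable]: "F \<in> borel_measurable borel"
    have [measurable]: "(\<lambda>y. ?J y ^ d) \<in> borel_measurable \<sigma>" by measurable
    have [measurable]: "(\<lambda>y. F (\<phi> y)) \<in> borel_measurable \<sigma>" by measurable
    show "(\<integral>y. ?J y ^ d * F (\<phi> y) \<partial>\<sigma>) = (\<integral>y. F y \<partial>\<sigma>)"
    proof -
      have "(\<integral>y. F y \<partial>\<sigma>) = (\<integral>y. F y \<partial>distr (density \<sigma> (\<lambda>y. ennreal (?J y ^ d))) borel \<phi>)"
        by (simp only: img)
      also have "\<dots> = (\<integral>y. F (\<phi> y) \<partial>density \<sigma> (\<lambda>y. ennreal (?J y ^ d)))"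
        by (rule integral_distr) measurable
      also have "\<dots> = (\<integral>y. ?J y ^ d * F (\<phi> y) \<partial>\<sigma>)"
        by (subst integral_density) (use J0 in auto)
      finally show ?thesis by simp
    qed
    assume "integrable \<sigma> F"
    then have "integrable (distr (density \<sigma> (\<lambda>y. ennreal (?J y ^ d))) borel \<phi>) F"
      by (simp only: img)
    then have "integrable (density \<sigma> (\<lambda>y. ennreal (?J y ^ d))) (\<lambda>y. F (\<phi> y))"
      by (subst (asm) integrable_distr_eq) measurable
    then show "integrable \<sigma> (\<lambda>y. ?J y ^ d * F (\<phi> y))"
      by (subst (asm) integrable_density) (use J0 in auto)
  qed
qed

section \<open>Integrals of powers of the distance\<close>

lemma integrable_shifted_powr:
  assumes "z \<in> sphere 0 1" "\<theta> > 0"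
  shows "integrable \<sigma> (\<lambda>y. (\<theta> + (dist y z)\<^sup>2) powr p)"
proof (rule integrable_AE_bounded)
  fix y :: 'a assume "y \<in> sphere 0 1"
  then have "(\<theta> + (dist y z)\<^sup>2) powr p \<le> \<theta> powr p + (\<theta> + 4) powr p"
    using bounds_on_sphere(2)[of y z] assms by (intro powr_between) auto
  then show "\<bar>(\<theta> + (dist y z)\<^sup>2) powr p\<bar> \<le> \<theta> powr p + (\<theta> + 4) powr p" by simp
qed measurable

text \<open>Substituting the Moebius map inverts the conformal factor \<open>J\<close>, so the
  integral of \<open>J powr b\<close> equals that of \<open>J powr (d - b)\<close>. A concentrated
  integrand is thereby traded for a bounded one.\<close>

lemma integral_shifted_powr_reflect:
  assumes z: "z \<in> sphere 0 1" and \<theta>: "\<theta> > 0"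
  shows "(\<integral>y. (\<theta> + (dist y z)\<^sup>2) powr (- (real d - b)) \<partial>\<sigma>) =
    (\<theta> * (\<theta> + 4)) powr (b - real d / 2) * (\<integral>y. (\<theta> + (dist y z)\<^sup>2) powr (- b) \<partial>\<sigma>)"
proof -
  let ?J = "moebius_factor \<theta> z"
  have Jp: "?J y > 0" for y by (rule moebius_factor_pos[OF \<theta>])
  from moebius_integral[OF z \<theta>] obtain \<phi> where \<phi> [measurable]: "\<phi> \<in> borel_measurable borel"
    and inv: "\<And>x. x \<in> sphere 0 1 \<Longrightarrow> ?J (\<phi> x) = inverse (?J x)"
    and int: "\<And>F :: 'a \<Rightarrow> real. F \<in> borel_measurable borel \<Longrightarrow>
      (\<integral>y. ?J y ^ d * F (\<phi> y) \<partial>\<sigma>) = (\<integral>y. F y \<partial>\<sigma>)" by metis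
  have w: "\<theta> * (\<theta> + 4) > 0" using \<theta> by simp
  have "(\<integral>y. ?J y powr b \<partial>\<sigma>) = (\<integral>y. ?J y ^ d * ?J (\<phi> y) powr b \<partial>\<sigma>)"
    by (rule int[symmetric]) measurable
  also have "\<dots> = (\<integral>y. ?J y powr (real d - b) \<partial>\<sigma>)"
  proof (rule integral_cong_sphere)
    fix y :: 'a assume "y \<in> sphere 0 1"
    then show "?J y ^ d * ?J (\<phi> y) powr b = ?J y powr (real d - b)"
      using Jp[of y] inv by (simp add: powr_diff powr_realpow inverse_powr divide_inverse)
  qed measurable
  finally have eq: "(\<theta> * (\<theta> + 4)) powr (b / 2) * (\<integral>y. (\<theta> + (dist y z)\<^sup>2) powr (- b) \<partial>\<sigma>) =
      (\<theta> * (\<theta> + 4)) powr ((real d - b) / 2) * (\<integral>y. (\<theta> + (dist y z)\<^sup>2) powr (- (real d - b)) \<partial>\<sigma>)"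
    by (simp only: moebius_factor_powr[OF \<theta>] integral_mult_right_zero)
  have ratio: "(\<theta> * (\<theta> + 4)) powr (b - real d / 2) =
      (\<theta> * (\<theta> + 4)) powr (b / 2) / (\<theta> * (\<theta> + 4)) powr ((real d - b) / 2)"
    by (simp add: powr_diff[symmetric] diff_divide_distrib)
  have "v = e * u" if "a * u = c * v" "e = a / c" "c > 0" for a c e u v :: real
  proof -
    have "a = c * e" using that(2,3) by simp
    then have "c * v = c * (e * u)" using that(1) by (simp only: mult.assoc)
    then show ?thesis using that(3) by simp
  qed
  from this[OF eq ratio] w show ?thesis by (simp only: powr_gt_zero)
qed

text \<open>For \<theta> = r^2 the function \<open>J ^ d\<close> has integral 1 and is at least
  \<open>(1 / r) ^ d\<close> on the cap, so this is Markov's inequality. The constant 1 lets a union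
  of caps be measured without further constants.\<close>

lemma cap_measure_le:
  assumes z: "z \<in> sphere 0 1" and r: "r > 0"
  shows "measure \<sigma> {y. dist y z \<le> r} \<le> r ^ d"
proof -
  define \<theta> where "\<theta> = r\<^sup>2"
  have \<theta>: "\<theta> > 0" using r by (simp add: \<theta>_def)
  let ?J = "moebius_factor \<theta> z"
  have Jp: "?J y > 0" for y by (rule moebius_factor_pos[OF \<theta>])
  from moebius_integral[OF z \<theta>] obtain \<phi> where
    int: "\<And>F :: 'a \<Rightarrow> real. F \<in> borel_measurable borel \<Longrightarrow>
      (\<integral>y. ?J y ^ d * F (\<phi> y) \<partial>\<sigma>) = (\<integral>y. F y \<partial>\<sigma>)"
    and integ: "\<And>F :: 'a \<Rightarrow> real. F \<in> borel_measurable borel \<Longrightarrow> integrable \<sigma> F \<Longrightarrow>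
      integrable \<sigma> (\<lambda>y. ?J y ^ d * F (\<phi> y))" by metis
  have cap: "{y. dist y z \<le> r} \<in> sets \<sigma>"
    using borel_closed[OF closed_cball[of z r]] by (simp add: cball_def dist_commute)
  have "measure \<sigma> {y. dist y z \<le> r} * (1 / r) ^ d =
      (\<integral>y. indicator {y. dist y z \<le> r} y * (1 / r) ^ d \<partial>\<sigma>)"
    using cap by simp
  also have "\<dots> \<le> (\<integral>y. ?J y ^ d \<partial>\<sigma>)"
  proof (rule integral_mono)
    show "integrable \<sigma> (\<lambda>y. indicator {y. dist y z \<le> r} y * (1 / r) ^ d)"
      using cap by (intro integrable_mult_left integrable_real_indicator) (auto simp: less_top[symmetric])
    show "integrable \<sigma> (\<lambda>y. ?J y ^ d)" using integ[of "\<lambda>_. 1"] by simp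
    fix y
    have "(1 / r) ^ d \<le> ?J y ^ d" if "dist y z \<le> r"
    proof (rule power_mono)
      have "(dist y z)\<^sup>2 \<le> \<theta>" unfolding \<theta>_def using that by (intro power_mono) auto
      moreover have "sqrt (\<theta> * (\<theta> + 4)) \<ge> 2 * r"
        by (rule real_le_rsqrt) (use r in \<open>simp add: \<theta>_def power2_eq_square algebra_simps\<close>)
      ultimately have "2 * r / (\<theta> + \<theta>) \<le> ?J y"
        unfolding moebius_factor_def using \<theta> r by (intro frac_le) (auto simp: add_pos_nonneg)
      then show "1 / r \<le> ?J y" using r by (simp add: \<theta>_def power2_eq_square)
    qed (use r in simp)
    then show "indicator {y. dist y z \<le> r} y * (1 / r) ^ d \<le> ?J y ^ d"
      using Jp[of y] by (auto simp: indicator_def)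
  qed
  also have "\<dots> = 1" using int[of "\<lambda>_. 1"] prob_space by simp
  finally show ?thesis using r by (simp add: power_divide field_simps)
qed

lemma AE_sigma_neq:
  assumes "z \<in> sphere 0 1"
  shows "AE y in \<sigma>. y \<noteq> z"
proof -
  have le: "measure \<sigma> {z} \<le> r" if "0 < r" "r \<le> 1" for r
  proof -
    have "measure \<sigma> {z} \<le> measure \<sigma> {y. dist y z \<le> r}"
      using that borel_closed[OF closed_cball[of z r]]
      by (intro finite_measure_mono) (auto simp: cball_def dist_commute)
    also have "\<dots> \<le> r ^ d" using cap_measure_le[OF assms] that by simp
    also have "\<dots> \<le> r" using that dim power_decreasing[of 1 d r] by simp
    finally show ?thesis .
  qed
  have "measure \<sigma> {z} \<le> 0"
  proof (rule field_le_epsilon)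
    fix e :: real assume "e > 0"
    then show "measure \<sigma> {z} \<le> 0 + e" using le[of "min e 1"] by simp
  qed
  then have "emeasure \<sigma> {z} = 0" by (simp add: emeasure_eq_measure measure_le_0_iff)
  then show ?thesis by (intro AE_I[of _ _ "{z}"]) auto
qed

text \<open>Dyadic decomposition: caps of radius \<open>2 / 2 ^ j\<close> have measure at most
  \<open>(2 / 2 ^ j) ^ d\<close>, on the innermost one containing \<open>y\<close> the integrand is
  at most \<open>(2 powr p) ^ j\<close>, and the resulting series is geometric with ratio
  \<open>2 powr (p - d)\<close>.\<close>

lemma integrable_dist_powr:
  assumes z: "z \<in> sphere 0 1" and p: "p < real d"
  shows "integrable \<sigma> (\<lambda>y. dist y z powr (- p))"
proof (cases "p \<le> 0")
  case True
  show ?thesis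
  proof (rule integrable_AE_bounded)
    fix y :: 'a assume "y \<in> sphere 0 1"
    then have "dist y z powr (- p) \<le> 2 powr (- p)"
      using True bounds_on_sphere(1)[of y z] z by (intro powr_mono2) auto
    then show "\<bar>dist y z powr (- p)\<bar> \<le> 2 powr (- p)" by simp
  qed measurable
next
  case False
  define A where "A j = {y. dist y z \<le> 2 / 2 ^ j}" for j :: nat
  have A [measurable]: "A j \<in> sets borel" for j
    using borel_closed[OF closed_cball[of z "2 / 2 ^ j"]] by (simp add: A_def cball_def dist_commute)
  define q where "q = (2::real) powr (p - real d)"
  have q: "0 \<le> q" "q < 1"
  proof -
    have "q < 2 powr 0" unfolding q_def using p by (intro powr_less_mono) auto
    then show "q < 1" by simp
  qed (simp add: q_def)
  have pointwise: "ennreal (dist y z powr (- p)) \<le> (\<Sum>j. ennreal ((2 powr p) ^ j) * indicator (A j) y)"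
    if y: "y \<in> sphere 0 1" for y
  proof (cases "y = z")
    case False
    define r where "r = dist y z"
    have r: "r > 0" "r \<le> 2" using False bounds_on_sphere(1)[OF y z] by (auto simp: r_def)
    \<comment> \<open>The largest index with \<open>y \<in> A j\<close>; hence
      \<open>r > 1 / 2 ^ j\<close>.\<close>
    define j where "j = nat \<lfloor>log 2 (2 / r)\<rfloor>"
    have l0: "log 2 (2 / r) \<ge> 0" using r by simp
    have "real j \<le> log 2 (2 / r)" "log 2 (2 / r) < real j + 1"
      using l0 unfolding j_def by linarith+
    then have "2 powr real j \<le> 2 / r" "2 / r < 2 powr (real j + 1)"
      using r by (simp_all add: le_log_iff log_less_iff)
    then have j: "2 ^ j \<le> 2 / r" "2 / r < 2 * 2 ^ j"
      by (simp_all add: powr_realpow powr_add)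
    have "y \<in> A j" using j(1) r by (simp add: A_def r_def[symmetric] field_simps)
    have "r powr (- p) \<le> (1 / 2 ^ j) powr (- p)"
      using j(2) r \<open>\<not> p \<le> 0\<close> by (intro powr_mono2') (auto simp: field_simps)
    also have "\<dots> = (2 powr p) ^ j"
      by (simp add: powr_minus powr_divide powr_realpow[symmetric] powr_powr mult.commute)
    finally have "ennreal (r powr (- p)) \<le> ennreal ((2 powr p) ^ j) * indicator (A j) y"
      using \<open>y \<in> A j\<close> by (simp add: ennreal_leI)
    also have "\<dots> \<le> (\<Sum>j. ennreal ((2 powr p) ^ j) * indicator (A j) y)"
    proof -
      define f where "f j = ennreal ((2 powr p) ^ j) * indicator (A j) y" for j
      have "sum f {j} \<le> suminf f" by (rule sum_le_suminf) auto
      then have "f j \<le> suminf f" by simp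
      then show ?thesis unfolding f_def[abs_def] .
    qed
    finally show ?thesis by (simp add: r_def)
  qed simp
  have "(\<integral>\<^sup>+y. ennreal (norm (dist y z powr (- p))) \<partial>\<sigma>) \<le>
      (\<integral>\<^sup>+y. (\<Sum>j. ennreal ((2 powr p) ^ j) * indicator (A j) y) \<partial>\<sigma>)"
    by (rule nn_integral_mono_AE) (use AE_sphere pointwise in \<open>auto elim!: eventually_mono\<close>)
  also have "\<dots> = (\<Sum>j. \<integral>\<^sup>+y. ennreal ((2 powr p) ^ j) * indicator (A j) y \<partial>\<sigma>)"
    by (rule nn_integral_suminf) measurable
  also have "\<dots> \<le> (\<Sum>j. ennreal (2 ^ d * q ^ j))"
  proof (intro suminf_le summableI)
    fix j
    have "(\<integral>\<^sup>+y. ennreal ((2 powr p) ^ j) * indicator (A j) y \<partial>\<sigma>) = ennreal ((2 powr p) ^ j * measure \<sigma> (A j))"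
      by (subst nn_integral_cmult_indicator) (auto simp: emeasure_eq_measure ennreal_mult')
    also have "(2 powr p) ^ j * measure \<sigma> (A j) \<le> (2 powr p) ^ j * (2 / 2 ^ j) ^ d"
      unfolding A_def using z by (intro mult_left_mono cap_measure_le) auto
    also have "\<dots> = 2 ^ d * ((2 powr p) ^ j / (2 powr real d) ^ j)"
      by (simp add: power_divide powr_realpow power_mult[symmetric] mult.commute)
    also have "\<dots> = 2 ^ d * q ^ j" by (simp add: q_def powr_diff power_divide)
    finally show "(\<integral>\<^sup>+y. ennreal ((2 powr p) ^ j) * indicator (A j) y \<partial>\<sigma>) \<le> ennreal (2 ^ d * q ^ j)"
      by (simp add: ennreal_leI)
  qed
  also have "\<dots> < \<infinity>"
  proof -
    have "summable (\<lambda>j. 2 ^ d * q ^ j)" using q by (intro summable_mult summable_geometric) auto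
    then show ?thesis using q by (subst suminf_ennreal2) auto
  qed
  finally show ?thesis by (intro integrableI_bounded) measurable
qed

lemma AE_sphere_neq:
  assumes "z \<in> sphere 0 1"
  shows "AE y in \<sigma>. y \<in> sphere 0 1 \<and> dist y z > 0"
  using AE_sphere AE_sigma_neq[OF assms] by eventually_elim simp

end

subsection \<open>Riesz potentials\<close>

definition riesz :: "real \<Rightarrow> real \<Rightarrow> real" where
  "riesz s r = (if s = 0 then - ln r else sgn s * r powr (- s))"

lemma borel_measurable_riesz [measurable]: "riesz s \<in> borel_measurable borel"
  unfolding riesz_def[abs_def] by measurable

lemma borel_measurable_riesz_profile [measurable]: "riesz_profile s \<in> borel_measurable borel"
  unfolding riesz_profile_def[abs_def] by measurable

lemma riesz_kernel_eq: "x \<noteq> y \<or> s < 0 \<Longrightarrow> riesz_kernel s x y = ereal (riesz s (dist x y))"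
  by (auto simp: riesz_kernel_def riesz_def)

text \<open>On the diagonal both sides are 0, because of \<open>ln 0 = 0\<close> and \<open>0 powr p = 0\<close>.\<close>

lemma real_of_riesz_kernel: "real_of_ereal (riesz_kernel s x y) = riesz s (dist x y)"
  by (auto simp: riesz_kernel_def riesz_def)

text \<open>Reduces the logarithmic kernel to the power 1 / 2, which is below \<open>d\<close> for
  every \<open>d \<ge> 1\<close>.\<close>

lemma abs_ln_le_powr:
  fixes r :: real
  assumes "0 < r" "r \<le> 2"
  shows "\<bar>ln r\<bar> \<le> 2 * r powr (- (1 / 2)) + 2"
proof (cases "r \<ge> 1")
  case True
  have "ln r \<le> r - 1" using assms by (intro ln_le_minus_one) auto
  moreover have "ln r \<ge> 0" using True by simp
  moreover have "r powr (- (1 / 2)) \<ge> 0" by simp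
  ultimately show ?thesis using assms by linarith
next
  case False
  have "ln (r powr (- (1 / 2))) \<le> r powr (- (1 / 2)) - 1"
    using assms by (intro ln_le_minus_one) simp
  then have "- ln r \<le> 2 * r powr (- (1 / 2)) - 2" using assms by (simp add: ln_powr)
  moreover have "ln r \<le> 0" using False assms by simp
  ultimately show ?thesis by linarith
qed

locale riesz_sphere = moebius_sphere +
  fixes s :: real
  assumes s_gt: "s > -2" and s_lt: "s < real d"
begin

section \<open>The constant potential of the surface measure\<close>

lemma integrable_riesz:
  assumes z: "z \<in> sphere 0 1"
  shows "integrable \<sigma> (\<lambda>y. riesz s (dist y z))"
proof (cases "s = 0")
  case False
  then show ?thesis unfolding riesz_def using integrable_dist_powr[OF z s_lt] by simp
next
  case True
  have "integrable \<sigma> (\<lambda>y. 2 * dist y z powr (- (1 / 2)) + 2)"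
    using integrable_dist_powr[OF z, of "1 / 2"] dim by simp
  then have "integrable \<sigma> (\<lambda>y. - ln (dist y z))"
  proof (rule Bochner_Integration.integrable_bound)
    show "AE y in \<sigma>. norm (- ln (dist y z)) \<le> norm (2 * dist y z powr (- (1 / 2)) + 2)"
      using AE_sphere_neq[OF z]
    proof eventually_elim
      fix y assume "y \<in> sphere 0 1 \<and> dist y z > 0"
      then show "norm (- ln (dist y z)) \<le> norm (2 * dist y z powr (- (1 / 2)) + 2)"
        using abs_ln_le_powr[of "dist y z"] bounds_on_sphere(1)[of y z] z by simp
    qed
  qed measurable
  with True show ?thesis by (simp add: riesz_def)
qed

definition energy :: real where
  "energy = continuous_energy (riesz_kernel s) \<sigma>"

text \<open>A rotation taking \<open>z\<close> to \<open>x\<close> preserves the measure and all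
  distances, so the potential is constant on the sphere; its mean is the energy.\<close>

lemma integral_riesz:
  assumes z: "z \<in> sphere 0 1"
  shows "(\<integral>y. riesz s (dist y z) \<partial>\<sigma>) = energy"
proof -
  have eq: "(\<integral>y. riesz s (dist x y) \<partial>\<sigma>) = (\<integral>y. riesz s (dist y z) \<partial>\<sigma>)"
    if x: "x \<in> sphere 0 1" for x
  proof -
    obtain f where f [measurable]: "f \<in> borel_measurable borel" and fz: "f z = x"
      and iso: "\<And>u v. dist (f u) (f v) = dist u v" and img: "distr \<sigma> borel f = \<sigma>"
      using rotation[OF z x] by blast
    have "(\<integral>y. riesz s (dist x y) \<partial>\<sigma>) = (\<integral>y. riesz s (dist x y) \<partial>distr \<sigma> borel f)"
      by (simp only: img)
    also have "\<dots> = (\<integral>y. riesz s (dist x (f y)) \<partial>\<sigma>)"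
      by (rule integral_distr) measurable
    also have "\<dots> = (\<integral>y. riesz s (dist y z) \<partial>\<sigma>)"
      by (simp add: iso fz[symmetric] dist_commute)
    finally show ?thesis .
  qed
  have "energy = (\<integral>x. \<integral>y. riesz s (dist x y) \<partial>\<sigma> \<partial>\<sigma>)"
    by (simp add: energy_def continuous_energy_def real_of_riesz_kernel)
  also have "\<dots> = (\<integral>x. \<integral>y. riesz s (dist y z) \<partial>\<sigma> \<partial>\<sigma>)"
    by (rule integral_cong_sphere) (use eq in simp_all)
  finally show ?thesis using prob_space by simp
qed

lemma energy_eq_sgn_abs:
  assumes "s \<noteq> 0"
  shows "energy = sgn s * \<bar>energy\<bar>" "\<bar>energy\<bar> > 0"
proof -
  obtain z :: 'a where z: "z \<in> sphere 0 1"
    using vector_choose_size[of 1] by (metis mem_sphere_0 zero_le_one)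
  define P where "P = (\<integral>y. dist y z powr (- s) \<partial>\<sigma>)"
  have e: "energy = sgn s * P"
    using integral_riesz[OF z] assms by (simp add: riesz_def P_def)
  have "(\<integral>y. 0 \<partial>\<sigma>) < P" unfolding P_def
  proof (rule integral_less_AE_space)
    show "integrable \<sigma> (\<lambda>y. dist y z powr (- s))" by (rule integrable_dist_powr[OF z s_lt])
    show "AE y in \<sigma>. 0 < dist y z powr (- s)"
      using AE_sphere_neq[OF z] by eventually_elim simp
    show "emeasure \<sigma> (space \<sigma>) \<noteq> 0" by (simp only: emeasure_space_1) simp
  qed simp
  then have "P > 0" by simp
  with e show "energy = sgn s * \<bar>energy\<bar>" "\<bar>energy\<bar> > 0"
    using assms by (auto simp: abs_mult sgn_if)
qed

text \<open>For \<open>s \<noteq> 0\<close> the energy has the sign of \<open>s\<close>, which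
  \<open>riesz_profile\<close> absorbs. For \<open>s = 0\<close> conformal factors enter a logarithm
  additively, so the profile appears with factor 1 whatever the energy is.\<close>

definition energy_scale :: real where
  "energy_scale = (if s = 0 then 1 else \<bar>energy\<bar>)"

lemma energy_scale_pos: "energy_scale > 0"
  using energy_eq_sgn_abs(2) by (simp add: energy_scale_def)

text \<open>
  Scaled so that its potential at \<open>x\<close> is \<^const>\<open>riesz_profile\<close> at \<open>\<theta> + |x - z|\<^sup>2\<close> up to
  a factor that does not depend on \<open>\<theta>\<close> and an additive constant.
\<close>

definition bubble :: "real \<Rightarrow> 'a \<Rightarrow> 'a \<Rightarrow> real" where
  "bubble \<theta> z y = (\<theta> * (\<theta> + 4)) powr ((real d - s) / 2) *
    (\<theta> + (dist y z)\<^sup>2) powr (- (real d - s / 2))"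

section \<open>Bubbles: total mass and potential\<close>

lemma bubble_nonneg: "bubble \<theta> z y \<ge> 0"
  by (simp add: bubble_def)

lemma bubble_commute: "bubble \<theta> z y = bubble \<theta> y z"
  by (simp add: bubble_def dist_commute)

lemma borel_measurable_bubble [measurable]:
  "bubble \<theta> z \<in> borel_measurable borel"
  "(\<lambda>p. bubble \<theta> (snd p) (fst p)) \<in> borel_measurable (borel \<Otimes>\<^sub>M borel)"
  unfolding bubble_def[abs_def] by measurable

lemma bubble_eq_moebius_factor:
  assumes "\<theta> > 0"
  shows "bubble \<theta> z y = (\<theta> * (\<theta> + 4)) powr (- s / 4) * moebius_factor \<theta> z y powr (real d - s / 2)"
proof -
  have "(real d - s) / 2 = - s / 4 + (real d - s / 2) / 2" by (simp add: field_simps)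
  then have "(\<theta> * (\<theta> + 4)) powr ((real d - s) / 2) =
      (\<theta> * (\<theta> + 4)) powr (- s / 4) * (\<theta> * (\<theta> + 4)) powr ((real d - s / 2) / 2)"
    by (simp only: powr_add)
  then show ?thesis by (simp add: bubble_def moebius_factor_powr[OF assms])
qed

lemma bubble_bounded:
  assumes "\<theta> > 0"
  shows "\<exists>B\<ge>0. \<forall>y\<in>sphere 0 1. \<forall>z\<in>sphere 0 1. bubble \<theta> z y \<le> B"
proof (intro exI conjI ballI)
  let ?c = "(\<theta> * (\<theta> + 4)) powr ((real d - s) / 2)"
  let ?p = "- (real d - s / 2)"
  show "?c * (\<theta> powr ?p + (\<theta> + 4) powr ?p) \<ge> 0" by simp
  fix y z :: 'a assume "y \<in> sphere 0 1" "z \<in> sphere 0 1"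
  then have "(\<theta> + (dist y z)\<^sup>2) powr ?p \<le> \<theta> powr ?p + (\<theta> + 4) powr ?p"
    using bounds_on_sphere(2)[of y z] assms by (intro powr_between) auto
  then show "bubble \<theta> z y \<le> ?c * (\<theta> powr ?p + (\<theta> + 4) powr ?p)"
    unfolding bubble_def by (intro mult_left_mono) auto
qed

lemma integrable_bubble:
  assumes "z \<in> sphere 0 1" "\<theta> > 0"
  shows "integrable \<sigma> (bubble \<theta> z)"
  unfolding bubble_def[abs_def] using integrable_shifted_powr[OF assms] by simp

lemma integral_bubble:
  assumes "z \<in> sphere 0 1" "\<theta> > 0"
  shows "(\<integral>y. bubble \<theta> z y \<partial>\<sigma>) = (\<integral>y. (\<theta> + (dist y z)\<^sup>2) powr (- (s / 2)) \<partial>\<sigma>)"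
proof -
  let ?w = "\<theta> * (\<theta> + 4)"
  have w: "?w \<noteq> 0" using assms by simp
  have "(\<integral>y. bubble \<theta> z y \<partial>\<sigma>) = ?w powr ((real d - s) / 2) *
      (?w powr (s / 2 - real d / 2) * (\<integral>y. (\<theta> + (dist y z)\<^sup>2) powr (- (s / 2)) \<partial>\<sigma>))"
    unfolding bubble_def using integral_shifted_powr_reflect[OF assms, of "s / 2"] by simp
  moreover have "?w powr ((real d - s) / 2) * ?w powr (s / 2 - real d / 2) = 1"
    using w by (simp add: powr_add[symmetric] diff_divide_distrib)
  ultimately show ?thesis by (simp only: mult.assoc[symmetric] mult_1_left)
qed

text \<open>After reflection of exponents the mass is the integral of a shifted kernel, which is
  below the Riesz kernel for \<open>s > 0\<close> and bounded otherwise. Hence it does not grow as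
  \<theta> tends to 0, although the bubble itself does near its centre.\<close>

lemma integral_bubble_le:
  assumes z: "z \<in> sphere 0 1" and \<theta>: "\<theta> > 0" "\<theta> \<le> T"
  shows "(\<integral>y. bubble \<theta> z y \<partial>\<sigma>) \<le> \<bar>energy\<bar> + (T + 4) powr (- (s / 2))"
proof (cases "s > 0")
  case True
  have "(\<integral>y. (\<theta> + (dist y z)\<^sup>2) powr (- (s / 2)) \<partial>\<sigma>) \<le> (\<integral>y. riesz s (dist y z) \<partial>\<sigma>)"
  proof (rule integral_mono_AE)
    show "integrable \<sigma> (\<lambda>y. (\<theta> + (dist y z)\<^sup>2) powr (- (s / 2)))"
      by (rule integrable_shifted_powr[OF z \<theta>(1)])
    show "integrable \<sigma> (\<lambda>y. riesz s (dist y z))" by (rule integrable_riesz[OF z])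
    show "AE y in \<sigma>. (\<theta> + (dist y z)\<^sup>2) powr (- (s / 2)) \<le> riesz s (dist y z)"
      using AE_sphere_neq[OF z]
    proof eventually_elim
      fix y assume y: "y \<in> sphere 0 1 \<and> dist y z > 0"
      then have "(\<theta> + (dist y z)\<^sup>2) powr (- (s / 2)) \<le> ((dist y z)\<^sup>2) powr (- (s / 2))"
        using True \<theta> by (intro powr_mono2') auto
      also have "\<dots> = dist y z powr (- s)"
        using y by (simp add: powr_realpow[symmetric] powr_powr del: powr_numeral)
      finally show "(\<theta> + (dist y z)\<^sup>2) powr (- (s / 2)) \<le> riesz s (dist y z)"
        using True by (simp add: riesz_def)
    qed
  qed
  also have "\<dots> \<le> \<bar>energy\<bar>" using integral_riesz[OF z] by simp
  finally show ?thesis unfolding integral_bubble[OF z \<theta>(1)] by (simp add: add_increasing2)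
next
  case False
  have "(\<integral>y. (\<theta> + (dist y z)\<^sup>2) powr (- (s / 2)) \<partial>\<sigma>) \<le> (\<integral>y. (T + 4) powr (- (s / 2)) \<partial>\<sigma>)"
  proof (rule integral_mono_AE)
    show "integrable \<sigma> (\<lambda>y. (\<theta> + (dist y z)\<^sup>2) powr (- (s / 2)))"
      by (rule integrable_shifted_powr[OF z \<theta>(1)])
    show "AE y in \<sigma>. (\<theta> + (dist y z)\<^sup>2) powr (- (s / 2)) \<le> (T + 4) powr (- (s / 2))"
      using AE_sphere
    proof eventually_elim
      fix y :: 'a assume y: "y \<in> sphere 0 1"
      show "(\<theta> + (dist y z)\<^sup>2) powr (- (s / 2)) \<le> (T + 4) powr (- (s / 2))"
        using bounds_on_sphere(2)[OF y z] \<theta> False by (intro powr_mono2) auto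
    qed
  qed simp
  also have "\<dots> = (T + 4) powr (- (s / 2))" using prob_space by simp
  finally show ?thesis unfolding integral_bubble[OF z \<theta>(1)] by (simp add: add_increasing)
qed

lemma integrable_mult_bounded:
  fixes f h :: "'a \<Rightarrow> real"
  assumes f: "integrable \<sigma> f" and [measurable]: "h \<in> borel_measurable borel"
    and bd: "\<And>y. y \<in> sphere 0 1 \<Longrightarrow> \<bar>h y\<bar> \<le> B"
  shows "integrable \<sigma> (\<lambda>y. f y * h y)"
proof (rule Bochner_Integration.integrable_bound)
  show "integrable \<sigma> (\<lambda>y. B * \<bar>f y\<bar>)" using f by simp
  have [measurable]: "f \<in> borel_measurable \<sigma>" using f by (rule borel_measurable_integrable)
  show "(\<lambda>y. f y * h y) \<in> borel_measurable \<sigma>" by measurable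
  show "AE y in \<sigma>. norm (f y * h y) \<le> norm (B * \<bar>f y\<bar>)"
    using AE_sphere
  proof eventually_elim
    fix y :: 'a assume y: "y \<in> sphere 0 1"
    have "\<bar>f y\<bar> * \<bar>h y\<bar> \<le> \<bar>f y\<bar> * B" using bd[OF y] by (intro mult_left_mono) auto
    also have "\<dots> \<le> \<bar>B * \<bar>f y\<bar>\<bar>" by (simp add: mult.commute)
    finally show "norm (f y * h y) \<le> norm (B * \<bar>f y\<bar>)" by (simp add: abs_mult)
  qed
qed

lemma integrable_riesz_bubble:
  assumes x: "x \<in> sphere 0 1" and z: "z \<in> sphere 0 1" and \<theta>: "\<theta> > 0"
  shows "integrable \<sigma> (\<lambda>y. riesz s (dist y x) * bubble \<theta> z y)"
proof -
  obtain B where B: "\<And>y z. y \<in> sphere 0 1 \<Longrightarrow> z \<in> sphere 0 1 \<Longrightarrow> bubble \<theta> z y \<le> B"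
    using bubble_bounded[OF \<theta>] by blast
  show ?thesis
    by (rule integrable_mult_bounded[OF integrable_riesz[OF x], of _ B])
      (use B z bubble_nonneg in auto)
qed

lemma integrable_riesz_profile:
  assumes z: "z \<in> sphere 0 1" and \<theta>: "\<theta> > 0"
  shows "integrable \<sigma> (\<lambda>y. riesz_profile t (\<theta> + (dist y z)\<^sup>2))"
proof (cases "t = 0")
  case False
  then show ?thesis
    unfolding riesz_profile_def using integrable_shifted_powr[OF z \<theta>, of "- t / 2"] by simp
next
  case True
  have "\<bar>- ln (\<theta> + (dist y z)\<^sup>2) / 2\<bar> \<le> \<bar>ln \<theta>\<bar> + \<bar>ln (\<theta> + 4)\<bar>" if "y \<in> sphere 0 1" for y
  proof -
    have "ln \<theta> \<le> ln (\<theta> + (dist y z)\<^sup>2)" "ln (\<theta> + (dist y z)\<^sup>2) \<le> ln (\<theta> + 4)"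
      using \<theta> bounds_on_sphere(2)[OF that z] by (auto simp: add_pos_nonneg intro!: ln_mono)
    then show ?thesis by linarith
  qed
  then have "integrable \<sigma> (\<lambda>y. - ln (\<theta> + (dist y z)\<^sup>2) / 2)"
    by (intro integrable_AE_bounded[where B = "\<bar>ln \<theta>\<bar> + \<bar>ln (\<theta> + 4)\<bar>"]) measurable
  with True show ?thesis by (simp add: riesz_profile_def)
qed

text \<open>Evaluate the constant potential at \<phi> x and substitute y = \<phi> y'. Conformality
  splits the kernel into \<open>J x powr (- (s / 2))\<close>, \<open>J y powr (- (s / 2))\<close>
  and the original kernel; the factor in \<open>y\<close>, multiplied by the Jacobian
  \<open>J y ^ d\<close>, is the bubble up to a constant.\<close>

lemma integral_riesz_bubble_nonzero:
  assumes x: "x \<in> sphere 0 1" and z: "z \<in> sphere 0 1" and \<theta>: "\<theta> > 0" and s: "s \<noteq> 0"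
  shows "(\<integral>y. riesz s (dist y x) * bubble \<theta> z y \<partial>\<sigma>) =
    energy * (\<theta> + (dist x z)\<^sup>2) powr (- (s / 2))"
proof -
  let ?J = "moebius_factor \<theta> z"
  let ?w = "\<theta> * (\<theta> + 4)"
  have Jp: "?J y > 0" for y by (rule moebius_factor_pos[OF \<theta>])
  have w: "?w > 0" using \<theta> by simp
  obtain \<phi> where \<phi> [measurable]: "\<phi> \<in> borel_measurable borel"
    and S: "\<And>x. x \<in> sphere 0 1 \<Longrightarrow> \<phi> x \<in> sphere 0 1"
    and inv: "\<And>x. x \<in> sphere 0 1 \<Longrightarrow> ?J (\<phi> x) = inverse (?J x)"
    and conf: "\<And>x y. x \<in> sphere 0 1 \<Longrightarrow> y \<in> sphere 0 1 \<Longrightarrow>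
      dist (\<phi> x) (\<phi> y) = sqrt (?J x * ?J y) * dist x y"
    and "\<And>F :: 'a \<Rightarrow> real. F \<in> borel_measurable borel \<Longrightarrow> integrable \<sigma> F \<Longrightarrow>
      integrable \<sigma> (\<lambda>y. ?J y ^ d * F (\<phi> y))"
    and int: "\<And>F :: 'a \<Rightarrow> real. F \<in> borel_measurable borel \<Longrightarrow>
      (\<integral>y. ?J y ^ d * F (\<phi> y) \<partial>\<sigma>) = (\<integral>y. F y \<partial>\<sigma>)"
    using that by (rule moebius_integral[OF z \<theta>])
  have ww: "?w powr (s / 4) * ?w powr (- s / 4) = 1"
    using \<theta> by (simp add: powr_add[symmetric])
  have "energy = (\<integral>y. riesz s (dist y (\<phi> x)) \<partial>\<sigma>)"
    using integral_riesz[OF S[OF x]] by simp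
  also have "\<dots> = (\<integral>y. ?J y ^ d * riesz s (dist (\<phi> y) (\<phi> x)) \<partial>\<sigma>)"
    by (rule int[symmetric]) measurable
  also have "\<dots> = (\<integral>y. (?J x powr (- (s / 2)) * ?w powr (s / 4)) * (riesz s (dist y x) * bubble \<theta> z y) \<partial>\<sigma>)"
  proof (rule integral_cong_sphere)
    fix y :: 'a assume y: "y \<in> sphere 0 1"
    have "riesz s (dist (\<phi> y) (\<phi> x)) = ?J y powr (- (s / 2)) * ?J x powr (- (s / 2)) * riesz s (dist y x)"
      using s Jp[of x] Jp[of y] unfolding conf[OF y x] riesz_def
      by (simp add: powr_mult powr_half_sqrt[symmetric] powr_powr)
    moreover have "?J y ^ d * ?J y powr (- (s / 2)) = ?J y powr (real d - s / 2)"
      using Jp[of y] by (simp add: powr_realpow[symmetric] powr_add[symmetric])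
    moreover have "?w powr (s / 4) * bubble \<theta> z y = ?J y powr (real d - s / 2)"
      using ww by (simp only: bubble_eq_moebius_factor[OF \<theta>] mult.assoc[symmetric] mult_1_left)
    moreover have "A * R' = (b * W) * (R * u)"
      if "R' = a * b * R" "A * a = P" "W * u = P" for A R' a b R W u P :: real
    proof -
      have "A * R' = (A * a) * (b * R)" using that(1) by (simp only: mult_ac)
      also have "\<dots> = (W * u) * (b * R)" using that(2,3) by simp
      finally show ?thesis by (simp only: mult_ac)
    qed
    ultimately show "?J y ^ d * riesz s (dist (\<phi> y) (\<phi> x)) =
      (?J x powr (- (s / 2)) * ?w powr (s / 4)) * (riesz s (dist y x) * bubble \<theta> z y)"
      by blast
  qed measurable
  also have "\<dots> = ?J x powr (- (s / 2)) * ?w powr (s / 4) * (\<integral>y. riesz s (dist y x) * bubble \<theta> z y \<partial>\<sigma>)"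
    by (rule integral_mult_right_zero)
  also have "?J x powr (- (s / 2)) * ?w powr (s / 4) = inverse ((\<theta> + (dist x z)\<^sup>2) powr (- (s / 2)))"
  proof -
    have "?J x powr (- (s / 2)) = ?w powr (- s / 4) * (\<theta> + (dist x z)\<^sup>2) powr (s / 2)"
      by (simp add: moebius_factor_powr[OF \<theta>])
    then have "?J x powr (- (s / 2)) * ?w powr (s / 4) =
        (?w powr (s / 4) * ?w powr (- s / 4)) * (\<theta> + (dist x z)\<^sup>2) powr (s / 2)"
      by (simp only: mult_ac)
    then show ?thesis unfolding ww by (simp add: powr_minus)
  qed
  finally have "energy = inverse ((\<theta> + (dist x z)\<^sup>2) powr (- (s / 2))) *
    (\<integral>y. riesz s (dist y x) * bubble \<theta> z y \<partial>\<sigma>)" .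
  moreover have "\<theta> + (dist x z)\<^sup>2 > 0" using \<theta> by (simp add: add_pos_nonneg)
  then have "(\<theta> + (dist x z)\<^sup>2) powr (- (s / 2)) > 0" by (simp only: powr_gt_zero)
  moreover have "v = e * c" if "e = inverse c * v" "c > 0" for c e v :: real
    using that by (simp add: field_simps)
  ultimately show ?thesis by blast
qed

text \<open>The same substitution, but the conformal factors now split off as summands. The summand
  in \<open>x\<close> gives the profile; the one in \<open>y\<close> integrates to a constant,
  identified by substituting once more and using that \<phi> inverts \<open>J\<close>.\<close>

lemma integral_riesz_bubble_log:
  assumes x: "x \<in> sphere 0 1" and z: "z \<in> sphere 0 1" and \<theta>: "\<theta> > 0" and s: "s = 0"
  shows "(\<integral>y. riesz s (dist y x) * bubble \<theta> z y \<partial>\<sigma>) =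
    energy + riesz_profile 0 (\<theta> + (dist x z)\<^sup>2) - (\<integral>y. riesz_profile 0 (\<theta> + (dist y z)\<^sup>2) \<partial>\<sigma>)"
proof -
  let ?J = "moebius_factor \<theta> z"
  let ?w = "\<theta> * (\<theta> + 4)"
  have Jp: "?J y > 0" for y by (rule moebius_factor_pos[OF \<theta>])
  have w: "?w > 0" using \<theta> by simp
  obtain \<phi> where \<phi> [measurable]: "\<phi> \<in> borel_measurable borel"
    and S: "\<And>x. x \<in> sphere 0 1 \<Longrightarrow> \<phi> x \<in> sphere 0 1"
    and inv: "\<And>x. x \<in> sphere 0 1 \<Longrightarrow> ?J (\<phi> x) = inverse (?J x)"
    and conf: "\<And>x y. x \<in> sphere 0 1 \<Longrightarrow> y \<in> sphere 0 1 \<Longrightarrow>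
      dist (\<phi> x) (\<phi> y) = sqrt (?J x * ?J y) * dist x y"
    and "\<And>F :: 'a \<Rightarrow> real. F \<in> borel_measurable borel \<Longrightarrow> integrable \<sigma> F \<Longrightarrow>
      integrable \<sigma> (\<lambda>y. ?J y ^ d * F (\<phi> y))"
    and int: "\<And>F :: 'a \<Rightarrow> real. F \<in> borel_measurable borel \<Longrightarrow>
      (\<integral>y. ?J y ^ d * F (\<phi> y) \<partial>\<sigma>) = (\<integral>y. F y \<partial>\<sigma>)"
    using that by (rule moebius_integral[OF z \<theta>])
  have bubble: "bubble \<theta> z y = ?J y ^ d" for y
  proof -
    have "bubble \<theta> z y = ?w powr (- s / 4) * ?J y powr (real d - s / 2)"
      by (rule bubble_eq_moebius_factor[OF \<theta>])
    also have "\<dots> = ?J y ^ d" using Jp[of y] \<theta> s by (simp add: powr_realpow)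
    finally show ?thesis .
  qed
  have lnJ: "ln (?J y) / 2 = ln ?w / 4 + riesz_profile 0 (\<theta> + (dist y z)\<^sup>2)" for y
  proof -
    have "\<theta> + (dist y z)\<^sup>2 > 0" using \<theta> by (simp add: add_pos_nonneg)
    moreover have "ln (sqrt a / b) / 2 = ln a / 4 + - ln b / 2" if "a > 0" "b > 0" for a b :: real
      using that by (simp add: ln_div ln_sqrt)
    ultimately show ?thesis using w by (simp only: moebius_factor_def riesz_profile_def simp_thms if_True)
  qed
  have int_bubble: "integrable \<sigma> (\<lambda>y. ?J y ^ d)"
    using integrable_bubble[OF z \<theta>] by (simp add: bubble[abs_def] cong: integrable_cong)
  have int_profile: "integrable \<sigma> (\<lambda>y. riesz_profile 0 (\<theta> + (dist y z)\<^sup>2))"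
    by (rule integrable_riesz_profile[OF z \<theta>])
  have "integrable \<sigma> (\<lambda>y. 2 * (ln ?w / 4 + riesz_profile 0 (\<theta> + (dist y z)\<^sup>2)))"
    using int_profile by simp
  then have int_ln: "integrable \<sigma> (\<lambda>y. ln (?J y))"
    unfolding lnJ[symmetric] by simp
  obtain B where B: "\<And>y z. y \<in> sphere 0 1 \<Longrightarrow> z \<in> sphere 0 1 \<Longrightarrow> bubble \<theta> z y \<le> B"
    using bubble_bounded[OF \<theta>] by blast
  have int_ln_bubble: "integrable \<sigma> (\<lambda>y. ln (?J y) * ?J y ^ d)"
    by (rule integrable_mult_bounded[OF int_ln, of _ B])
      (use B z bubble_nonneg in \<open>auto simp: bubble[symmetric]\<close>)
  have one: "(\<integral>y. ?J y ^ d \<partial>\<sigma>) = 1" using int[of "\<lambda>_. 1"] prob_space by simp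
  have flip: "(\<integral>y. ln (?J y) * ?J y ^ d \<partial>\<sigma>) = - (\<integral>y. ln (?J y) \<partial>\<sigma>)"
  proof -
    have "(\<integral>y. ln (?J y) \<partial>\<sigma>) = (\<integral>y. ?J y ^ d * ln (?J (\<phi> y)) \<partial>\<sigma>)"
      by (rule int[symmetric]) measurable
    also have "\<dots> = (\<integral>y. - (ln (?J y) * ?J y ^ d) \<partial>\<sigma>)"
      by (rule integral_cong_sphere) (use Jp in \<open>simp_all add: inv ln_inverse\<close>)
    finally show ?thesis by simp
  qed
  have "energy = (\<integral>y. riesz s (dist y (\<phi> x)) \<partial>\<sigma>)"
    using integral_riesz[OF S[OF x]] by simp
  also have "\<dots> = (\<integral>y. ?J y ^ d * riesz s (dist (\<phi> y) (\<phi> x)) \<partial>\<sigma>)"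
    by (rule int[symmetric]) measurable
  also have "\<dots> = (\<integral>y. riesz s (dist y x) * bubble \<theta> z y
      - (ln (?J x) / 2 * ?J y ^ d + ln (?J y) * ?J y ^ d / 2) \<partial>\<sigma>)"
  proof (rule integral_cong_AE)
    show "AE y in \<sigma>. ?J y ^ d * riesz s (dist (\<phi> y) (\<phi> x)) =
        riesz s (dist y x) * bubble \<theta> z y - (ln (?J x) / 2 * ?J y ^ d + ln (?J y) * ?J y ^ d / 2)"
      using AE_sphere_neq[OF x]
    proof eventually_elim
      fix y assume y: "y \<in> sphere 0 1 \<and> dist y x > 0"
      have h: "riesz s (dist (\<phi> y) (\<phi> x)) = riesz s (dist y x) - (ln (?J x) / 2 + ln (?J y) / 2)"
        using y s Jp[of x] Jp[of y] conf[of y x] x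
        by (simp add: riesz_def ln_mult ln_sqrt add_divide_distrib)
      show "?J y ^ d * riesz s (dist (\<phi> y) (\<phi> x)) =
        riesz s (dist y x) * bubble \<theta> z y - (ln (?J x) / 2 * ?J y ^ d + ln (?J y) * ?J y ^ d / 2)"
        unfolding h bubble by (simp add: algebra_simps)
    qed
  qed measurable
  also have "\<dots> = (\<integral>y. riesz s (dist y x) * bubble \<theta> z y \<partial>\<sigma>)
      - (ln (?J x) / 2 - (\<integral>y. ln (?J y) \<partial>\<sigma>) / 2)"
    using integrable_riesz_bubble[OF x z \<theta>] int_bubble int_ln_bubble one flip by simp
  also have "ln (?J x) / 2 - (\<integral>y. ln (?J y) \<partial>\<sigma>) / 2 =
      riesz_profile 0 (\<theta> + (dist x z)\<^sup>2) - (\<integral>y. riesz_profile 0 (\<theta> + (dist y z)\<^sup>2) \<partial>\<sigma>)"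
  proof -
    have "(\<integral>y. ln ?w / 4 + riesz_profile 0 (\<theta> + (dist y z)\<^sup>2) \<partial>\<sigma>) =
        ln ?w / 4 + (\<integral>y. riesz_profile 0 (\<theta> + (dist y z)\<^sup>2) \<partial>\<sigma>)"
      using prob_space int_profile by simp
    then have "(\<integral>y. ln (?J y) \<partial>\<sigma>) / 2 = ln ?w / 4 + (\<integral>y. riesz_profile 0 (\<theta> + (dist y z)\<^sup>2) \<partial>\<sigma>)"
      by (simp only: lnJ[symmetric]) simp
    then show ?thesis using lnJ[of x] by linarith
  qed
  finally show ?thesis by simp
qed

text \<open>Subtracting \<open>energy\<close> from the kernel subtracts \<open>energy\<close> times
  the mass of the bubble, and \<open>integral_bubble\<close> turns this into the mean of the
  profile. For \<open>s = 0\<close> the mass is 1 and the constant of the logarithmic formula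
  remains; so all \<open>s\<close> share one formula.\<close>

lemma integral_potential_bubble:
  assumes x: "x \<in> sphere 0 1" and z: "z \<in> sphere 0 1" and \<theta>: "\<theta> > 0"
  shows "(\<integral>y. (riesz s (dist y x) - energy) * bubble \<theta> z y \<partial>\<sigma>) =
    energy_scale * (riesz_profile s (\<theta> + (dist x z)\<^sup>2) - (\<integral>y. riesz_profile s (\<theta> + (dist y z)\<^sup>2) \<partial>\<sigma>))"
proof -
  have "(\<integral>y. (riesz s (dist y x) - energy) * bubble \<theta> z y \<partial>\<sigma>) =
      (\<integral>y. riesz s (dist y x) * bubble \<theta> z y - energy * bubble \<theta> z y \<partial>\<sigma>)"
    by (simp only: left_diff_distrib)
  also have "\<dots> = (\<integral>y. riesz s (dist y x) * bubble \<theta> z y \<partial>\<sigma>) - energy * (\<integral>y. bubble \<theta> z y \<partial>\<sigma>)"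
    using integrable_riesz_bubble[OF assms] integrable_bubble[OF z \<theta>] by simp
  finally have eq: "(\<integral>y. (riesz s (dist y x) - energy) * bubble \<theta> z y \<partial>\<sigma>) =
    (\<integral>y. riesz s (dist y x) * bubble \<theta> z y \<partial>\<sigma>) - energy * (\<integral>y. bubble \<theta> z y \<partial>\<sigma>)" .
  show ?thesis
  proof (cases "s = 0")
    case True
    have "(\<integral>y. bubble \<theta> z y \<partial>\<sigma>) = (\<integral>y. 1 \<partial>\<sigma>)"
      unfolding integral_bubble[OF z \<theta>]
    proof (rule integral_cong_sphere)
      fix y :: 'a
      have "\<theta> + (dist y z)\<^sup>2 > 0" using \<theta> by (simp add: add_pos_nonneg)
      then show "(\<theta> + (dist y z)\<^sup>2) powr (- (s / 2)) = 1" using True by simp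
    qed measurable
    then have one: "(\<integral>y. bubble \<theta> z y \<partial>\<sigma>) = 1" using prob_space by simp
    have scale: "energy_scale = 1" unfolding energy_scale_def using True by simp
    have "energy + a - b - energy * 1 = 1 * (a - b)" for a b :: real by simp
    moreover have "riesz_profile s = riesz_profile 0" using True by simp
    ultimately show ?thesis
      unfolding eq integral_riesz_bubble_log[OF assms True] one scale by simp
  next
    case False
    have prof: "riesz_profile s v = sgn s * v powr (- (s / 2))" for v
      using False by (simp add: riesz_profile_def)
    have "energy_scale * sgn s = energy"
      using energy_eq_sgn_abs(1)[OF False] False by (simp add: energy_scale_def mult.commute)
    then show ?thesis
      unfolding eq integral_riesz_bubble_nonzero[OF assms False] integral_bubble[OF z \<theta>] prof
        integral_mult_right_zero right_diff_distrib
      by (simp only: mult.assoc[symmetric])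
  qed
qed

text \<open>
  The order \<open>d + 1\<close> gives \<open>exponent > d / 2\<close> (integrable tails) and moreover \<open>d - exponent < 0\<close>, so that the
  reflection \<open>b \<mapsto> d - b\<close> of exponents reduces the integrals of the tails to bounded integrands.
\<close>

definition order :: nat where
  "order = d + 1"

definition exponent :: real where
  "exponent = s / 2 + real order"

text \<open>No sign is claimed for this alternating sum. Positivity is needed only for
  \<open>bump\<close>, which describes its potential.\<close>

definition bump_density :: "real \<Rightarrow> 'a \<Rightarrow> 'a \<Rightarrow> real" where
  "bump_density \<theta> z y =
    (\<Sum>k\<le>order. (-1) ^ k * real (order choose k) * bubble (real (Suc k) * \<theta>) z y)"

definition bump :: "real \<Rightarrow> real \<Rightarrow> real" where
  "bump \<theta> v = (\<Sum>k\<le>order. (-1) ^ k * real (order choose k) * riesz_profile s (real (Suc k) * \<theta> + v))"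

section \<open>Bumps: mass of the density, mean and tail of the potential\<close>

lemma borel_measurable_bump_density [measurable]:
  "bump_density \<theta> z \<in> borel_measurable borel"
  "(\<lambda>p. bump_density \<theta> (snd p) (fst p)) \<in> borel_measurable (borel \<Otimes>\<^sub>M borel)"
  unfolding bump_density_def[abs_def] by measurable

lemma borel_measurable_bump [measurable]: "bump \<theta> \<in> borel_measurable borel"
  unfolding bump_def[abs_def] by measurable

text \<open>By this symmetry \<open>integral_bump_density_le\<close>, a bound on the integral over
  \<open>y\<close>, also bounds integrals over the centre \<open>z\<close>, uniformly in
  \<theta>.\<close>

lemma bump_density_commute: "bump_density \<theta> z y = bump_density \<theta> y z"
  by (simp add: bump_density_def bubble_commute)

lemma bump_density_bounded:
  assumes "\<theta> > 0"
  shows "\<exists>B\<ge>0. \<forall>y\<in>sphere 0 1. \<forall>z\<in>sphere 0 1. \<bar>bump_density \<theta> z y\<bar> \<le> B"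
proof -
  have "\<exists>B\<ge>0. \<forall>y\<in>sphere 0 1. \<forall>z\<in>sphere 0 1. bubble (real (Suc k) * \<theta>) z y \<le> B" for k
    using assms by (intro bubble_bounded) simp
  then obtain B where B: "\<And>k. B k \<ge> 0"
    "\<And>k y z. y \<in> sphere 0 1 \<Longrightarrow> z \<in> sphere 0 1 \<Longrightarrow> bubble (real (Suc k) * \<theta>) z y \<le> B k"
    by metis
  have "\<bar>bump_density \<theta> z y\<bar> \<le> (\<Sum>k\<le>order. real (order choose k) * B k)"
    if "y \<in> sphere 0 1" "z \<in> sphere 0 1" for y z
    unfolding bump_density_def
  proof (rule sum_abs[THEN order_trans], rule sum_mono)
    fix k
    have "\<bar>(-1) ^ k * real (order choose k) * bubble (real (Suc k) * \<theta>) z y\<bar> =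
        real (order choose k) * bubble (real (Suc k) * \<theta>) z y"
      using bubble_nonneg by (simp add: abs_mult power_abs)
    also have "\<dots> \<le> real (order choose k) * B k"
      using B(2)[OF that] by (intro mult_left_mono) auto
    finally show "\<bar>(-1) ^ k * real (order choose k) * bubble (real (Suc k) * \<theta>) z y\<bar> \<le> real (order choose k) * B k" .
  qed
  moreover have "(\<Sum>k\<le>order. real (order choose k) * B k) \<ge> 0"
    using B(1) by (intro sum_nonneg) auto
  ultimately show ?thesis by blast
qed

lemma integral_bump_density_le:
  "\<exists>C>0. \<forall>\<theta>. 0 < \<theta> \<longrightarrow> \<theta> \<le> 1 \<longrightarrow> (\<forall>z\<in>sphere 0 1. (\<integral>y. \<bar>bump_density \<theta> z y\<bar> \<partial>\<sigma>) \<le> C)"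
proof -
  define T where "T = real (Suc order)"
  define D where "D = \<bar>energy\<bar> + (T + 4) powr (- (s / 2))"
  define C where "C = (\<Sum>k\<le>order. real (order choose k) * D) + 1"
  have D: "D \<ge> 0" by (simp add: D_def)
  have "C > 0" unfolding C_def using D by (intro add_nonneg_pos sum_nonneg) auto
  moreover have "(\<integral>y. \<bar>bump_density \<theta> z y\<bar> \<partial>\<sigma>) \<le> C"
    if \<theta>: "0 < \<theta>" "\<theta> \<le> 1" and z: "z \<in> sphere 0 1" for \<theta> z
  proof -
    have pos: "real (Suc k) * \<theta> > 0" for k using \<theta> by simp
    have le: "real (Suc k) * \<theta> \<le> T" if "k \<le> order" for k
      unfolding T_def using that \<theta> mult_mono[of "real (Suc k)" "real (Suc order)" \<theta> 1] by simp
    have int: "integrable \<sigma> (bubble (real (Suc k) * \<theta>) z)" for k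
      by (rule integrable_bubble[OF z pos])
    have "(\<integral>y. \<bar>bump_density \<theta> z y\<bar> \<partial>\<sigma>) \<le>
        (\<integral>y. (\<Sum>k\<le>order. real (order choose k) * bubble (real (Suc k) * \<theta>) z y) \<partial>\<sigma>)"
    proof (rule integral_mono)
      show "integrable \<sigma> (\<lambda>y. \<bar>bump_density \<theta> z y\<bar>)"
        unfolding bump_density_def using int by (intro integrable_abs Bochner_Integration.integrable_sum integrable_mult_right) auto
      show "integrable \<sigma> (\<lambda>y. \<Sum>k\<le>order. real (order choose k) * bubble (real (Suc k) * \<theta>) z y)"
        using int by (intro Bochner_Integration.integrable_sum integrable_mult_right) auto
      fix y
      show "\<bar>bump_density \<theta> z y\<bar> \<le> (\<Sum>k\<le>order. real (order choose k) * bubble (real (Suc k) * \<theta>) z y)"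
        unfolding bump_density_def
        by (rule sum_abs[THEN order_trans], rule sum_mono)
          (use bubble_nonneg in \<open>simp add: abs_mult power_abs\<close>)
    qed
    also have "\<dots> = (\<Sum>k\<le>order. real (order choose k) * (\<integral>y. bubble (real (Suc k) * \<theta>) z y \<partial>\<sigma>))"
      using int by (subst Bochner_Integration.integral_sum) auto
    also have "\<dots> \<le> (\<Sum>k\<le>order. real (order choose k) * D)"
      unfolding D_def using integral_bubble_le[OF z pos le] by (intro sum_mono mult_left_mono) auto
    finally show ?thesis by (simp add: C_def)
  qed
  ultimately show ?thesis by blast
qed

lemma integral_potential_bump_density:
  assumes x: "x \<in> sphere 0 1" and z: "z \<in> sphere 0 1" and \<theta>: "\<theta> > 0"
  shows "(\<integral>y. (riesz s (dist y x) - energy) * bump_density \<theta> z y \<partial>\<sigma>) =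
    energy_scale * (bump \<theta> ((dist x z)\<^sup>2) - (\<integral>y. bump \<theta> ((dist y z)\<^sup>2) \<partial>\<sigma>))"
proof -
  let ?c = "\<lambda>k. (-1) ^ k * real (order choose k)"
  let ?t = "\<lambda>k. real (Suc k) * \<theta>"
  have pos: "?t k > 0" for k using \<theta> by simp
  have int1: "integrable \<sigma> (\<lambda>y. (riesz s (dist y x) - energy) * bubble (?t k) z y)" for k
    unfolding left_diff_distrib
    using integrable_riesz_bubble[OF x z pos] integrable_bubble[OF z pos] by simp
  have int2: "integrable \<sigma> (\<lambda>y. riesz_profile s (?t k + (dist y z)\<^sup>2))" for k
    by (rule integrable_riesz_profile[OF z pos])
  have "(\<integral>y. (riesz s (dist y x) - energy) * bump_density \<theta> z y \<partial>\<sigma>) =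
      (\<integral>y. (\<Sum>k\<le>order. ?c k * ((riesz s (dist y x) - energy) * bubble (?t k) z y)) \<partial>\<sigma>)"
    by (simp only: bump_density_def sum_distrib_left mult.left_commute)
  also have "\<dots> = (\<Sum>k\<le>order. ?c k * (\<integral>y. (riesz s (dist y x) - energy) * bubble (?t k) z y \<partial>\<sigma>))"
    using int1 by (subst Bochner_Integration.integral_sum) auto
  also have "\<dots> = (\<Sum>k\<le>order. ?c k * (energy_scale * (riesz_profile s (?t k + (dist x z)\<^sup>2)
      - (\<integral>y. riesz_profile s (?t k + (dist y z)\<^sup>2) \<partial>\<sigma>))))"
    by (simp only: integral_potential_bubble[OF x z pos])
  also have "\<dots> = energy_scale * (bump \<theta> ((dist x z)\<^sup>2) -
      (\<Sum>k\<le>order. ?c k * (\<integral>y. riesz_profile s (?t k + (dist y z)\<^sup>2) \<partial>\<sigma>)))"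
    unfolding bump_def
    by (simp only: right_diff_distrib sum_distrib_left sum_subtractf mult.left_commute)
  also have "(\<Sum>k\<le>order. ?c k * (\<integral>y. riesz_profile s (?t k + (dist y z)\<^sup>2) \<partial>\<sigma>)) =
      (\<integral>y. bump \<theta> ((dist y z)\<^sup>2) \<partial>\<sigma>)"
    unfolding bump_def using int2 by (subst Bochner_Integration.integral_sum) auto
  finally show ?thesis .
qed

lemma exponent_gt: "exponent > real d / 2" "exponent > 0"
  using s_gt dim by (simp_all add: exponent_def order_def)

text \<open>Reflection replaces \<open>- exponent\<close> by the positive power
  \<open>p = s / 2 + 1\<close> and moves the singular size into a prefactor. The remaining integrand
  is bounded, and bounded below outside the cap of radius 1 / 2, that is on at least half of the
  sphere.\<close>

lemma integral_shifted_powr_bounds: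
  "\<exists>c>0. \<exists>C>0. \<forall>\<theta>. 0 < \<theta> \<longrightarrow> \<theta> \<le> 1 \<longrightarrow> (\<forall>z\<in>sphere 0 1.
    c * \<theta> powr (real d / 2 - exponent) \<le> (\<integral>y. (\<theta> + (dist y z)\<^sup>2) powr (- exponent) \<partial>\<sigma>) \<and>
    (\<integral>y. (\<theta> + (dist y z)\<^sup>2) powr (- exponent) \<partial>\<sigma>) \<le> C * \<theta> powr (real d / 2 - exponent))"
proof -
  define e where "e = real d / 2 - exponent"
  define p where "p = s / 2 + 1"
  have e: "e \<le> 0" using exponent_gt by (simp add: e_def)
  have p: "p > 0" using s_gt by (simp add: p_def)
  \<comment> \<open>For \<theta> \<le> 1 the product \<theta> (\<theta> + 4) lies between \<theta>
    and 5 \<theta>, and \<open>e \<le> 0\<close>; this gives \<open>5 powr e\<close>. The rest comes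
    from the squared distance 1 / 4 and the measure 1 / 2 outside the cap; \<open>C\<close> comes
    from \<theta> + |y - z|^2 \<le> 5.\<close>
  define c where "c = 5 powr e * (1 / 4 powr p / 2)"
  define C where "C = (5::real) powr p"
  have bounds: "c * \<theta> powr e \<le> (\<integral>y. (\<theta> + (dist y z)\<^sup>2) powr (- exponent) \<partial>\<sigma>) \<and>
    (\<integral>y. (\<theta> + (dist y z)\<^sup>2) powr (- exponent) \<partial>\<sigma>) \<le> C * \<theta> powr e"
    if \<theta>: "0 < \<theta>" "\<theta> \<le> 1" and z: "z \<in> sphere 0 1" for \<theta> z
  proof -
    let ?w = "\<theta> * (\<theta> + 4)"
    let ?I = "\<integral>y. (\<theta> + (dist y z)\<^sup>2) powr p \<partial>\<sigma>"
    have w: "\<theta> \<le> ?w" "?w \<le> 5 * \<theta>" "0 < ?w"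
      using \<theta> mult_left_mono[of "\<theta> + 4" 5 \<theta>] mult_left_mono[of 1 "\<theta> + 4" \<theta>]
      by (simp_all add: mult.commute)
    have eq: "(\<integral>y. (\<theta> + (dist y z)\<^sup>2) powr (- exponent) \<partial>\<sigma>) = ?w powr e * ?I"
    proof -
      have "- (real d - (real d - exponent)) = - exponent" "real d - exponent - real d / 2 = e"
        "- (real d - exponent) = p"
        by (simp_all add: e_def p_def exponent_def order_def field_simps)
      then show ?thesis using integral_shifted_powr_reflect[OF z \<theta>(1), of "real d - exponent"] by simp
    qed
    have int: "integrable \<sigma> (\<lambda>y. (\<theta> + (dist y z)\<^sup>2) powr p)"
      by (rule integrable_shifted_powr[OF z \<theta>(1)])
    have I_le: "?I \<le> C"
    proof -
      have "?I \<le> (\<integral>y. C \<partial>\<sigma>)"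
      proof (rule integral_mono_AE[OF int])
        show "AE y in \<sigma>. (\<theta> + (dist y z)\<^sup>2) powr p \<le> C"
          using AE_sphere
        proof eventually_elim
          fix y :: 'a assume y: "y \<in> sphere 0 1"
          show "(\<theta> + (dist y z)\<^sup>2) powr p \<le> C"
            unfolding C_def using bounds_on_sphere(2)[OF y z] \<theta> p by (intro powr_mono2) auto
        qed
      qed simp
      then show ?thesis using prob_space by simp
    qed
    have I_ge: "?I \<ge> 1 / 4 powr p / 2"
    proof -
      let ?A = "{y. dist y z \<le> 1 / 2}"
      have A: "?A \<in> sets \<sigma>"
        using borel_closed[OF closed_cball[of z "1 / 2"]] by (simp add: cball_def dist_commute)
      have "measure \<sigma> ?A \<le> (1 / 2) ^ d" by (rule cap_measure_le[OF z]) simp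
      also have "\<dots> \<le> 1 / 2" using power_decreasing[OF dim, of "1 / 2 :: real"] by simp
      finally have "1 / 2 \<le> measure \<sigma> (UNIV - ?A)"
        using prob_compl[OF A] by simp
      then have "1 / 4 powr p / 2 \<le> 1 / 4 powr p * measure \<sigma> (UNIV - ?A)"
        using mult_left_mono[of "1 / 2" "measure \<sigma> (UNIV - ?A)" "1 / 4 powr p"] by simp
      also have "\<dots> = (\<integral>y. 1 / 4 powr p * indicator (UNIV - ?A) y \<partial>\<sigma>)"
        using A by simp
      also have "\<dots> \<le> ?I"
      proof (rule integral_mono[OF _ int])
        show "integrable \<sigma> (\<lambda>y. 1 / 4 powr p * indicator (UNIV - ?A) y)"
          using A by (intro integrable_mult_right integrable_real_indicator) (auto simp: less_top[symmetric])
        fix y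
        have "1 / 4 powr p \<le> (\<theta> + (dist y z)\<^sup>2) powr p" if "y \<notin> ?A"
        proof -
          have "(1 / 2)\<^sup>2 \<le> (dist y z)\<^sup>2" using that by (intro power_mono) auto
          then have "(1 / 4) powr p \<le> (\<theta> + (dist y z)\<^sup>2) powr p"
            using \<theta> p by (intro powr_mono2) (auto simp: power2_eq_square)
          then show ?thesis by (simp add: powr_divide)
        qed
        then show "1 / 4 powr p * indicator (UNIV - ?A) y \<le> (\<theta> + (dist y z)\<^sup>2) powr p"
          by (auto simp: indicator_def)
      qed
      finally show ?thesis .
    qed
    have "c * \<theta> powr e = (5 * \<theta>) powr e * (1 / 4 powr p / 2)"
      using \<theta> by (simp add: c_def powr_mult)
    also have "\<dots> \<le> ?w powr e * ?I"
      by (rule mult_mono[OF powr_mono2'[OF e w(3) w(2)] I_ge]) auto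
    finally have lower: "c * \<theta> powr e \<le> ?w powr e * ?I" .
    have "?w powr e * ?I \<le> \<theta> powr e * C"
      by (rule mult_mono[OF powr_mono2'[OF e \<theta>(1) w(1)] I_le])
        (auto intro!: Bochner_Integration.integral_nonneg)
    with lower show ?thesis unfolding eq by (simp add: mult.commute)
  qed
  have "c > 0" "C > 0" by (simp_all add: c_def C_def)
  with bounds show ?thesis unfolding e_def by blast
qed

lemma bump_bounds:
  "\<exists>c>0. \<exists>C>0. \<forall>\<theta>>0. \<forall>v\<ge>0. c * (\<theta> ^ order * (\<theta> + v) powr (- exponent)) \<le> bump \<theta> v \<and>
    bump \<theta> v \<le> C * (\<theta> ^ order * (\<theta> + v) powr (- exponent))"
  unfolding bump_def exponent_def
  by (rule riesz_profile_difference_bounds[OF s_gt]) (simp add: order_def)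

lemma integrable_bump:
  assumes z: "z \<in> sphere 0 1" and \<theta>: "\<theta> > 0"
  shows "integrable \<sigma> (\<lambda>y. bump \<theta> ((dist y z)\<^sup>2))"
proof -
  have pos: "real (Suc k) * \<theta> > 0" for k using \<theta> by simp
  show ?thesis unfolding bump_def
    by (intro Bochner_Integration.integrable_sum integrable_mult_right integrable_riesz_profile[OF z pos])
qed

text \<open>Mean and tail have the same order in \<theta>, but the tail carries a negative power of
  \<Lambda>; a fixed large \<Lambda> therefore makes it a small fraction of the mean at every scale.
  On the tail, \<theta> may be replaced by \<Lambda> \<theta> at the cost of
  \<open>2 powr exponent\<close>, so the tail is estimated by a full integral at the larger
  scale.\<close>

lemma integral_bump_bounds:
  "\<exists>c>0. \<exists>C>0. \<forall>\<theta>. 0 < \<theta> \<longrightarrow> \<theta> \<le> 1 \<longrightarrow> (\<forall>z\<in>sphere 0 1.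
    c * \<theta> powr ((real d - s) / 2) \<le> (\<integral>y. bump \<theta> ((dist y z)\<^sup>2) \<partial>\<sigma>) \<and>
    (\<forall>\<Lambda>\<ge>1. \<Lambda> * \<theta> \<le> 1 \<longrightarrow>
      (\<integral>y. indicator {y. \<Lambda> * \<theta> \<le> (dist y z)\<^sup>2} y * bump \<theta> ((dist y z)\<^sup>2) \<partial>\<sigma>)
        \<le> C * \<Lambda> powr (real d / 2 - exponent) * \<theta> powr ((real d - s) / 2)))"
proof -
  obtain c1 C1 where c1: "c1 > 0" "C1 > 0" and bump: "\<And>\<theta> v. \<theta> > 0 \<Longrightarrow> v \<ge> 0 \<Longrightarrow>
      c1 * (\<theta> ^ order * (\<theta> + v) powr (- exponent)) \<le> bump \<theta> v \<and>
      bump \<theta> v \<le> C1 * (\<theta> ^ order * (\<theta> + v) powr (- exponent))"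
    using bump_bounds by blast
  obtain c2 C2 where c2: "c2 > 0" "C2 > 0" and pw: "\<And>\<theta> z. 0 < \<theta> \<Longrightarrow> \<theta> \<le> 1 \<Longrightarrow> z \<in> sphere 0 1 \<Longrightarrow>
    c2 * \<theta> powr (real d / 2 - exponent) \<le> (\<integral>y. (\<theta> + (dist y z)\<^sup>2) powr (- exponent) \<partial>\<sigma>) \<and>
    (\<integral>y. (\<theta> + (dist y z)\<^sup>2) powr (- exponent) \<partial>\<sigma>) \<le> C2 * \<theta> powr (real d / 2 - exponent)"
    using integral_shifted_powr_bounds by blast
  have scale: "\<theta> ^ order * \<theta> powr (real d / 2 - exponent) = \<theta> powr ((real d - s) / 2)" if "\<theta> > 0" for \<theta> :: real
  proof -
    have "\<theta> ^ order * \<theta> powr (real d / 2 - exponent) = \<theta> powr (real order + (real d / 2 - exponent))"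
      using that by (simp add: powr_add powr_realpow)
    also have "real order + (real d / 2 - exponent) = (real d - s) / 2"
      by (simp add: exponent_def field_simps)
    finally show ?thesis .
  qed
  define c where "c = c1 * c2"
  define C where "C = C1 * (2 powr exponent * C2)"
  have lower: "c * \<theta> powr ((real d - s) / 2) \<le> (\<integral>y. bump \<theta> ((dist y z)\<^sup>2) \<partial>\<sigma>)"
    if \<theta>: "0 < \<theta>" "\<theta> \<le> 1" and z: "z \<in> sphere 0 1" for \<theta> z
  proof -
    have "c * \<theta> powr ((real d - s) / 2) = c1 * \<theta> ^ order * (c2 * \<theta> powr (real d / 2 - exponent))"
      using scale[OF \<theta>(1)] by (simp add: c_def)
    also have "\<dots> \<le> c1 * \<theta> ^ order * (\<integral>y. (\<theta> + (dist y z)\<^sup>2) powr (- exponent) \<partial>\<sigma>)"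
      using pw[OF \<theta> z] c1 \<theta> by (intro mult_left_mono) auto
    also have "\<dots> = (\<integral>y. c1 * (\<theta> ^ order * (\<theta> + (dist y z)\<^sup>2) powr (- exponent)) \<partial>\<sigma>)"
      by (simp add: mult.assoc)
    also have "\<dots> \<le> (\<integral>y. bump \<theta> ((dist y z)\<^sup>2) \<partial>\<sigma>)"
      using bump[OF \<theta>(1)] integrable_shifted_powr[OF z \<theta>(1)] integrable_bump[OF z \<theta>(1)]
      by (intro integral_mono) auto
    finally show ?thesis .
  qed
  have upper: "(\<integral>y. indicator {y. \<Lambda> * \<theta> \<le> (dist y z)\<^sup>2} y * bump \<theta> ((dist y z)\<^sup>2) \<partial>\<sigma>)
        \<le> C * \<Lambda> powr (real d / 2 - exponent) * \<theta> powr ((real d - s) / 2)"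
    if \<theta>: "0 < \<theta>" and z: "z \<in> sphere 0 1" and \<Lambda>: "\<Lambda> \<ge> 1" "\<Lambda> * \<theta> \<le> 1" for \<theta> z \<Lambda>
  proof -
    define t where "t = \<Lambda> * \<theta>"
    have t: "0 < t" "t \<le> 1" using \<theta> \<Lambda> by (auto simp: t_def)
    have "(\<integral>y. indicator {y. t \<le> (dist y z)\<^sup>2} y * bump \<theta> ((dist y z)\<^sup>2) \<partial>\<sigma>) \<le>
        (\<integral>y. C1 * (\<theta> ^ order * (2 powr exponent * (t + (dist y z)\<^sup>2) powr (- exponent))) \<partial>\<sigma>)"
    proof (rule integral_mono)
      have "{y. t \<le> (dist y z)\<^sup>2} \<in> sets \<sigma>" by measurable
      then show "integrable \<sigma> (\<lambda>y. indicator {y. t \<le> (dist y z)\<^sup>2} y * bump \<theta> ((dist y z)\<^sup>2))"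
        unfolding mult.commute[of "indicator _ _"]
        by (rule integrable_real_mult_indicator[OF _ integrable_bump[OF z \<theta>]])
      show "integrable \<sigma> (\<lambda>y. C1 * (\<theta> ^ order * (2 powr exponent * (t + (dist y z)\<^sup>2) powr (- exponent))))"
        using integrable_shifted_powr[OF z t(1)] by simp
      fix y
      let ?u = "(dist y z)\<^sup>2"
      have "bump \<theta> ?u \<le> C1 * (\<theta> ^ order * (2 powr exponent * (t + ?u) powr (- exponent)))" if "t \<le> ?u"
      proof -
        have "(\<theta> + ?u) powr (- exponent) \<le> ((t + ?u) / 2) powr (- exponent)"
          using that t \<theta> exponent_gt by (intro powr_mono2') auto
        also have "\<dots> = 2 powr exponent * (t + ?u) powr (- exponent)"
          using t by (simp add: powr_divide powr_minus field_simps add_pos_nonneg)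
        finally have "C1 * (\<theta> ^ order * (\<theta> + ?u) powr (- exponent)) \<le>
            C1 * (\<theta> ^ order * (2 powr exponent * (t + ?u) powr (- exponent)))"
          using c1 \<theta> by (intro mult_left_mono) auto
        with bump[OF \<theta>, of ?u] show ?thesis by simp
      qed
      moreover have "0 \<le> C1 * (\<theta> ^ order * (2 powr exponent * (t + ?u) powr (- exponent)))"
        using c1 \<theta> by simp
      ultimately show "indicator {y. t \<le> (dist y z)\<^sup>2} y * bump \<theta> ?u \<le>
          C1 * (\<theta> ^ order * (2 powr exponent * (t + ?u) powr (- exponent)))"
        by (auto simp: indicator_def)
    qed
    also have "\<dots> = C1 * (\<theta> ^ order * (2 powr exponent * (\<integral>y. (t + (dist y z)\<^sup>2) powr (- exponent) \<partial>\<sigma>)))"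
      by simp
    also have "\<dots> \<le> C1 * (\<theta> ^ order * (2 powr exponent * (C2 * t powr (real d / 2 - exponent))))"
      using pw[OF t z] c1 \<theta> by (intro mult_left_mono) auto
    also have "\<dots> = C * \<Lambda> powr (real d / 2 - exponent) * (\<theta> ^ order * \<theta> powr (real d / 2 - exponent))"
      using \<theta> \<Lambda> by (simp add: C_def t_def powr_mult)
    also have "\<dots> = C * \<Lambda> powr (real d / 2 - exponent) * \<theta> powr ((real d - s) / 2)"
      by (simp only: scale[OF \<theta>])
    finally show ?thesis by (simp add: t_def)
  qed
  have "c > 0" "C > 0" using c1 c2 by (simp_all add: c_def C_def)
  with lower upper show ?thesis by (intro exI[of _ c] exI[of _ C] conjI) auto
qed


subsection \<open>The polarization bound\<close>

lemma pair_sigma_finite_sigma: "pair_sigma_finite \<sigma> \<sigma>"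
  by (simp add: pair_sigma_finite_def sigma_finite_measure_axioms)

text \<open>The function \<open>f\<close> may be singular at the given points, but for fixed
  \<theta> the density is bounded on pairs of points of the sphere, which is enough for Fubini. The
  bound \<open>B\<close> used here may depend on \<theta>.\<close>

lemma Fubini_bump_density:
  assumes f: "integrable \<sigma> f" and \<theta>: "\<theta> > 0" and H [measurable]: "H \<in> sets borel"
  shows "integrable \<sigma> (\<lambda>y. f y * (\<integral>z. indicator H z * bump_density \<theta> z y \<partial>\<sigma>))"
    and "(\<integral>y. f y * (\<integral>z. indicator H z * bump_density \<theta> z y \<partial>\<sigma>) \<partial>\<sigma>) =
      (\<integral>z. indicator H z * (\<integral>y. f y * bump_density \<theta> z y \<partial>\<sigma>) \<partial>\<sigma>)"
    and "integrable \<sigma> (\<lambda>z. indicator H z * (\<integral>y. f y * bump_density \<theta> z y \<partial>\<sigma>))"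
proof -
  note measurable_integral = borel_measurable_lebesgue_integral
  interpret pair_sigma_finite \<sigma> \<sigma> by (rule pair_sigma_finite_sigma)
  obtain B where B: "B \<ge> 0"
    "\<And>y z. y \<in> sphere 0 1 \<Longrightarrow> z \<in> sphere 0 1 \<Longrightarrow> \<bar>bump_density \<theta> z y\<bar> \<le> B"
    using bump_density_bounded[OF \<theta>] by blast
  have [measurable]: "f \<in> borel_measurable \<sigma>" using f by (rule borel_measurable_integrable)
  define F where "F y z = f y * (indicator H z * bump_density \<theta> z y)" for y z
  have F_meas: "case_prod F \<in> borel_measurable (\<sigma> \<Otimes>\<^sub>M \<sigma>)"
  proof -
    have [measurable]: "(\<lambda>p. bump_density \<theta> (snd p) (fst p)) \<in> borel_measurable (\<sigma> \<Otimes>\<^sub>M \<sigma>)"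
      using borel_measurable_bump_density(2) by (simp cong: measurable_cong_sets sets_pair_measure_cong)
    have "(\<lambda>p. f (fst p) * (indicator H (snd p) * bump_density \<theta> (snd p) (fst p)))
        \<in> borel_measurable (\<sigma> \<Otimes>\<^sub>M \<sigma>)"
      by measurable
    then show ?thesis by (simp add: F_def case_prod_unfold)
  qed
  define r where "r y = (\<integral>z. \<bar>indicator H z * bump_density \<theta> z y\<bar> \<partial>\<sigma>)" for y
  have r_bd: "\<bar>r y\<bar> \<le> B" if y: "y \<in> sphere 0 1" for y
  proof -
    have "r y \<le> (\<integral>z. B \<partial>\<sigma>)" unfolding r_def
    proof (rule integral_mono_AE')
      show "AE z in \<sigma>. \<bar>indicator H z * bump_density \<theta> z y\<bar> \<le> B"
        using AE_sphere by eventually_elim (use B y in \<open>auto simp: indicator_def\<close>)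
    qed (use B in auto)
    moreover have "r y \<ge> 0" by (simp add: r_def)
    ultimately show ?thesis using prob_space by simp
  qed
  have r_meas [measurable]: "r \<in> borel_measurable borel"
  proof -
    have "(\<lambda>p. \<bar>indicator H (snd p) * bump_density \<theta> (snd p) (fst p)\<bar>) \<in> borel_measurable (borel \<Otimes>\<^sub>M \<sigma>)"
      using borel_measurable_bump_density(2)[of \<theta>]
      by (simp cong: measurable_cong_sets sets_pair_measure_cong)
    then have "case_prod (\<lambda>y z. \<bar>indicator H z * bump_density \<theta> z y\<bar>) \<in> borel_measurable (borel \<Otimes>\<^sub>M \<sigma>)"
      by (simp add: case_prod_unfold)
    from measurable_integral[OF this] show ?thesis by (simp add: r_def[abs_def])
  qed
  have F_int: "integrable (\<sigma> \<Otimes>\<^sub>M \<sigma>) (case_prod F)"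
  proof (rule Fubini_integrable[OF F_meas])
    have "(\<integral>z. norm (case_prod F (y, z)) \<partial>\<sigma>) = \<bar>f y\<bar> * r y" for y
      by (simp add: F_def r_def abs_mult)
    moreover have "integrable \<sigma> (\<lambda>y. \<bar>f y\<bar> * r y)"
      using f r_bd by (intro integrable_mult_bounded[where B = B]) auto
    ultimately show "integrable \<sigma> (\<lambda>y. \<integral>z. norm (case_prod F (y, z)) \<partial>\<sigma>)" by simp
    show "AE y in \<sigma>. integrable \<sigma> (\<lambda>z. case_prod F (y, z))"
      using AE_sphere
    proof eventually_elim
      fix y :: 'a assume y: "y \<in> sphere 0 1"
      have m: "(\<lambda>z. bump_density \<theta> z y) \<in> borel_measurable borel"
        unfolding bump_density_commute[of \<theta> _ y] by measurable
      have "integrable \<sigma> (\<lambda>z. indicator H z * bump_density \<theta> z y)"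
        by (rule integrable_AE_bounded[where B = B]) (use m B y in \<open>auto simp: indicator_def\<close>)
      then show "integrable \<sigma> (\<lambda>z. case_prod F (y, z))" by (simp add: F_def)
    qed
  qed
  have inner_z: "(\<integral>z. F y z \<partial>\<sigma>) = f y * (\<integral>z. indicator H z * bump_density \<theta> z y \<partial>\<sigma>)" for y
    by (simp add: F_def)
  have inner_y: "(\<integral>y. F y z \<partial>\<sigma>) = indicator H z * (\<integral>y. f y * bump_density \<theta> z y \<partial>\<sigma>)" for z
    unfolding F_def by (simp only: mult.left_commute[of "f _"] integral_mult_right_zero)
  show "integrable \<sigma> (\<lambda>y. f y * (\<integral>z. indicator H z * bump_density \<theta> z y \<partial>\<sigma>))"
    using integrable_fst[OF F_int] by (simp only: inner_z)
  show "integrable \<sigma> (\<lambda>z. indicator H z * (\<integral>y. f y * bump_density \<theta> z y \<partial>\<sigma>))"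
    using integrable_snd[OF F_int] by (simp only: inner_y)
  show "(\<integral>y. f y * (\<integral>z. indicator H z * bump_density \<theta> z y \<partial>\<sigma>) \<partial>\<sigma>) =
      (\<integral>z. indicator H z * (\<integral>y. f y * bump_density \<theta> z y \<partial>\<sigma>) \<partial>\<sigma>)"
    using Fubini_integral[OF F_int] by (simp only: inner_z inner_y)
qed

text \<open>Formulated for arbitrary lower bounds \<open>M\<close>, so that no minimum has to be
  attained. The points themselves are exempt because \<open>riesz s 0\<close> is 0 instead of the
  infinite value of the kernel for \<open>s \<ge> 0\<close>; they form a null set.\<close>

theorem polarization:
  "\<exists>c>0. \<forall>N\<ge>1. \<forall>x :: nat \<Rightarrow> 'a. \<forall>M :: real.
    (\<forall>i\<in>{1..N}. x i \<in> sphere 0 1) \<longrightarrow>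
    (\<forall>y\<in>sphere 0 1. y \<notin> x ` {1..N} \<longrightarrow> M \<le> (\<Sum>i=1..N. riesz s (dist y (x i)))) \<longrightarrow>
    M \<le> real N * energy - c * real N powr (s / real d)"
proof -
  obtain c1 C1 where c1: "c1 > 0" "C1 > 0"
    and mean: "\<And>\<theta> z. 0 < \<theta> \<Longrightarrow> \<theta> \<le> 1 \<Longrightarrow> z \<in> sphere 0 1 \<Longrightarrow>
      c1 * \<theta> powr ((real d - s) / 2) \<le> (\<integral>y. bump \<theta> ((dist y z)\<^sup>2) \<partial>\<sigma>)"
    and tail: "\<And>\<theta> z \<Lambda>. 0 < \<theta> \<Longrightarrow> \<theta> \<le> 1 \<Longrightarrow> z \<in> sphere 0 1 \<Longrightarrow> \<Lambda> \<ge> 1 \<Longrightarrow> \<Lambda> * \<theta> \<le> 1 \<Longrightarrow>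
      (\<integral>y. indicator {y. \<Lambda> * \<theta> \<le> (dist y z)\<^sup>2} y * bump \<theta> ((dist y z)\<^sup>2) \<partial>\<sigma>)
        \<le> C1 * \<Lambda> powr (real d / 2 - exponent) * \<theta> powr ((real d - s) / 2)"
    using integral_bump_bounds by blast
  obtain C2 where C2: "C2 > 0" and L1: "\<And>\<theta> z. 0 < \<theta> \<Longrightarrow> \<theta> \<le> 1 \<Longrightarrow> z \<in> sphere 0 1 \<Longrightarrow>
      (\<integral>y. \<bar>bump_density \<theta> z y\<bar> \<partial>\<sigma>) \<le> C2"
    using integral_bump_density_le by blast
  obtain c2 C3 where c2: "c2 > 0" and bump: "\<And>\<theta> v. \<theta> > 0 \<Longrightarrow> v \<ge> 0 \<Longrightarrow>
      c2 * (\<theta> ^ order * (\<theta> + v) powr (- exponent)) \<le> bump \<theta> v"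
    using bump_bounds by metis
  have bump_nonneg: "bump \<theta> v \<ge> 0" if "\<theta> > 0" "v \<ge> 0" for \<theta> v
    using bump[OF that] c2 that by (intro order_trans[OF _ bump[OF that]]) auto
  define e where "e = exponent - real d / 2"
  have e: "e > 0" using exponent_gt by (simp add: e_def)
  \<comment> \<open>Makes the tail at most a quarter of the lower bound for the mean. The mean will
    count with weight at least one half, so a quarter survives.\<close>
  define \<Lambda> where "\<Lambda> = max 1 ((4 * C1 / c1) powr (1 / e))"
  have \<Lambda>1: "\<Lambda> \<ge> 1" by (simp add: \<Lambda>_def)
  have \<Lambda>: "C1 * \<Lambda> powr (- e) \<le> c1 / 4"
  proof -
    have "4 * C1 / c1 = ((4 * C1 / c1) powr (1 / e)) powr e"
      using e c1 by (simp add: powr_powr)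
    also have "\<dots> \<le> \<Lambda> powr e"
      unfolding \<Lambda>_def using e by (intro powr_mono2) auto
    finally show ?thesis using c1 \<Lambda>1 by (simp add: powr_minus field_simps)
  qed
  define a where "a = (real d - s) / 2"
  \<comment> \<open>The 8 is 4 for the surviving quarter times 2, because the weight \<rho> + C2
    used below has integral at most \<open>2 * C2\<close>. The last two factors express the power of
    \<theta> through \<open>N\<close>.\<close>
  define c where "c = energy_scale * c1 / (8 * C2) * \<Lambda> powr (- a) * 2 powr (s / real d - 1)"
  have c: "c > 0" using energy_scale_pos c1 C2 \<Lambda>1 by (simp add: c_def)
  have main: "M \<le> real N * energy - c * real N powr (s / real d)"
    if N: "N \<ge> 1" and x: "\<And>i. i \<in> {1..N} \<Longrightarrow> x i \<in> sphere 0 1"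
    and M: "\<And>y. y \<in> sphere 0 1 \<Longrightarrow> y \<notin> x ` {1..N} \<Longrightarrow> M \<le> (\<Sum>i=1..N. riesz s (dist y (x i)))"
    for N and x :: "nat \<Rightarrow> 'a" and M
  proof -
    \<comment> \<open>Chosen so that \<open>N * R ^ d = 1 / 2\<close>: the caps of radius
      \<open>R\<close> around the points cover at most half of the sphere. Then \<theta> is such
      that these caps contain everything except the tails beyond \<Lambda> \<theta>.\<close>
    define R where "R = (1 / (2 * real N)) powr (1 / real d)"
    define \<theta> where "\<theta> = R\<^sup>2 / \<Lambda>"
    have R: "R > 0" "R \<le> 1" using N powr_mono2[of "1 / real d" "1 / (2 * real N)" 1]
      by (simp_all add: R_def)
    have Rd: "R ^ d = 1 / (2 * real N)"
      using R(1) dim N by (simp add: powr_realpow[symmetric] R_def powr_powr)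
    have R2: "R\<^sup>2 \<le> 1" using R by (simp add: power_le_one)
    have \<theta>: "\<theta> > 0" "\<Lambda> * \<theta> = R\<^sup>2" using R \<Lambda>1 by (simp_all add: \<theta>_def)
    have \<theta>1: "\<theta> \<le> 1" using \<theta> R2 \<Lambda>1 mult_right_mono[of 1 \<Lambda> \<theta>] by simp
    define E where "E = \<theta> powr a"
    define H where "H = {y. \<forall>i\<in>{1..N}. R < dist y (x i)}"
    have H [measurable]: "H \<in> sets borel"
    proof -
      have "H = UNIV - (\<Union>i\<in>{1..N}. cball (x i) R)" by (auto simp: H_def dist_commute not_le)
      then show ?thesis by simp
    qed
    have Hc: "measure \<sigma> (UNIV - H) \<le> 1 / 2"
    proof -
      have "UNIV - H = (\<Union>i\<in>{1..N}. {y. dist y (x i) \<le> R})" by (auto simp: H_def not_less)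
      then have "measure \<sigma> (UNIV - H) \<le> (\<Sum>i=1..N. measure \<sigma> {y. dist y (x i) \<le> R})"
        using borel_closed[OF closed_cball[of _ R]]
        by (auto intro!: finite_measure_subadditive_finite simp: cball_def dist_commute)
      also have "\<dots> \<le> (\<Sum>i=1..N. R ^ d)"
        using x R by (intro sum_mono cap_measure_le) auto
      also have "\<dots> = 1 / 2" using N by (simp add: Rd)
      finally show ?thesis .
    qed
    have H_half: "measure \<sigma> H \<ge> 1 / 2"
      using Hc prob_compl[of H] H by simp
    define f where "f y = (\<Sum>i=1..N. riesz s (dist y (x i)) - energy)" for y
    define \<rho> where "\<rho> y = (\<integral>z. indicator H z * bump_density \<theta> z y \<partial>\<sigma>)" for y
    define M0 where "M0 = M - real N * energy"
    have int_term: "integrable \<sigma> (\<lambda>y. riesz s (dist y (x i)) - energy)" if "i \<in> {1..N}" for i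
      using integrable_riesz[OF x[OF that]] by simp
    have f_int: "integrable \<sigma> f"
      unfolding f_def using int_term by (intro Bochner_Integration.integrable_sum) auto
    have f_zero: "(\<integral>y. f y \<partial>\<sigma>) = 0"
    proof -
      have "(\<integral>y. f y \<partial>\<sigma>) = (\<Sum>i=1..N. \<integral>y. riesz s (dist y (x i)) - energy \<partial>\<sigma>)"
        unfolding f_def using int_term by (intro Bochner_Integration.integral_sum) auto
      also have "\<dots> = (\<Sum>i=1..N. 0)"
      proof (rule sum.cong)
        fix i assume i: "i \<in> {1..N}"
        show "(\<integral>y. riesz s (dist y (x i)) - energy \<partial>\<sigma>) = 0"
          using integrable_riesz[OF x[OF i]] integral_riesz[OF x[OF i]] prob_space by simp
      qed simp
      finally show ?thesis by simp
    qed
    have f_ge: "AE y in \<sigma>. f y \<ge> M0"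
    proof -
      have "AE y in \<sigma>. \<forall>i\<in>{1..N}. y \<noteq> x i"
        using AE_sigma_neq x by (intro AE_finite_allI) auto
      with AE_sphere show ?thesis
      proof eventually_elim
        fix y assume "y \<in> sphere 0 1" "\<forall>i\<in>{1..N}. y \<noteq> x i"
        then have "M \<le> (\<Sum>i=1..N. riesz s (dist y (x i)))" by (intro M) auto
        then show "f y \<ge> M0" by (simp add: f_def M0_def sum_subtractf)
      qed
    qed
    have \<rho>_int: "integrable \<sigma> \<rho>"
      using Fubini_bump_density(1)[OF _ \<theta>(1) H, of "\<lambda>_. 1"] by (simp add: \<rho>_def[abs_def])
    have f\<rho>_int: "integrable \<sigma> (\<lambda>y. f y * \<rho> y)"
      unfolding \<rho>_def by (rule Fubini_bump_density(1)[OF f_int \<theta>(1) H])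
    have \<rho>_bd: "\<bar>\<rho> y\<bar> \<le> C2" if y: "y \<in> sphere 0 1" for y
    proof -
      obtain B where B: "\<And>y z. y \<in> sphere 0 1 \<Longrightarrow> z \<in> sphere 0 1 \<Longrightarrow> \<bar>bump_density \<theta> z y\<bar> \<le> B"
        using bump_density_bounded[OF \<theta>(1)] by blast
      have "\<bar>\<rho> y\<bar> \<le> (\<integral>z. \<bar>indicator H z * bump_density \<theta> y z\<bar> \<partial>\<sigma>)"
        unfolding \<rho>_def bump_density_commute[of \<theta> _ y] by (rule integral_abs_bound)
      also have "\<dots> \<le> (\<integral>z. \<bar>bump_density \<theta> y z\<bar> \<partial>\<sigma>)"
      proof (rule integral_mono_AE')
        show "integrable \<sigma> (\<lambda>z. \<bar>bump_density \<theta> y z\<bar>)"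
          by (rule integrable_AE_bounded[where B = B]) (use B y in auto)
      qed (auto simp: indicator_def)
      also have "\<dots> \<le> C2" by (rule L1[OF \<theta>(1) \<theta>1 y])
      finally show ?thesis .
    qed
    have upper: "(\<integral>y. f y * \<rho> y \<partial>\<sigma>) \<le> - (energy_scale * c1 / 4 * (real N * E))"
    proof -
      \<comment> \<open>After exchanging the integrals, a centre \<open>z\<close> contributes the
        values of its bump at the points, summed to \<open>b z\<close>, minus \<open>N\<close> times
        the mean of a bump. Over \<open>H\<close> the first part amounts to at most a quarter of
        \<open>N * (c1 * E)\<close>, the second to at least half of it.\<close>
      define b where "b z = (\<Sum>i=1..N. bump \<theta> ((dist z (x i))\<^sup>2))" for z
      have inner: "(\<integral>y. f y * bump_density \<theta> z y \<partial>\<sigma>) =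
          energy_scale * (b z - real N * (\<integral>y. bump \<theta> ((dist y z)\<^sup>2) \<partial>\<sigma>))"
        if z: "z \<in> sphere 0 1" for z
      proof -
        obtain B where B: "\<And>y z. y \<in> sphere 0 1 \<Longrightarrow> z \<in> sphere 0 1 \<Longrightarrow> \<bar>bump_density \<theta> z y\<bar> \<le> B"
          using bump_density_bounded[OF \<theta>(1)] by blast
        have "integrable \<sigma> (\<lambda>y. (riesz s (dist y (x i)) - energy) * bump_density \<theta> z y)"
          if "i \<in> {1..N}" for i
          by (rule integrable_mult_bounded[OF int_term[OF that], of _ B]) (use B z in auto)
        then have "(\<integral>y. f y * bump_density \<theta> z y \<partial>\<sigma>) =
            (\<Sum>i=1..N. \<integral>y. (riesz s (dist y (x i)) - energy) * bump_density \<theta> z y \<partial>\<sigma>)"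
          unfolding f_def sum_distrib_right by (intro Bochner_Integration.integral_sum) auto
        also have "\<dots> = (\<Sum>i=1..N. energy_scale *
            (bump \<theta> ((dist z (x i))\<^sup>2) - (\<integral>y. bump \<theta> ((dist y z)\<^sup>2) \<partial>\<sigma>)))"
          using integral_potential_bump_density[OF x z \<theta>(1)]
          by (intro sum.cong) (auto simp: dist_commute)
        also have "\<dots> = energy_scale * (b z - real N * (\<integral>y. bump \<theta> ((dist y z)\<^sup>2) \<partial>\<sigma>))"
          by (simp add: b_def sum_distrib_left[symmetric] sum_subtractf)
        finally show ?thesis .
      qed
      have ind_int: "integrable \<sigma> (\<lambda>z. indicator H z * bump \<theta> ((dist z (x i))\<^sup>2))" if "i \<in> {1..N}" for i
        unfolding mult.commute[of "indicator _ _"]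
        by (rule integrable_real_mult_indicator[OF _ integrable_bump[OF x[OF that] \<theta>(1)]]) simp
      have b_int: "integrable \<sigma> (\<lambda>z. indicator H z * b z)"
        unfolding b_def sum_distrib_left using ind_int
        by (intro Bochner_Integration.integrable_sum) auto
      have b_le: "(\<integral>z. indicator H z * b z \<partial>\<sigma>) \<le> real N * (c1 / 4 * E)"
      proof -
        have "(\<integral>z. indicator H z * b z \<partial>\<sigma>) = (\<Sum>i=1..N. \<integral>z. indicator H z * bump \<theta> ((dist z (x i))\<^sup>2) \<partial>\<sigma>)"
          unfolding b_def sum_distrib_left using ind_int
          by (intro Bochner_Integration.integral_sum) auto
        also have "\<dots> \<le> (\<Sum>i=1..N. c1 / 4 * E)"
        proof (rule sum_mono)
          fix i assume i: "i \<in> {1..N}"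
          \<comment> \<open>Only the cap around \<open>x i\<close> is kept excluded. Enlarging the
            domain increases the integral because bumps are nonnegative.\<close>
          have "(\<integral>z. indicator H z * bump \<theta> ((dist z (x i))\<^sup>2) \<partial>\<sigma>) \<le>
              (\<integral>z. indicator {y. \<Lambda> * \<theta> \<le> (dist y (x i))\<^sup>2} z * bump \<theta> ((dist z (x i))\<^sup>2) \<partial>\<sigma>)"
          proof (rule integral_mono[OF ind_int[OF i]])
            have "{y. \<Lambda> * \<theta> \<le> (dist y (x i))\<^sup>2} \<in> sets \<sigma>" by measurable
            then show "integrable \<sigma> (\<lambda>z. indicator {y. \<Lambda> * \<theta> \<le> (dist y (x i))\<^sup>2} z * bump \<theta> ((dist z (x i))\<^sup>2))"
              unfolding mult.commute[of "indicator _ _"]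
              by (rule integrable_real_mult_indicator[OF _ integrable_bump[OF x[OF i] \<theta>(1)]])
            fix z
            have "R\<^sup>2 \<le> (dist z (x i))\<^sup>2" if "z \<in> H"
              using that i R by (intro power_mono) (auto simp: H_def intro: less_imp_le)
            then show "indicator H z * bump \<theta> ((dist z (x i))\<^sup>2) \<le>
                indicator {y. \<Lambda> * \<theta> \<le> (dist y (x i))\<^sup>2} z * bump \<theta> ((dist z (x i))\<^sup>2)"
              using bump_nonneg[OF \<theta>(1)] by (auto simp: indicator_def \<theta>(2))
          qed
          also have "\<dots> \<le> C1 * \<Lambda> powr (real d / 2 - exponent) * \<theta> powr ((real d - s) / 2)"
            using tail[OF \<theta>(1) \<theta>1 x[OF i] \<Lambda>1] \<theta>(2) R2 by simp
          also have "\<dots> = C1 * \<Lambda> powr (- e) * E" by (simp add: e_def E_def a_def)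
          also have "\<dots> \<le> c1 / 4 * E" using \<Lambda> by (intro mult_right_mono) (auto simp: E_def)
          finally show "(\<integral>z. indicator H z * bump \<theta> ((dist z (x i))\<^sup>2) \<partial>\<sigma>) \<le> c1 / 4 * E" .
        qed
        finally show ?thesis by simp
      qed
      have ind_H_int: "integrable \<sigma> (\<lambda>z. indicator H z * (real N * (c1 * E)))"
        using H by (intro integrable_mult_left integrable_real_indicator) (auto simp: less_top[symmetric])
      have "(\<integral>y. f y * \<rho> y \<partial>\<sigma>) = (\<integral>z. indicator H z * (\<integral>y. f y * bump_density \<theta> z y \<partial>\<sigma>) \<partial>\<sigma>)"
        unfolding \<rho>_def by (rule Fubini_bump_density(2)[OF f_int \<theta>(1) H])
      also have "\<dots> \<le> (\<integral>z. energy_scale * (indicator H z * b z - indicator H z * (real N * (c1 * E))) \<partial>\<sigma>)"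
      proof (rule integral_mono_AE)
        show "integrable \<sigma> (\<lambda>z. indicator H z * (\<integral>y. f y * bump_density \<theta> z y \<partial>\<sigma>))"
          by (rule Fubini_bump_density(3)[OF f_int \<theta>(1) H])
        show "integrable \<sigma> (\<lambda>z. energy_scale * (indicator H z * b z - indicator H z * (real N * (c1 * E))))"
          using b_int ind_H_int by (intro integrable_mult_right Bochner_Integration.integrable_diff)
        show "AE z in \<sigma>. indicator H z * (\<integral>y. f y * bump_density \<theta> z y \<partial>\<sigma>) \<le>
            energy_scale * (indicator H z * b z - indicator H z * (real N * (c1 * E)))"
          using AE_sphere
        proof eventually_elim
          fix z :: 'a assume z: "z \<in> sphere 0 1"
          have "real N * (c1 * E) \<le> real N * (\<integral>y. bump \<theta> ((dist y z)\<^sup>2) \<partial>\<sigma>)"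
            using mean[OF \<theta>(1) \<theta>1 z] by (intro mult_left_mono) (auto simp: E_def a_def)
          then have "energy_scale * (b z - real N * (\<integral>y. bump \<theta> ((dist y z)\<^sup>2) \<partial>\<sigma>)) \<le>
              energy_scale * (b z - real N * (c1 * E))"
            using energy_scale_pos by (intro mult_left_mono) auto
          then show "indicator H z * (\<integral>y. f y * bump_density \<theta> z y \<partial>\<sigma>) \<le>
            energy_scale * (indicator H z * b z - indicator H z * (real N * (c1 * E)))"
            unfolding inner[OF z] by (auto simp: indicator_def)
        qed
      qed
      also have "\<dots> = energy_scale * ((\<integral>z. indicator H z * b z \<partial>\<sigma>) - measure \<sigma> H * (real N * (c1 * E)))"
        using b_int ind_H_int H by simp
      also have "\<dots> \<le> energy_scale * (real N * (c1 / 4 * E) - 1 / 2 * (real N * (c1 * E)))"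
        using b_le H_half c1 energy_scale_pos
        by (intro mult_left_mono diff_mono mult_right_mono) (auto simp: E_def)
      also have "\<dots> = - (energy_scale * c1 / 4 * (real N * E))" by (simp add: field_simps)
      finally show ?thesis .
    qed
    \<comment> \<open>This sign is what later allows the mean of \<rho> to be replaced by its upper
      bound \<open>C2\<close>.\<close>
    have M0: "M0 \<le> 0"
    proof -
      have "(\<integral>y. M0 \<partial>\<sigma>) \<le> (\<integral>y. f y \<partial>\<sigma>)"
        by (rule integral_mono_AE) (use f_int f_ge in auto)
      then show ?thesis using f_zero prob_space by simp
    qed
    \<comment> \<open>Adding \<open>C2\<close> makes the weight nonnegative, and does not affect the
      integral against \<open>f\<close>, which has mean zero.\<close>
    have "0 \<le> (\<integral>y. (f y - M0) * (\<rho> y + C2) \<partial>\<sigma>)"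
    proof (rule integral_nonneg_AE)
      show "AE y in \<sigma>. 0 \<le> (f y - M0) * (\<rho> y + C2)"
        using AE_sphere f_ge
      proof eventually_elim
        fix y assume "y \<in> sphere 0 1" "M0 \<le> f y"
        then show "0 \<le> (f y - M0) * (\<rho> y + C2)"
          using \<rho>_bd[of y] by (intro mult_nonneg_nonneg) auto
      qed
    qed
    also have "(\<integral>y. (f y - M0) * (\<rho> y + C2) \<partial>\<sigma>) =
        (\<integral>y. f y * \<rho> y + C2 * f y - M0 * \<rho> y - M0 * C2 \<partial>\<sigma>)"
      by (simp add: algebra_simps)
    also have "\<dots> = (\<integral>y. f y * \<rho> y \<partial>\<sigma>) + C2 * (\<integral>y. f y \<partial>\<sigma>) - M0 * (\<integral>y. \<rho> y \<partial>\<sigma>) - M0 * C2"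
      using f\<rho>_int f_int \<rho>_int prob_space by simp
    finally have lower: "M0 * (\<integral>y. \<rho> y \<partial>\<sigma>) + M0 * C2 \<le> (\<integral>y. f y * \<rho> y \<partial>\<sigma>)"
      using f_zero by simp
    have "(\<integral>y. \<rho> y \<partial>\<sigma>) \<le> (\<integral>y. C2 \<partial>\<sigma>)"
    proof (rule integral_mono_AE[OF \<rho>_int])
      show "AE y in \<sigma>. \<rho> y \<le> C2" using AE_sphere by eventually_elim (use \<rho>_bd in fastforce)
    qed simp
    then have "M0 * C2 \<le> M0 * (\<integral>y. \<rho> y \<partial>\<sigma>)"
      using M0 prob_space by (intro mult_left_mono_neg) auto
    with lower upper have "2 * (M0 * C2) \<le> - (energy_scale * c1 / 4 * (real N * E))" by linarith
    then have M0_le: "M0 \<le> - (energy_scale * c1 / (8 * C2) * (real N * E))"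
      using C2 by (simp add: field_simps)
    \<comment> \<open>Since \<open>2 * a = d - s\<close>, the power of \<open>R\<close> is
      \<open>(2 * N) powr (s / d - 1)\<close>; the factor \<open>N\<close> from the number of points
      raises the exponent to \<open>s / d\<close>.\<close>
    have NE: "real N * E = \<Lambda> powr (- a) * 2 powr (s / real d - 1) * real N powr (s / real d)"
    proof -
      have Na: "1 / (2 * real N) > 0" using N by simp
      have "E = (R\<^sup>2) powr a * \<Lambda> powr (- a)"
        using \<Lambda>1 by (simp add: E_def \<theta>_def powr_divide powr_minus_divide)
      also have "(R\<^sup>2) powr a = R powr (real d - s)"
      proof -
        have "2 * a = real d - s" by (simp add: a_def)
        moreover have "(R\<^sup>2) powr a = R powr (2 * a)" using R by (simp add: powr_powr[symmetric])
        ultimately show ?thesis by simp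
      qed
      also have "\<dots> = (2 * real N) powr (s / real d - 1)"
      proof -
        have "R powr (real d - s) = (1 / (2 * real N)) powr (1 - s / real d)"
          using dim by (simp add: R_def powr_powr diff_divide_distrib)
        also have "\<dots> = (2 * real N) powr (- (1 - s / real d))"
          using N by (simp only: powr_minus inverse_eq_divide) (simp add: powr_divide)
        finally show ?thesis by simp
      qed
      also have "\<dots> = 2 powr (s / real d - 1) * (real N powr (s / real d) / real N)"
        using N by (simp add: powr_mult powr_diff)
      finally show ?thesis using N by simp
    qed
    have "energy_scale * c1 / (8 * C2) * (real N * E) = c * real N powr (s / real d)"
      unfolding NE c_def by (simp only: mult.assoc)
    with M0_le show ?thesis unfolding M0_def by linarith
  qed
  show ?thesis using c main by blast
qed

end

lemma moebius_sphere_sphere_measure: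
  assumes "d \<ge> 1" "CARD('n::{finite,wellorder}) = d + 1"
  shows "moebius_sphere (sphere_measure :: (real^'n::_) measure) d"
proof (intro moebius_sphere.intro moebius_sphere_axioms.intro)
  show "prob_space (sphere_measure :: (real^'n::_) measure)" by (rule prob_space_sphere_measure)
  show "d \<ge> 1" by (rule assms)
  show "sets (sphere_measure :: (real^'n::_) measure) = sets borel" by (simp add: sphere_measure_def)
  show "AE x in (sphere_measure :: (real^'n::_) measure). x \<in> sphere 0 1" by (rule AE_sphere_measure)
  show "\<exists>f \<in> borel_measurable borel. f x = y \<and> (\<forall>u v. dist (f u) (f v) = dist u v) \<and>
      distr sphere_measure borel f = sphere_measure"
    if "x \<in> sphere 0 1" "y \<in> sphere 0 1" for x y :: "real^'n::_"
    by (rule sphere_rotation[OF that])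
  fix z :: "real^'n::_" and \<theta> :: real
  assume z: "z \<in> sphere 0 1" and \<theta>: "\<theta> > 0"
  have d: "CARD('n) - 1 = d" using assms by simp
  show "\<exists>\<phi> \<in> borel_measurable borel.
      (\<forall>x\<in>sphere 0 1. \<phi> x \<in> sphere 0 1 \<and> moebius_factor \<theta> z (\<phi> x) * moebius_factor \<theta> z x = 1) \<and>
      (\<forall>x\<in>sphere 0 1. \<forall>y\<in>sphere 0 1. (dist (\<phi> x) (\<phi> y))\<^sup>2 =
        moebius_factor \<theta> z x * moebius_factor \<theta> z y * (dist x y)\<^sup>2) \<and>
      distr (density sphere_measure (\<lambda>y. ennreal (moebius_factor \<theta> z y ^ d))) borel \<phi> = sphere_measure"
    using sphere_moebius[OF z \<theta>] unfolding d moebius_factor_def .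
qed

subsection \<open>Arbitrary finite index types\<close>

text \<open>A map that merely renames the coordinates pulls boxes back to boxes with the same edge
  lengths, and boxes determine Lebesgue measure.\<close>

lemma lborel_distr_basis_isometry:
  fixes T :: "'a::euclidean_space \<Rightarrow> 'b::euclidean_space"
  assumes inner: "\<And>x y. T x \<bullet> T y = x \<bullet> y" and basis: "bij_betw T Basis Basis"
    and lin: "linear T" and surj: "surj T"
  shows "distr lborel borel T = lborel"
proof (rule lborel_eqI[symmetric])
  have [measurable]: "T \<in> borel_measurable borel"
    using lin by (intro borel_measurable_continuous_onI linear_continuous_on)
      (simp add: linear_conv_bounded_linear)
  fix l u :: 'b assume le: "\<And>b. b \<in> Basis \<Longrightarrow> l \<bullet> b \<le> u \<bullet> b"
  obtain l' u' where T: "l = T l'" "u = T u'" using surj by (meson surjE)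
  have img: "Basis = T ` Basis" using basis by (simp add: bij_betw_def)
  have le': "l' \<bullet> b \<le> u' \<bullet> b" if "b \<in> Basis" for b
    using le[of "T b"] that basis by (auto simp: T inner dest: bij_betwE)
  have "T -` box l u = box l' u'"
    unfolding set_eq_iff vimage_eq mem_box img T by (simp add: inner)
  then have "emeasure (distr lborel borel T) (box l u) = emeasure lborel (box l' u')"
    by (subst emeasure_distr) auto
  also have "\<dots> = (\<Prod>b\<in>Basis. (u' - l') \<bullet> b)" using le' by (rule emeasure_lborel_box)
  also have "(\<Prod>b\<in>Basis. (u' - l') \<bullet> b) = (\<Prod>b\<in>Basis. (u - l) \<bullet> T b)"
    by (simp add: T inner_diff_left inner)
  also have "\<dots> = (\<Prod>b\<in>Basis. (u - l) \<bullet> b)"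
    by (rule prod.reindex_bij_betw[OF basis])
  finally show "emeasure (distr lborel borel T) (box l u) = (\<Prod>b\<in>Basis. (u - l) \<bullet> b)" .
qed simp

lemma sphere_measure_distr_basis_isometry:
  fixes T :: "'a::euclidean_space \<Rightarrow> 'b::euclidean_space"
  assumes inner: "\<And>x y. T x \<bullet> T y = x \<bullet> y" and basis: "bij_betw T Basis Basis"
    and lin: "linear T" and surj: "surj T"
  shows "distr sphere_measure borel T = sphere_measure"
proof -
  have T [measurable]: "T \<in> borel_measurable borel"
    using lin by (intro borel_measurable_continuous_onI linear_continuous_on)
      (simp add: linear_conv_bounded_linear)
  have norm_T: "norm (T x) = norm x" for x by (simp add: norm_eq_sqrt_inner inner)
  have lborel: "emeasure lborel (T -` A) = emeasure lborel A" if "A \<in> sets borel" for A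
    using lborel_distr_basis_isometry[OF assms] that emeasure_distr[of T lborel borel A] by simp
  have ball: "T -` ball 0 1 = ball 0 1" by (auto simp: norm_T)
  have U: "distr (uniform_measure lborel (ball 0 1)) borel T = uniform_measure lborel (ball 0 1)"
  proof (rule measure_eqI)
    fix A assume "A \<in> sets (distr (uniform_measure lborel (ball 0 1)) borel T)"
    then have A: "A \<in> sets borel" by simp
    have TA: "T -` A \<in> sets borel" using measurable_sets[OF T A] by simp
    have "emeasure (distr (uniform_measure lborel (ball 0 1)) borel T) A =
        emeasure (uniform_measure lborel (ball 0 1)) (T -` A)"
      using A by (subst emeasure_distr) auto
    also have "\<dots> = emeasure lborel (ball 0 1 \<inter> T -` A) / emeasure lborel (ball (0::'a) 1)"
      using TA by (subst emeasure_uniform_measure) auto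
    also have "ball 0 1 \<inter> T -` A = T -` (ball 0 1 \<inter> A)" using ball by auto
    also have "emeasure lborel \<dots> = emeasure lborel (ball 0 1 \<inter> A)" using A by (intro lborel) auto
    also have "emeasure lborel (ball (0::'a) 1) = emeasure lborel (ball (0::'b) 1)"
      using lborel[of "ball 0 1"] ball by simp
    finally show "emeasure (distr (uniform_measure lborel (ball 0 1)) borel T) A =
        emeasure (uniform_measure lborel (ball 0 1)) A"
      using A by simp
  qed simp
  have "distr sphere_measure borel T =
      distr (uniform_measure lborel (ball 0 1)) borel (T \<circ> (\<lambda>x. x /\<^sub>R norm x))"
    unfolding sphere_measure_def by (rule distr_distr) measurable
  also have "T \<circ> (\<lambda>x. x /\<^sub>R norm x) = (\<lambda>x. x /\<^sub>R norm x) \<circ> T"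
    by (simp add: fun_eq_iff norm_T linear_cmul[OF lin])
  also have "distr (uniform_measure lborel (ball 0 1)) borel ((\<lambda>x. x /\<^sub>R norm x) \<circ> T) =
      distr (distr (uniform_measure lborel (ball 0 1)) borel T) borel (\<lambda>x. x /\<^sub>R norm x)"
    by (rule distr_distr[symmetric]) measurable
  finally show ?thesis by (simp add: U sphere_measure_def)
qed

text \<open>
  The library states the change of variables formula for \<open>real^'n\<close> with a well-ordered index
  type only. An arbitrary finite index type is replaced by a copy carrying the order of \<^const>\<open>to_nat\<close>.
\<close>

typedef 'a ordered_index = "UNIV :: 'a set" morphisms index_of Index by blast

instantiation ordered_index :: (countable) wellorder
begin

definition "x \<le> y \<longleftrightarrow> to_nat (index_of x) \<le> to_nat (index_of y)"
definition "x < y \<longleftrightarrow> to_nat (index_of x) < to_nat (index_of y)"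

instance
proof
  fix P :: "'a ordered_index \<Rightarrow> bool" and a
  assume step: "\<And>x. (\<And>y. y < x \<Longrightarrow> P y) \<Longrightarrow> P x"
  show "P a"
  proof (induction "to_nat (index_of a)" arbitrary: a rule: less_induct)
    case less
    show ?case by (rule step) (rule less, simp add: less_ordered_index_def)
  qed
qed (auto simp: less_eq_ordered_index_def less_ordered_index_def index_of_inject)

end

instance ordered_index :: (finite) finite
proof
  have "UNIV = range (Index :: 'a \<Rightarrow> 'a ordered_index)"
    by (metis UNIV_eq_I index_of_inverse rangeI)
  then show "finite (UNIV :: 'a ordered_index set)" by (metis finite finite_imageI)
qed

lemma bij_index_of: "bij index_of"
  by (metis bijI' index_of_inject Index_inverse UNIV_I)

lemma card_ordered_index: "CARD('a ordered_index) = CARD('a)"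
  using bij_betw_same_card[OF bij_index_of] .

text \<open>Renaming the coordinates is an isometry that preserves the sphere measure, so energy,
  potentials and admissible points correspond on both sides.\<close>

theorem sphere_polarization:
  fixes d :: nat and s :: real
  assumes "d \<ge> 1" and card: "CARD('n::finite) = d + 1" and "- 2 < s" and "s < real d"
  defines "I \<equiv> continuous_energy (riesz_kernel s) (sphere_measure :: (real ^ 'n) measure)"
  shows "\<exists>c>0. \<forall>N\<ge>1. \<forall>x :: nat \<Rightarrow> real ^ 'n. \<forall>M :: real.
    (\<forall>i\<in>{1..N}. x i \<in> sphere 0 1) \<longrightarrow>
    (\<forall>y\<in>sphere 0 1. y \<notin> x ` {1..N} \<longrightarrow> M \<le> (\<Sum>i=1..N. riesz s (dist y (x i)))) \<longrightarrow>
    M \<le> real N * I - c * real N powr (s / real d)"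
proof -
  define T :: "real ^ 'n \<Rightarrow> real ^ 'n ordered_index" where "T v = (\<chi> i. v $ index_of i)" for v
  have lin: "linear T" by (auto intro!: linearI simp: T_def vec_eq_iff)
  have inner: "T x \<bullet> T y = x \<bullet> y" for x y
    unfolding T_def inner_vec_def
    using sum.reindex_bij_betw[OF bij_index_of, of "\<lambda>i. x $ i \<bullet> y $ i"] by simp
  have surj: "surj T"
  proof (rule surjI)
    show "T (\<chi> i. v $ Index i) = v" for v by (simp add: T_def vec_eq_iff index_of_inverse)
  qed
  have norm_T: "norm (T x) = norm x" for x by (simp add: norm_eq_sqrt_inner inner)
  have dist_T: "dist (T x) (T y) = dist x y" for x y
    by (simp add: dist_norm norm_T linear_diff[OF lin, symmetric])
  have inj: "inj T" by (rule injI) (metis dist_T dist_eq_0_iff)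
  have T_axis: "T (axis (index_of i) c) = axis i c" for i c
    by (simp add: T_def axis_def vec_eq_iff index_of_inject)
  have "T ` Basis = Basis"
  proof -
    have B: "(Basis :: (real ^ 'n) set) = (\<lambda>i. axis i 1) ` range (index_of :: 'n ordered_index \<Rightarrow> 'n)"
      using bij_index_of[where 'a = 'n] by (auto simp: Basis_vec_def bij_def)
    have "T ` Basis = range (\<lambda>i. axis i 1)" unfolding B image_image T_axis ..
    then show ?thesis by (auto simp: Basis_vec_def)
  qed
  then have basis: "bij_betw T Basis Basis"
    using inj by (auto simp: bij_betw_def intro: inj_on_subset)
  have T_meas [measurable]: "T \<in> borel_measurable borel"
    using lin by (intro borel_measurable_continuous_onI linear_continuous_on)
      (simp add: linear_conv_bounded_linear)
  interpret riesz_sphere "sphere_measure :: (real ^ 'n ordered_index) measure" d s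
    using assms moebius_sphere_sphere_measure[where 'n = "'n ordered_index", of d] card_ordered_index[where 'a = 'n]
    by (simp add: riesz_sphere_def riesz_sphere_axioms_def)
  have sets_eq [measurable_cong]: "sets (sphere_measure :: (real ^ 'n) measure) = sets borel"
    by (simp add: sphere_measure_def)
  interpret S: prob_space "sphere_measure :: (real ^ 'n) measure" by (rule prob_space_sphere_measure)
  have "energy = (\<integral>x. \<integral>y. riesz s (dist x y) \<partial>distr sphere_measure borel T \<partial>distr sphere_measure borel T)"
    by (simp add: energy_def continuous_energy_def real_of_riesz_kernel
        sphere_measure_distr_basis_isometry[OF inner basis lin surj])
  also have "\<dots> = (\<integral>x. \<integral>y. riesz s (dist x (T y)) \<partial>sphere_measure \<partial>distr sphere_measure borel T)"
    by (simp add: integral_distr)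
  also have "\<dots> = (\<integral>x. \<integral>y. riesz s (dist (T x) (T y)) \<partial>sphere_measure \<partial>sphere_measure)"
    by (rule integral_distr) measurable
  also have "\<dots> = I"
    by (simp add: I_def continuous_energy_def real_of_riesz_kernel dist_T)
  finally have energy: "energy = I" .
  obtain c where c: "c > 0" and pol: "\<forall>N\<ge>1. \<forall>x :: nat \<Rightarrow> real ^ 'n ordered_index. \<forall>M :: real.
    (\<forall>i\<in>{1..N}. x i \<in> sphere 0 1) \<longrightarrow>
    (\<forall>y\<in>sphere 0 1. y \<notin> x ` {1..N} \<longrightarrow> M \<le> (\<Sum>i=1..N. riesz s (dist y (x i)))) \<longrightarrow>
    M \<le> real N * energy - c * real N powr (s / real d)"
    using polarization by blast
  have "M \<le> real N * I - c * real N powr (s / real d)"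
    if N: "N \<ge> 1" and x: "\<And>i. i \<in> {1..N} \<Longrightarrow> x i \<in> sphere 0 1"
    and M: "\<And>y. y \<in> sphere 0 1 \<Longrightarrow> y \<notin> x ` {1..N} \<Longrightarrow> M \<le> (\<Sum>i=1..N. riesz s (dist y (x i)))"
    for N and x :: "nat \<Rightarrow> real ^ 'n" and M
    unfolding energy[symmetric]
  proof (rule pol[rule_format, OF N])
    show "T (x i) \<in> sphere 0 1" if "i \<in> {1..N}" for i
      using x[OF that] by (simp add: norm_T)
    fix y assume y: "y \<in> sphere (0 :: real ^ 'n ordered_index) 1" "y \<notin> (\<lambda>i. T (x i)) ` {1..N}"
    obtain v where v: "y = T v" using surj by blast
    then have "M \<le> (\<Sum>i=1..N. riesz s (dist v (x i)))"
      using y by (intro M) (auto simp: norm_T)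
    then show "M \<le> (\<Sum>i=1..N. riesz s (dist y (T (x i))))" by (simp add: v dist_T)
  qed
  with c show ?thesis by blast
qed


subsection \<open>Greedy sequences\<close>

lemma discrete_energy_Suc:
  assumes sym: "\<And>u v. K u v = K v u"
  shows "discrete_energy K x (Suc N) = discrete_energy K x N + 2 * (\<Sum>i=1..N. K (x (Suc N)) (x i))"
proof -
  have "(\<Sum>i\<in>{1..Suc N}. \<Sum>j\<in>{i<..Suc N}. K (x i) (x j)) =
      (\<Sum>i\<in>{1..N}. \<Sum>j\<in>{i<..Suc N}. K (x i) (x j))" by simp
  also have "\<dots> = (\<Sum>i\<in>{1..N}. (\<Sum>j\<in>{i<..N}. K (x i) (x j)) + K (x (Suc N)) (x i))"
  proof (rule sum.cong)
    fix i assume "i \<in> {1..N}"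
    then have "{i<..Suc N} = insert (Suc N) {i<..N}" by auto
    then show "(\<Sum>j\<in>{i<..Suc N}. K (x i) (x j)) = (\<Sum>j\<in>{i<..N}. K (x i) (x j)) + K (x (Suc N)) (x i)"
      by (simp add: sym[of "x i"] add.commute)
  qed simp
  finally show ?thesis
    by (simp add: discrete_energy_def sum.distrib ereal_pos_distrib)
qed

lemma riesz_kernel_commute: "riesz_kernel s x y = riesz_kernel s y x"
  by (simp add: riesz_kernel_def dist_commute)

lemma riesz_kernel_not_minus_infty: "riesz_kernel s x y \<noteq> -\<infinity>"
  by (simp add: riesz_kernel_def)

text \<open>A connected finite set has at most one point, but the sphere contains antipodal pairs.
  This provides a point where the potential of finitely many points is finite.\<close>

lemma infinite_unit_sphere:
  assumes "DIM('a::euclidean_space) \<ge> 2"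
  shows "infinite (sphere (0::'a) 1)"
proof
  assume fin: "finite (sphere (0::'a) 1)"
  obtain v :: 'a where v: "norm v = 1" using vector_choose_size[of 1] by auto
  from fin have "sphere (0::'a) 1 = {} \<or> (\<exists>a. sphere (0::'a) 1 = {a})"
    using connected_finite_iff_sing[OF connected_sphere[OF assms]] by blast
  moreover have "v \<in> sphere 0 1" "- v \<in> sphere 0 1" using v by simp_all
  ultimately have "v = - v" by (metis empty_iff singletonD)
  then show False using v by (simp add: eq_neg_iff_add_eq_0 flip: scaleR_2)
qed

lemma greedy_sequence_in_sphere:
  assumes "greedy_sequence K m x" "i \<ge> 1"
  shows "x i \<in> sphere 0 1"
proof (cases "i \<le> m")
  case False
  then have "i - 1 \<ge> m" "i - 1 + 1 = i" using assms(2) by auto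
  then show ?thesis using assms(1) by (metis greedy_sequence_def is_arg_min_def)
qed (use assms in \<open>auto simp: greedy_sequence_def\<close>)

text \<open>The minimal value is finite because some point of the sphere avoids all singularities.
  It is therefore a real lower bound of the kind required by the polarization estimate, even where
  the kernel takes infinite values.\<close>

lemma greedy_potential:
  fixes x :: "nat \<Rightarrow> 'a::euclidean_space"
  assumes greedy: "greedy_sequence (riesz_kernel s) m x" and N: "N \<ge> m" and dim: "DIM('a) \<ge> 2"
  shows "\<exists>u. (\<Sum>i=1..N. riesz_kernel s (x (Suc N)) (x i)) = ereal u \<and>
    (\<forall>y\<in>sphere 0 1. y \<notin> x ` {1..N} \<longrightarrow> u \<le> (\<Sum>i=1..N. riesz s (dist y (x i))))"
proof -
  let ?U = "\<lambda>y. \<Sum>i=1..N. riesz_kernel s y (x i)"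
  have U_eq: "?U y = ereal (\<Sum>i=1..N. riesz s (dist y (x i)))" if "y \<notin> x ` {1..N}" for y
  proof -
    have "?U y = (\<Sum>i=1..N. ereal (riesz s (dist y (x i))))"
      using that by (intro sum.cong riesz_kernel_eq) auto
    then show ?thesis by simp
  qed
  have min: "?U (x (Suc N)) \<le> ?U y" if "y \<in> sphere 0 1" for y
    using greedy N that unfolding greedy_sequence_def is_arg_min_def
    by (metis Suc_eq_plus1 not_less)
  obtain y where y: "y \<in> sphere 0 1" "y \<notin> x ` {1..N}"
    using infinite_unit_sphere[OF dim] by (meson finite_atLeastAtMost finite_imageI finite_subset subsetI)
  have "?U (x (Suc N)) \<noteq> \<infinity>" using min[OF y(1)] U_eq[OF y(2)] by auto
  moreover have "?U (x (Suc N)) \<noteq> -\<infinity>"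
  proof -
    have "sum f A \<noteq> -\<infinity>" if "\<And>i. f i \<noteq> -\<infinity>" for f :: "nat \<Rightarrow> ereal" and A
      by (induction A rule: infinite_finite_induct) (use that in auto)
    from this[OF riesz_kernel_not_minus_infty] show ?thesis .
  qed
  ultimately obtain u where u: "?U (x (Suc N)) = ereal u" by (cases "?U (x (Suc N))") auto
  have "u \<le> (\<Sum>i=1..N. riesz s (dist y (x i)))" if "y \<in> sphere 0 1" "y \<notin> x ` {1..N}" for y
    using min[OF that(1)] unfolding u U_eq[OF that(2)] by simp
  with u show ?thesis by blast
qed

section \<open>Comparison of the summed gains with powers and logarithms\<close>

text \<open>The mean value theorem gives a power of an intermediate point, which is at most
  \<open>2 * k\<close>. The factor 2 suffices for \<open>0 \<le> a \<le> 1\<close>, and for negative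
  \<open>a\<close> the power is decreasing.\<close>

lemma powr_Suc_diff_le:
  fixes a :: real
  assumes "- 1 < a" "a \<le> 1" "k \<ge> 1"
  shows "real (Suc k) powr (1 + a) - real k powr (1 + a) \<le> 2 * (1 + a) * real k powr a"
proof -
  have "\<exists>\<xi>. real k < \<xi> \<and> \<xi> < real (Suc k) \<and>
      real (Suc k) powr (1 + a) - real k powr (1 + a) = (real (Suc k) - real k) * ((1 + a) * \<xi> powr a)"
    by (rule MVT2) (use assms in \<open>auto intro!: derivative_eq_intros\<close>)
  then obtain \<xi> where \<xi>: "real k < \<xi>" "\<xi> < real (Suc k)"
    "real (Suc k) powr (1 + a) - real k powr (1 + a) = (1 + a) * \<xi> powr a" by auto
  have "\<xi> powr a \<le> 2 * real k powr a"
  proof (cases "a \<ge> 0")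
    case True
    have "\<xi> powr a \<le> (2 * real k) powr a" using \<xi> assms True by (intro powr_mono2) auto
    also have "\<dots> = 2 powr a * real k powr a" by (simp add: powr_mult)
    also have "\<dots> \<le> 2 powr 1 * real k powr a" using assms by (intro mult_right_mono powr_mono) auto
    finally show ?thesis by simp
  next
    case False
    have "\<xi> powr a \<le> real k powr a" using \<xi> assms False by (intro powr_mono2') auto
    moreover have "0 \<le> real k powr a" by simp
    ultimately show ?thesis by linarith
  qed
  then have "(1 + a) * \<xi> powr a \<le> (1 + a) * (2 * real k powr a)"
    using assms by (intro mult_left_mono) auto
  then show ?thesis unfolding \<xi>(3) by (simp only: mult_ac)
qed

lemma powr_diff_le_sum:
  fixes a :: real
  assumes "- 1 < a" "a \<le> 1" "1 \<le> m" "m \<le> N"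
  shows "real N powr (1 + a) - real m powr (1 + a) \<le> 2 * (1 + a) * (\<Sum>k=m..<N. real k powr a)"
  using assms(4)
proof (induction N rule: dec_induct)
  case (step N)
  then show ?case using powr_Suc_diff_le[OF assms(1,2), of N] assms(3)
    by (simp add: distrib_left)
qed simp

lemma ln_diff_le_sum:
  assumes "1 \<le> m" "m \<le> N"
  shows "ln (real N) - ln (real m) \<le> (\<Sum>k=m..<N. real k powr (- 1))"
  using assms(2)
proof (induction N rule: dec_induct)
  case (step N)
  have "ln (real (Suc N)) - ln (real N) \<le> real N powr (- 1)"
  proof -
    have "real (Suc N) / real N = 1 + 1 / real N" using step assms by (simp add: field_simps)
    then have "ln (real (Suc N)) - ln (real N) = ln (1 + 1 / real N)"
      using step assms ln_div[of "real (Suc N)" "real N"] by simp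
    also have "\<dots> \<le> 1 / real N" using ln_add_one_self_le_self[of "1 / real N"] by simp
    finally show ?thesis by (simp add: powr_minus_divide)
  qed
  with step show ?case by simp
qed simp

text \<open>Each step adds at most twice the polarization bound. Since 2 N = (N + 1)^2 - N^2 - 1,
  the linear terms telescope to the difference of squares minus \<open>N - m\<close>, and only the
  sum of the gains is left to be estimated.\<close>

lemma greedy_energy_le:
  fixes x :: "nat \<Rightarrow> 'a::euclidean_space"
  assumes greedy: "greedy_sequence (riesz_kernel s) m x" and dim: "DIM('a) \<ge> 2" and "m \<ge> 1" "m \<le> N"
    and pol: "\<And>N M. N \<ge> 1 \<Longrightarrow>
      (\<And>y. y \<in> sphere 0 1 \<Longrightarrow> y \<notin> x ` {1..N} \<Longrightarrow> M \<le> (\<Sum>i=1..N. riesz s (dist y (x i)))) \<Longrightarrow>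
      M \<le> real N * I - c * real N powr a"
  shows "discrete_energy (riesz_kernel s) x N \<le> discrete_energy (riesz_kernel s) x m +
    ereal (I * ((real N)\<^sup>2 - (real m)\<^sup>2) - I * (real N - real m) - 2 * c * (\<Sum>k=m..<N. real k powr a))"
  using assms(4)
proof (induction N rule: dec_induct)
  case (step N)
  let ?E = "discrete_energy (riesz_kernel s) x"
  let ?r = "\<lambda>N. I * ((real N)\<^sup>2 - (real m)\<^sup>2) - I * (real N - real m) - 2 * c * (\<Sum>k=m..<N. real k powr a)"
  obtain u where u: "(\<Sum>i=1..N. riesz_kernel s (x (Suc N)) (x i)) = ereal u"
    "\<forall>y\<in>sphere 0 1. y \<notin> x ` {1..N} \<longrightarrow> u \<le> (\<Sum>i=1..N. riesz s (dist y (x i)))"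
    using greedy_potential[OF greedy step(1) dim] by blast
  have "u \<le> real N * I - c * real N powr a"
    using u(2) step assms(3) by (intro pol) auto
  then have "?r N + 2 * u \<le> ?r N + 2 * (real N * I - c * real N powr a)" by simp
  also have "\<dots> = ?r (Suc N)"
    using step by (simp add: power2_eq_square algebra_simps)
  finally have le: "?r N + 2 * u \<le> ?r (Suc N)" .
  have "?E (Suc N) = ?E N + 2 * ereal u"
    unfolding u(1)[symmetric] by (rule discrete_energy_Suc) (rule riesz_kernel_commute)
  also have "2 * ereal u = ereal (2 * u)" by (simp only: numeral_eq_ereal times_ereal.simps)
  also have "?E N + ereal (2 * u) \<le> (?E m + ereal (?r N)) + ereal (2 * u)"
    using step by (intro add_right_mono) auto
  also have "\<dots> = ?E m + ereal (?r N + 2 * u)" by (simp add: add.assoc)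
  also have "\<dots> \<le> ?E m + ereal (?r (Suc N))" using le by (intro add_left_mono) simp
  finally show ?case .
qed simp

theorem theorem2p3:
  fixes d :: nat and s :: real
  assumes "d \<ge> 1" and "CARD('n::finite) = d + 1" and "- 2 < s" and "s < real d"
  defines "I \<equiv> continuous_energy (riesz_kernel s) (sphere_measure :: (real ^ 'n) measure)"
  shows "\<exists>C > 0. \<exists>A \<ge> 0. \<forall>m \<ge> 1. \<forall>x :: nat \<Rightarrow> real ^ 'n.
    greedy_sequence (riesz_kernel s) m x \<longrightarrow>
    (\<forall>N > m.
      (0 \<le> s \<longrightarrow>
        discrete_energy (riesz_kernel s) x N \<le>
          ereal (I * ((real N)\<^sup>2 - (real m)\<^sup>2)
                 - C * (real N powr (1 + s / real d) - real m powr (1 + s / real d))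
                 - I * (real N - real m))
          + discrete_energy (riesz_kernel s) x m
          + ereal (A * real N powr (s / real d))) \<and>
      ((d \<ge> 2 \<and> s \<le> 0) \<or> (d = 1 \<and> - 1 < s \<and> s \<le> 0) \<longrightarrow>
        discrete_energy (riesz_kernel s) x N \<le>
          ereal (I * ((real N)\<^sup>2 - (real m)\<^sup>2)
                 - I * (real N - real m)
                 - C * (real N powr (1 + s / real d) - real m powr (1 + s / real d)))
          + discrete_energy (riesz_kernel s) x m
          + ereal A) \<and>
      (d = 1 \<and> s = - 1 \<longrightarrow>
        discrete_energy (riesz_kernel s) x N \<le>
          ereal (I * ((real N)\<^sup>2 - (real m)\<^sup>2)
                 - I * (real N - real m)
                 - C * (ln (real N) - ln (real m)))
          + discrete_energy (riesz_kernel s) x m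
          + ereal A) \<and>
      (d = 1 \<and> s < - 1 \<longrightarrow>
        discrete_energy (riesz_kernel s) x N \<le>
          ereal (I * ((real N)\<^sup>2 - (real m)\<^sup>2)
                 - I * (real N - real m))
          + discrete_energy (riesz_kernel s) x m
          + ereal (A * real N powr (1 + s))
          + ereal (A * real m powr (1 + s))))"
proof -
  define a where "a = s / real d"
  obtain c where c: "c > 0" and pol: "\<forall>N\<ge>1. \<forall>x :: nat \<Rightarrow> real ^ 'n. \<forall>M :: real.
    (\<forall>i\<in>{1..N}. x i \<in> sphere 0 1) \<longrightarrow>
    (\<forall>y\<in>sphere 0 1. y \<notin> x ` {1..N} \<longrightarrow> M \<le> (\<Sum>i=1..N. riesz s (dist y (x i)))) \<longrightarrow>
    M \<le> real N * I - c * real N powr a"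
    using sphere_polarization[OF assms(1-4)] unfolding I_def a_def by blast
  \<comment> \<open>The first value cancels the factor \<open>1 + a\<close> of the mean value
    estimate; \<open>2 * c\<close> serves the logarithm at \<open>a = - 1\<close>. For
    \<open>a < - 1\<close> only the nonnegativity of the gain is used.\<close>
  define C where "C = (if a > - 1 then c / (1 + a) else 2 * c)"
  have C: "C > 0" using c by (simp add: C_def)
  have a1: "a \<le> 1" using assms by (simp add: a_def)
  have dim: "DIM(real ^ 'n) \<ge> 2" using assms by simp
  have energy: "discrete_energy (riesz_kernel s) x N \<le> ereal b + discrete_energy (riesz_kernel s) x m"
    if greedy: "greedy_sequence (riesz_kernel s) m x" and m: "m \<ge> 1" "m < N"
    and b: "I * ((real N)\<^sup>2 - (real m)\<^sup>2) - I * (real N - real m) - 2 * c * (\<Sum>k=m..<N. real k powr a) \<le> b"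
    for m N b and x :: "nat \<Rightarrow> real ^ 'n"
  proof -
    have "discrete_energy (riesz_kernel s) x N \<le> discrete_energy (riesz_kernel s) x m +
      ereal (I * ((real N)\<^sup>2 - (real m)\<^sup>2) - I * (real N - real m) - 2 * c * (\<Sum>k=m..<N. real k powr a))"
    proof (rule greedy_energy_le[OF greedy dim m(1)])
      show "M \<le> real N * I - c * real N powr a"
        if "N \<ge> 1" "\<And>y. y \<in> sphere 0 1 \<Longrightarrow> y \<notin> x ` {1..N} \<Longrightarrow> M \<le> (\<Sum>i=1..N. riesz s (dist y (x i)))"
        for N M
        using that greedy_sequence_in_sphere[OF greedy]
        by (intro pol[rule_format, of N x M]) auto
    qed (use m in simp)
    also have "\<dots> \<le> discrete_energy (riesz_kernel s) x m + ereal b"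
      using b by (intro add_left_mono) simp
    finally show ?thesis by (simp add: add.commute)
  qed
  have power_gain: "C * (real N powr (1 + a) - real m powr (1 + a)) \<le> 2 * c * (\<Sum>k=m..<N. real k powr a)"
    if "a > - 1" "m \<ge> 1" "m < N" for m N :: nat
  proof -
    have "C * (real N powr (1 + a) - real m powr (1 + a)) \<le> C * (2 * (1 + a) * (\<Sum>k=m..<N. real k powr a))"
      using powr_diff_le_sum[of a m N] that a1 C by (intro mult_left_mono) auto
    also have "\<dots> = 2 * (C * (1 + a)) * (\<Sum>k=m..<N. real k powr a)" by (simp only: mult_ac)
    also have "C * (1 + a) = c" using that by (simp add: C_def)
    finally show ?thesis .
  qed
  have log_gain: "C * (ln (real N) - ln (real m)) \<le> 2 * c * (\<Sum>k=m..<N. real k powr a)"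
    if "a = - 1" "m \<ge> 1" "m < N" for m N :: nat
    using ln_diff_le_sum[of m N] that c by (simp add: C_def)
  have gain: "0 \<le> 2 * c * (\<Sum>k=m..<N. real k powr a)" for m N :: nat
    using c by (intro mult_nonneg_nonneg sum_nonneg) auto
  \<comment> \<open>For \<open>d \<ge> 2\<close> this follows from \<open>s > - 2 \<ge> - d\<close>;
    for \<open>d = 1\<close> it needs \<open>s > - 1\<close>, which is why the case distinction of
    the theorem concerns the circle.\<close>
  have a_gt: "a > - 1" if "0 \<le> s \<or> d \<ge> 2 \<or> - 1 < s"
  proof -
    have "- real d < s" using that assms(1,3) by auto
    then show ?thesis using assms(1) by (simp add: a_def field_simps)
  qed
  show ?thesis
  \<comment> \<open>The remainder constant is 0, because the gains are compared with differences of
    powers or logarithms exactly from \<open>m\<close> to \<open>N\<close>.\<close>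
  proof (rule exI[of _ C], rule conjI[OF C], rule exI[of _ 0], rule conjI[OF order_refl],
      intro conjI allI impI)
    fix m :: nat and x :: "nat \<Rightarrow> real ^ 'n" and N :: nat
    assume m: "1 \<le> m" and greedy: "greedy_sequence (riesz_kernel s) m x" and N: "m < N"
    note bound = energy[OF greedy m N]
    { assume "0 \<le> s"
      then show "discrete_energy (riesz_kernel s) x N \<le>
          ereal (I * ((real N)\<^sup>2 - (real m)\<^sup>2)
                 - C * (real N powr (1 + s / real d) - real m powr (1 + s / real d))
                 - I * (real N - real m))
          + discrete_energy (riesz_kernel s) x m
          + ereal (0 * real N powr (s / real d))"
        using power_gain[OF a_gt m N] bound by (simp add: a_def) }
    { assume "d \<ge> 2 \<and> s \<le> 0 \<or> d = 1 \<and> - 1 < s \<and> s \<le> 0"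
      then show "discrete_energy (riesz_kernel s) x N \<le>
          ereal (I * ((real N)\<^sup>2 - (real m)\<^sup>2)
                 - I * (real N - real m)
                 - C * (real N powr (1 + s / real d) - real m powr (1 + s / real d)))
          + discrete_energy (riesz_kernel s) x m
          + ereal 0"
        using power_gain[OF a_gt m N] bound by (auto simp: a_def) }
    { assume "d = 1 \<and> s = - 1"
      then show "discrete_energy (riesz_kernel s) x N \<le>
          ereal (I * ((real N)\<^sup>2 - (real m)\<^sup>2)
                 - I * (real N - real m)
                 - C * (ln (real N) - ln (real m)))
          + discrete_energy (riesz_kernel s) x m
          + ereal 0"
        using log_gain[OF _ m N] bound by (simp add: a_def) }
    { assume "d = 1 \<and> s < - 1"
      show "discrete_energy (riesz_kernel s) x N \<le>
          ereal (I * ((real N)\<^sup>2 - (real m)\<^sup>2)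
                 - I * (real N - real m))
          + discrete_energy (riesz_kernel s) x m
          + ereal (0 * real N powr (1 + s))
          + ereal (0 * real m powr (1 + s))"
        using gain[of m N] bound by simp }
  qed
qed

end
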